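(* Let $p$ be an odd prime and let $f=\sum a_nq^n\in S_k(\Gamma_1(N),\overline{\mathbb Q_p})$, with $k\ge 2$ and $p\nmid N$, be a cuspidal eigen-newform which is non-ordinary at $p$ (i.e. $a_p\notin\mathcal O^\times$) and whose residual representation $\overline\rho_f$ is absolutely irreducible. Suppose that $p>k-1$ and that $\mu^\sharp(f)=\mu^\flat(f)\neq\infty$. Then for all sufficiently large $n$, $$\mu(\Theta_n(f))=\mu^\star(f),\qquad \lambda(\Theta_n(f))=(k-1)q_n+\lambda^\star(f),$$ where $\star=\flat$ if $n$ is odd and $\star=\sharp$ if $n$ is even.
   Context: **Forms.** Fix an embedding $\overline{\mathbb Q}\hookrightarrow\overline{\mathbb Q_p}$. $f=\sum a_nq^n$ is a normalized cuspidal eigen-newform of weight $k\ge2$, level $\Gamma_1(N)$, $p\nmid N$, nebentype $\epsilon$. $K/\mathbb Q_p$ is a finite extension containing all $a_n$ (and the values of $\epsilon$), with ring of integers $\mathcal O$, uniformizer $\varpi$, residue field $\mathbb F$. $\rho_f$ is Deligne's $K$-linear representation and $\overline\rho_f$ its reduction. **Modular symbols.** For a commutative ring $R$, $V_{k-2}(R)$ is the space of homogeneous polynomials of degree $k-2$ in $X,Y$ over $R$, with right action $P(X,Y)|\gamma=P(dX-cY,-bX+aY)$ for $\gamma=\begin{pmatrix}a&b\\c&d\end{pmatrix}$. $\Delta^0=\mathrm{Div}^0(\mathbb P^1(\mathbb Q))$. $H^1_c(\Gamma_1(N),V_{k-2}(R))$ is identified with the $\Gamma_1(N)$-invariants of $\mathrm{Hom}(\Delta^0,V_{k-2}(R))$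 under $(\xi|\gamma)(D)=\xi(\gamma D)|\gamma$. Set $\xi_f(\{r\}-\{s\})=2\pi i\int_s^r f(z)(zX+Y)^{k-2}dz$ and $\xi_f=\xi_f^++\xi_f^-$, where $\xi_f^\pm$ is in the $\pm1$-eigenspace of $\begin{pmatrix}-1&0\\0&1\end{pmatrix}$. There are periods $\Omega_f^\pm\in\mathbb C$ such that $\xi_f^\pm/\Omega_f^\pm$ takes values in $V_{k-2}(K)$; they are scaled so that the resulting symbols $\varphi_f^\pm\in H^1_c(\Gamma_1(N),V_{k-2}(\mathcal O))$ are cohomological, i.e. the maximum of the absolute values of the coefficients of $\varphi_f^\pm(D)$ over $D\in\Delta^0$ is $1$. They are well defined up to $\mathcal O^\times$. **Mazur–Tate elements.** $\mathcal G_n=\mathrm{Gal}(\mathbb Q(\mu_{p^n})/\mathbb Q)\cong(\mathbb Z/p^n\mathbb Z)^\times$, $\sigma_a\leftrightarrow a$; $\mathcal G_{n+1}\cong\Delta\times G_n$ with $\Delta\cong(\mathbb Z/p\mathbb Z)^\times$ and $G_n$ cyclic of order $p^n$; $\omega$ is the Teichmüller character of $\Delta$, and $\omega^i$ also denotes the induced map $K[\mathcal G_{n+1}]\to K[G_n]$. For a symbol $\varphi$ put $$\vartheta_n(\varphi)=\sum_{a\in(\mathbb Z/p^n\mathbb Z)^\times}\Big(\varphi\,\Big|\begin{pmatrix}1&-a\\0&p^n\end{pmatrix}\Big)(\{\infty\}-\{0\})\,\sigma_a=\sum_{j=0}^{k-2}\binom{k-2}{j}X^jY^{k-2-j}\vartheta_{n,j}(\varphi).$$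 For $0\le i\le p-2$, $0\le j\le k-2$, $n\ge0$, $\Theta_{n,j}(f,\omega^i)\in K[G_n]$ is the image of $\vartheta_{n+1,j}(\varphi_f^{\pm})$ under $\omega^{i-j}$, where $\pm$ is the sign of $(-1)^i$. Write $\Theta_n(f)=\Theta_{n,0}(f,\omega^0)$. Fix a topological generator $\gamma$ of $G_\infty=\varprojlim G_n$ and let $u$ be its image under the cyclotomic character. Identify $K[G_n]=K[[X]]/(\omega_n)$, $\gamma\mapsto1+X$, $\omega_n=(1+X)^{p^n}-1$; let $Q_{n,j}(f,\omega^i)\in K[X]$ (degree $<p^n$) be the polynomial corresponding to $\Theta_{n,j}(f,\omega^i)$. **Iwasawa invariants.** For nonzero $F=\sum c_iX^i$ in $K[G_n]$ (written with degree $<p^n$) or in $\mathcal O[[X]]\otimes K$: $\mu(F)=\min_i\mathrm{ord}_\varpi(c_i)$, $\lambda(F)=\min\{i:\mathrm{ord}_\varpi(c_i)=\mu(F)\}$; $\mu(0)=\lambda(0)=\infty$. **$q_n$.** $q_n=p^{n-1}-p^{n-2}+\cdots+p-1$ for even $n\ge2$; $q_n=p^{n-1}-p^{n-2}+\cdots+p^2-p$ for odd $n\ge3$. **Unbounded $p$-adic $L$-functions.** $\alpha,\beta$ are the roots of $x^2-a_px+\epsilon(p)p^{k-1}$, $K'=K(\alpha,\beta)$. For $\Upsilon\in\{\alpha,\beta\}$ and $n\ge1$, $\Theta_{n,j}(f,\Upsilon,\omega^i)=\Upsilon^{-n-1}\Theta_{n,j}(f,\omega^i)-\epsilon(p)p^{k-2}\Upsilon^{-n-2}\nu^n_{n-1}\Theta_{n-1,j}(f,\omega^i)$,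 where $\nu^n_{n-1}:K[G_{n-1}]\to K[G_n]$ sends $\sigma\in G_{n-1}$ to the sum of its preimages in $G_n$; $Q_{n,j}(f,\Upsilon,\omega^i)$ is the corresponding polynomial. $L_p(f,\Upsilon,\omega^i)\in K'[[X]]$ is the unique power series on the open unit disc, of growth order $\mathrm{ord}_p(\Upsilon)$ (Amice transform of a tempered distribution), with $L_p(f,\Upsilon,\omega^i)(u^j(1+X)-1)\equiv Q_{n,j}(f,\Upsilon,\omega^i)\bmod\omega_n$ for all $0\le j\le k-2$ and $n\ge 1$ (existence is known). **Signed $p$-adic $L$-functions (for $p>k-1$, $a_p\notin\mathcal O^\times$).** On $\mathcal O[[\pi]]$ let $\varphi$ be the $\mathcal O$-linear map $\pi\mapsto(1+\pi)^p-1$, with left inverse $\psi$, and let $\mathcal G_\infty=\varprojlim\mathcal G_n$ act by $\sigma\pi=(1+\pi)^{\chi_{\rm cyc}(\sigma)}-1$. $\mathfrak M:\mathcal O[[\mathcal G_\infty]]\to\mathcal O[[\pi]]^{\psi=0}$, $a\mapsto a\cdot(1+\pi)$, is an isomorphism. $\mathrm{Tw}^i(F)(X)=F(u^i(1+X)-1)$; $\omega_{n,h}=\prod_{j=0}^{h-1}\mathrm{Tw}^{-j}(\omega_n)$. Let $q=\varphi(\pi)/\pi$, $\delta=p/(q-\pi^{p-1})\in\mathcal O[[\pi]]^\times$, $$P_f=\begin{pmatrix}0&\frac{-1}{\epsilon(p)q^{k-1}}\\ \delta^{k-1}&\frac{a_p}{\epsilon(p)q^{k-1}}\end{pmatrix},\quad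 A_f=\begin{pmatrix}0&\frac{-1}{\epsilon(p)p^{k-1}}\\1&\frac{a_p}{\epsilon(p)p^{k-1}}\end{pmatrix},\quad Q_f=\begin{pmatrix}\alpha&-\beta\\-\alpha\beta&\alpha\beta\end{pmatrix}.$$ $C_{n,f}$ is the $2\times2$ matrix of polynomials of degree $<(k-1)p^n$ in $\mathcal O[X]$ congruent to $\mathfrak M^{-1}\big((1+\pi)\varphi^n(P_f^{-1})\cdots\varphi(P_f^{-1})\big)$ modulo $\omega_{n,k-1}$. The matrices $A_f^{n+1}C_{n,f}$ converge to $M_{\log,f}$ over $K[[X]]$, with $M_{\log,f}\equiv A_f^{n+1}C_{n,f}\bmod\omega_{n,k-1}$. It is known that there are $L_p(f,\sharp,\omega^i),L_p(f,\flat,\omega^i)\in\mathcal O[[X]]\otimes_{\mathcal O}K$ with $$\frac1{\alpha-\beta}\begin{pmatrix}L_p(f,\alpha,\omega^i)\\L_p(f,\beta,\omega^i)\end{pmatrix}=Q_f^{-1}M_{\log,f}\begin{pmatrix}L_p(f,\sharp,\omega^i)\\L_p(f,\flat,\omega^i)\end{pmatrix}$$ (this formula presupposes $\alpha\ne\beta$). For $\star\in\{\sharp,\flat\}$, $\mu^\star(f),\lambda^\star(f)$ are the Iwasawa invariants of $L_p(f,\star,\omega^0)$. *)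

theory Defs
  imports
    "HOL-Analysis.Analysis"
    "HOL-Computational_Algebra.Computational_Algebra"
    "HOL-Library.Poly_Mapping"
begin

abbreviation mat2 :: "'b::zero \<Rightarrow> 'b \<Rightarrow> 'b \<Rightarrow> 'b \<Rightarrow> 'b^2^2" where
  "mat2 a b c d \<equiv> vector [vector [a, b], vector [c, d]]"


section \<open>Local fields\<close>

text \<open>
  A field of p-adic numbers cannot be a type depending on the variable \<open>p\<close>.  Instead a type
  \<open>'a\<close> with a function \<open>nrm\<close> is required to be an algebraic closure of
  the p-adic completion of the rationals, with its normalized absolute value; this determines the pair
  \<open>('a, nrm)\<close> up to isometric isomorphism.  All p-adic objects (finite extensions, rings of
  integers, coefficients of power series) live inside \<open>'a\<close>.
\<close>

definition nonarch_abs :: "('a::field \<Rightarrow> real) \<Rightarrow> bool" where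
  "nonarch_abs nrm \<longleftrightarrow>
     (\<forall>x. nrm x \<ge> 0) \<and> (\<forall>x. nrm x = 0 \<longleftrightarrow> x = 0) \<and>
     (\<forall>x y. nrm (x * y) = nrm x * nrm y) \<and> (\<forall>x y. nrm (x + y) \<le> max (nrm x) (nrm y))"

definition plim :: "('a::field \<Rightarrow> real) \<Rightarrow> (nat \<Rightarrow> 'a) \<Rightarrow> 'a \<Rightarrow> bool" where
  "plim nrm s l \<longleftrightarrow> (\<lambda>n. nrm (s n - l)) \<longlonglongrightarrow> 0"

definition pcauchy :: "('a::field \<Rightarrow> real) \<Rightarrow> (nat \<Rightarrow> 'a) \<Rightarrow> bool" where
  "pcauchy nrm s \<longleftrightarrow> (\<forall>e>0. \<exists>n0. \<forall>m\<ge>n0. \<forall>n\<ge>n0. nrm (s m - s n) < e)"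

definition psuminf :: "('a::field \<Rightarrow> real) \<Rightarrow> (nat \<Rightarrow> 'a) \<Rightarrow> 'a" where
  "psuminf nrm s = (THE l. plim nrm (\<lambda>n. \<Sum>i<n. s i) l)"

definition Qp :: "('a::field_char_0 \<Rightarrow> real) \<Rightarrow> 'a set" where
  "Qp nrm = {x. \<exists>s :: nat \<Rightarrow> rat. plim nrm (\<lambda>n. of_rat (s n)) x}"

definition is_Qp_closure :: "nat \<Rightarrow> ('a::{alg_closed_field, field_char_0} \<Rightarrow> real) \<Rightarrow> bool" where
  "is_Qp_closure p nrm \<longleftrightarrow>
     prime p \<and> nonarch_abs nrm \<and> nrm (of_nat p) = 1 / real p \<and>
     (\<forall>s :: nat \<Rightarrow> rat. pcauchy nrm (\<lambda>n. of_rat (s n)) \<longrightarrow> (\<exists>x. plim nrm (\<lambda>n. of_rat (s n)) x)) \<and>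
     (\<forall>x. \<exists>P :: 'a poly. P \<noteq> 0 \<and> (\<forall>i. coeff P i \<in> Qp nrm) \<and> poly P x = 0)"

definition is_subfield :: "'a::field set \<Rightarrow> bool" where
  "is_subfield K \<longleftrightarrow> 0 \<in> K \<and> 1 \<in> K \<and>
     (\<forall>x\<in>K. \<forall>y\<in>K. x + y \<in> K \<and> x * y \<in> K) \<and> (\<forall>x\<in>K. - x \<in> K \<and> inverse x \<in> K)"

definition is_finite_ext :: "('a::field_char_0 \<Rightarrow> real) \<Rightarrow> 'a set \<Rightarrow> bool" where
  "is_finite_ext nrm K \<longleftrightarrow> is_subfield K \<and> Qp nrm \<subseteq> K \<and>
     (\<exists>B. finite B \<and> B \<subseteq> K \<and>
        (\<forall>x\<in>K. \<exists>c. (\<forall>b\<in>B. c b \<in> Qp nrm) \<and> x = (\<Sum>b\<in>B. c b * b)))"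

definition adjoin :: "'a::field set \<Rightarrow> 'a set \<Rightarrow> 'a set" where
  "adjoin K S = \<Inter>{L. is_subfield L \<and> K \<union> S \<subseteq> L}"

definition int_ring :: "('a::field \<Rightarrow> real) \<Rightarrow> 'a set \<Rightarrow> 'a set" where
  "int_ring nrm K = {x \<in> K. nrm x \<le> 1}"

definition int_units :: "('a::field \<Rightarrow> real) \<Rightarrow> 'a set \<Rightarrow> 'a set" where
  "int_units nrm K = {x \<in> int_ring nrm K. x \<noteq> 0 \<and> inverse x \<in> int_ring nrm K}"

definition is_uniformizer :: "('a::field \<Rightarrow> real) \<Rightarrow> 'a set \<Rightarrow> 'a \<Rightarrow> bool" where
  "is_uniformizer nrm K \<pi> \<longleftrightarrow> \<pi> \<in> K \<and> \<pi> \<noteq> 0 \<and> nrm \<pi> < 1 \<and> (\<forall>x\<in>K. nrm x < 1 \<longrightarrow> nrm x \<le> nrm \<pi>)"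

text \<open>Reduction modulo the maximal ideal of the ring of integers of \<open>'a\<close>; the target
  \<open>'f\<close> is then an algebraic closure of the residue field of every finite extension.\<close>

definition is_residue_map :: "('a::field \<Rightarrow> real) \<Rightarrow> ('a \<Rightarrow> 'f::field) \<Rightarrow> bool" where
  "is_residue_map nrm red \<longleftrightarrow> red 1 = 1 \<and>
     (\<forall>x y. nrm x \<le> 1 \<and> nrm y \<le> 1 \<longrightarrow> red (x + y) = red x + red y \<and> red (x * y) = red x * red y) \<and>
     (\<forall>x. nrm x \<le> 1 \<longrightarrow> (red x = 0 \<longleftrightarrow> nrm x < 1)) \<and>
     (\<forall>y. \<exists>x. nrm x \<le> 1 \<and> red x = y)"

text \<open>\<open>nrm x = nrm \<pi> ^ ord x\<close>, so the base of the logarithm is less than one.\<close>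

definition ord_unif :: "('a::field \<Rightarrow> real) \<Rightarrow> 'a \<Rightarrow> 'a \<Rightarrow> ereal" where
  "ord_unif nrm \<pi> x = (if x = 0 then \<infinity> else ereal (log (nrm \<pi>) (nrm x)))"

definition mu_inv :: "('a::field \<Rightarrow> real) \<Rightarrow> 'a \<Rightarrow> (nat \<Rightarrow> 'a) \<Rightarrow> ereal" where
  "mu_inv nrm \<pi> c = (INF i. ord_unif nrm \<pi> (c i))"

definition lambda_inv :: "('a::field \<Rightarrow> real) \<Rightarrow> 'a \<Rightarrow> (nat \<Rightarrow> 'a) \<Rightarrow> enat" where
  "lambda_inv nrm \<pi> c =
     (if \<forall>i. c i = 0 then \<infinity> else enat (LEAST i. ord_unif nrm \<pi> (c i) = mu_inv nrm \<pi> c))"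

definition is_embedding :: "(complex \<Rightarrow> 'a::field) \<Rightarrow> bool" where
  "is_embedding \<iota> \<longleftrightarrow> \<iota> 1 = 1 \<and>
     (\<forall>x y. algebraic x \<and> algebraic y \<longrightarrow> \<iota> (x + y) = \<iota> x + \<iota> y \<and> \<iota> (x * y) = \<iota> x * \<iota> y)"


section \<open>Newforms\<close>

definition SL2Z :: "(int^2^2) set" where
  "SL2Z = {g. det g = 1}"

definition Gamma0 :: "nat \<Rightarrow> (int^2^2) set" where
  "Gamma0 N = {g \<in> SL2Z. int N dvd g$2$1}"

definition Gamma1 :: "nat \<Rightarrow> (int^2^2) set" where
  "Gamma1 N = {g \<in> SL2Z. int N dvd g$2$1 \<and> int N dvd g$1$1 - 1 \<and> int N dvd g$2$2 - 1}"

definition upper_half :: "complex set" where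
  "upper_half = {z. Im z > 0}"

text \<open>Only used for matrices of determinant one.\<close>

definition slash :: "nat \<Rightarrow> (complex \<Rightarrow> complex) \<Rightarrow> int^2^2 \<Rightarrow> complex \<Rightarrow> complex" where
  "slash k f g z = f ((of_int (g$1$1) * z + of_int (g$1$2)) / (of_int (g$2$1) * z + of_int (g$2$2)))
                     / (of_int (g$2$1) * z + of_int (g$2$2)) ^ k"

text \<open>The principal congruence subgroup of level \<open>N\<close> is normal, so every \<open>slash k f g\<close>
  has a Fourier expansion in \<open>exp (2 \<pi> i z / N)\<close>; cuspidality at all cusps is the absence of
  terms with nonpositive exponent.\<close>

definition cusp_form :: "nat \<Rightarrow> nat \<Rightarrow> (complex \<Rightarrow> complex) \<Rightarrow> bool" where
  "cusp_form k N f \<longleftrightarrow> f holomorphic_on upper_half \<and>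
     (\<forall>g\<in>Gamma1 N. \<forall>z\<in>upper_half. slash k f g z = f z) \<and>
     (\<forall>g\<in>SL2Z. \<exists>b :: nat \<Rightarrow> complex. \<forall>z\<in>upper_half.
        (\<lambda>n. b n * exp (2 * of_real pi * \<i> * of_nat (n + 1) * z / of_nat N)) sums slash k f g z)"

definition q_expansion :: "(complex \<Rightarrow> complex) \<Rightarrow> (nat \<Rightarrow> complex) \<Rightarrow> bool" where
  "q_expansion f a \<longleftrightarrow> a 0 = 0 \<and>
     (\<forall>z\<in>upper_half. (\<lambda>n. a n * exp (2 * of_real pi * \<i> * of_nat n * z)) sums f z)"

definition dirichlet_char :: "nat \<Rightarrow> (int \<Rightarrow> complex) \<Rightarrow> bool" where
  "dirichlet_char N \<epsilon> \<longleftrightarrow> (\<forall>m n. \<epsilon> (m * n) = \<epsilon> m * \<epsilon> n) \<and> (\<forall>m. \<epsilon> (m + int N) = \<epsilon> m) \<and>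
     (\<forall>m. \<epsilon> m \<noteq> 0 \<longleftrightarrow> coprime m (int N))"

text \<open>The Hecke operator at a prime \<open>l\<close> on forms of nebentype \<open>\<epsilon>\<close>; since
  \<open>\<epsilon> l = 0\<close> for \<open>l\<close> dividing the level, this covers the bad primes too.\<close>

definition hecke :: "nat \<Rightarrow> (int \<Rightarrow> complex) \<Rightarrow> nat \<Rightarrow> (complex \<Rightarrow> complex) \<Rightarrow> complex \<Rightarrow> complex" where
  "hecke k \<epsilon> l f z = (\<Sum>j<l. f ((z + of_nat j) / of_nat l)) / of_nat l
                      + \<epsilon> (int l) * of_nat l ^ (k - 1) * f (of_nat l * z)"

definition fund_domain :: "complex set" where
  "fund_domain = {z \<in> upper_half. \<bar>Re z\<bar> \<le> 1/2 \<and> cmod z \<ge> 1}"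

definition coset_rel :: "nat \<Rightarrow> ((int^2^2) \<times> (int^2^2)) set" where
  "coset_rel N = {(g, h). g \<in> SL2Z \<and> h \<in> SL2Z \<and> (\<exists>t\<in>Gamma1 N. h = t ** g)}"

text \<open>The Petersson product up to a positive constant: a fundamental domain of \<open>Gamma1 N\<close> is
  covered by the translates of \<open>fund_domain\<close> by coset representatives.\<close>

definition petersson :: "nat \<Rightarrow> nat \<Rightarrow> (complex \<Rightarrow> complex) \<Rightarrow> (complex \<Rightarrow> complex) \<Rightarrow> complex" where
  "petersson N k f g = (\<Sum>C\<in>SL2Z // coset_rel N. let h = (SOME h. h \<in> C) in
     (LBINT z:fund_domain. slash k f h z * cnj (slash k g h z) * of_real (Im z ^ (k - 2))))"

definition is_newform ::
  "nat \<Rightarrow> nat \<Rightarrow> (int \<Rightarrow> complex) \<Rightarrow> (complex \<Rightarrow> complex) \<Rightarrow> (nat \<Rightarrow> complex) \<Rightarrow> bool" where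
  "is_newform k N \<epsilon> f a \<longleftrightarrow>
     cusp_form k N f \<and> q_expansion f a \<and> a 1 = 1 \<and> dirichlet_char N \<epsilon> \<and>
     (\<forall>g\<in>Gamma0 N. \<forall>z\<in>upper_half. slash k f g z = \<epsilon> (g$2$2) * f z) \<and>
     (\<forall>l. prime l \<longrightarrow> (\<exists>c. \<forall>z\<in>upper_half. hecke k \<epsilon> l f z = c * f z)) \<and>
     (\<forall>M d g. M dvd N \<and> M \<noteq> N \<and> d dvd N div M \<and> cusp_form k M g \<longrightarrow>
        petersson N k f (\<lambda>z. g (of_nat d * z)) = 0)"


section \<open>The Galois representation\<close>

text \<open>Automorphisms of the field of algebraic numbers are extended by the identity to
  \<open>complex\<close>, so that composition of functions is the group law.\<close>

definition gal_Q :: "(complex \<Rightarrow> complex) set" where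
  "gal_Q = {\<sigma>. bij_betw \<sigma> {z. algebraic z} {z. algebraic z} \<and> (\<forall>z. \<not> algebraic z \<longrightarrow> \<sigma> z = z) \<and>
     (\<forall>x y. algebraic x \<and> algebraic y \<longrightarrow> \<sigma> (x + y) = \<sigma> x + \<sigma> y \<and> \<sigma> (x * y) = \<sigma> x * \<sigma> y)}"

definition prime_above :: "nat \<Rightarrow> complex set \<Rightarrow> bool" where
  "prime_above l P \<longleftrightarrow> P \<subseteq> {z. algebraic_int z} \<and> of_nat l \<in> P \<and> 1 \<notin> P \<and>
     (\<forall>x\<in>P. \<forall>y\<in>P. x + y \<in> P) \<and> (\<forall>x\<in>P. \<forall>y. algebraic_int y \<longrightarrow> y * x \<in> P) \<and>
     (\<forall>x y. algebraic_int x \<and> algebraic_int y \<and> x * y \<in> P \<longrightarrow> x \<in> P \<or> y \<in> P)"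

definition decomposition :: "complex set \<Rightarrow> (complex \<Rightarrow> complex) set" where
  "decomposition P = {\<sigma> \<in> gal_Q. \<sigma> ` P = P}"

definition inertia :: "complex set \<Rightarrow> (complex \<Rightarrow> complex) set" where
  "inertia P = {\<sigma> \<in> decomposition P. \<forall>x. algebraic_int x \<longrightarrow> \<sigma> x - x \<in> P}"

definition is_frob :: "nat \<Rightarrow> complex set \<Rightarrow> (complex \<Rightarrow> complex) \<Rightarrow> bool" where
  "is_frob l P \<sigma> \<longleftrightarrow> \<sigma> \<in> decomposition P \<and> (\<forall>x. algebraic_int x \<longrightarrow> \<sigma> x - x ^ l \<in> P)"

text \<open>Continuous for the Krull topology, unramified outside \<open>N * p\<close>, with the characteristic
  polynomials of arithmetic Frobenius elements prescribed by the eigenvalues.\<close>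

definition is_deligne_rep :: "nat \<Rightarrow> ('a::field_char_0 \<Rightarrow> real) \<Rightarrow> (complex \<Rightarrow> 'a) \<Rightarrow> 'a set \<Rightarrow>
    nat \<Rightarrow> nat \<Rightarrow> (int \<Rightarrow> complex) \<Rightarrow> (nat \<Rightarrow> complex) \<Rightarrow> ((complex \<Rightarrow> complex) \<Rightarrow> 'a^2^2) \<Rightarrow> bool" where
  "is_deligne_rep p nrm \<iota> K k N \<epsilon> a \<rho> \<longleftrightarrow>
     (\<forall>\<sigma>\<in>gal_Q. (\<forall>i j. \<rho> \<sigma> $ i $ j \<in> K) \<and> det (\<rho> \<sigma>) \<noteq> 0) \<and>
     (\<forall>\<sigma>\<in>gal_Q. \<forall>\<tau>\<in>gal_Q. \<rho> (\<sigma> \<circ> \<tau>) = \<rho> \<sigma> ** \<rho> \<tau>) \<and>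
     (\<forall>\<sigma>\<in>gal_Q. \<forall>e>0. \<exists>S. finite S \<and> S \<subseteq> {z. algebraic z} \<and>
        (\<forall>\<tau>\<in>gal_Q. (\<forall>z\<in>S. \<tau> z = \<sigma> z) \<longrightarrow> (\<forall>i j. nrm (\<rho> \<tau> $ i $ j - \<rho> \<sigma> $ i $ j) < e))) \<and>
     (\<forall>l P. prime l \<and> \<not> l dvd N * p \<and> prime_above l P \<longrightarrow>
        (\<forall>\<sigma>\<in>inertia P. \<rho> \<sigma> = mat 1) \<and>
        (\<forall>\<sigma>. is_frob l P \<sigma> \<longrightarrow>
           trace (\<rho> \<sigma>) = \<iota> (a l) \<and> det (\<rho> \<sigma>) = \<iota> (\<epsilon> (int l)) * of_nat l ^ (k - 1)))"

text \<open>Reduction of a stable lattice; the columns of \<open>inverse g\<close> are a basis of the lattice.\<close>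

definition is_reduction :: "('a::field \<Rightarrow> real) \<Rightarrow> 'a set \<Rightarrow> ('a \<Rightarrow> 'f::field) \<Rightarrow>
    ((complex \<Rightarrow> complex) \<Rightarrow> 'a^2^2) \<Rightarrow> ((complex \<Rightarrow> complex) \<Rightarrow> 'f^2^2) \<Rightarrow> bool" where
  "is_reduction nrm K red \<rho> \<rho>bar \<longleftrightarrow>
     (\<exists>g :: 'a^2^2. (\<forall>i j. g $ i $ j \<in> K) \<and> det g \<noteq> 0 \<and>
        (\<forall>\<sigma>\<in>gal_Q. let h = g ** \<rho> \<sigma> ** matrix_inv g in
           (\<forall>i j. h $ i $ j \<in> int_ring nrm K) \<and> \<rho>bar \<sigma> = map_matrix red h))"

text \<open>Irreducibility over the field of definition \<open>'f\<close>; when \<open>'f\<close> is an algebraic closure of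
  the residue field this is absolute irreducibility of the residual representation.\<close>

definition is_irreducible_rep :: "((complex \<Rightarrow> complex) \<Rightarrow> 'f::field^2^2) \<Rightarrow> bool" where
  "is_irreducible_rep \<rho>bar \<longleftrightarrow>
     (\<forall>W. vec.subspace W \<and> (\<forall>\<sigma>\<in>gal_Q. \<forall>w\<in>W. \<rho>bar \<sigma> *v w \<in> W) \<longrightarrow> W = {0} \<or> W = UNIV)"


section \<open>Modular symbols\<close>

datatype cusp = Infty | Rational rat

text \<open>A homogeneous polynomial of degree \<open>m\<close> in \<open>X, Y\<close> is encoded by its specialization at
  \<open>Y = 1\<close>, a polynomial of degree at most \<open>m\<close>: the coefficient of \<open>X^i Y^(m-i)\<close> is
  \<open>coeff P i\<close>.  Symbols are functions on divisors; only their values on \<open>Div0\<close> matter.\<close>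

type_synonym 'r msym = "(cusp \<Rightarrow>\<^sub>0 int) \<Rightarrow> 'r poly"

definition Div0 :: "(cusp \<Rightarrow>\<^sub>0 int) set" where
  "Div0 = {D. (\<Sum>c\<in>Poly_Mapping.keys D. Poly_Mapping.lookup D c) = 0}"

fun cusp_act :: "int^2^2 \<Rightarrow> cusp \<Rightarrow> cusp" where
  "cusp_act g Infty = (if g$2$1 = 0 then Infty else Rational (of_int (g$1$1) / of_int (g$2$1)))"
| "cusp_act g (Rational r) =
     (if of_int (g$2$1) * r + of_int (g$2$2) = 0 then Infty
      else Rational ((of_int (g$1$1) * r + of_int (g$1$2)) / (of_int (g$2$1) * r + of_int (g$2$2))))"

definition div_act :: "int^2^2 \<Rightarrow> (cusp \<Rightarrow>\<^sub>0 int) \<Rightarrow> (cusp \<Rightarrow>\<^sub>0 int)" where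
  "div_act g D =
     (\<Sum>c\<in>Poly_Mapping.keys D. Poly_Mapping.single (cusp_act g c) (Poly_Mapping.lookup D c))"

text \<open>\<open>P(dX - cY, -bX + aY)\<close>.\<close>

definition poly_act :: "nat \<Rightarrow> 'r::comm_ring_1 poly \<Rightarrow> int^2^2 \<Rightarrow> 'r poly" where
  "poly_act m P g = (\<Sum>i\<le>m. smult (coeff P i)
     ([:- of_int (g$2$1), of_int (g$2$2):] ^ i * [:of_int (g$1$1), - of_int (g$1$2):] ^ (m - i)))"

definition sym_act :: "nat \<Rightarrow> 'r::comm_ring_1 msym \<Rightarrow> int^2^2 \<Rightarrow> 'r msym" where
  "sym_act m \<xi> g D = poly_act m (\<xi> (div_act g D)) g"

text \<open>\<open>2 \<pi> i\<close> times the integral of \<open>f(z) (zX + Y)^m dz\<close> from \<open>i \<infinity>\<close> down the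
  vertical line to the cusp; the integral from a cusp \<open>s\<close> to a cusp \<open>r\<close> is the
  difference of two of these.\<close>

fun period_poly :: "(complex \<Rightarrow> complex) \<Rightarrow> nat \<Rightarrow> cusp \<Rightarrow> complex poly" where
  "period_poly f m Infty = 0"
| "period_poly f m (Rational r) = (\<Sum>j\<le>m. monom (2 * of_real pi * \<i> * of_nat (m choose j) *
     - (LBINT t:{0<..}. f (of_rat r + \<i> * of_real t) * (of_rat r + \<i> * of_real t) ^ j * \<i>)) j)"

definition xi_sym :: "(complex \<Rightarrow> complex) \<Rightarrow> nat \<Rightarrow> complex msym" where
  "xi_sym f m D =
     (\<Sum>c\<in>Poly_Mapping.keys D. smult (of_int (Poly_Mapping.lookup D c)) (period_poly f m c))"

text \<open>Projection to the eigenspace of \<open>diag(-1, 1)\<close> with eigenvalue \<open>s\<close> (1 or -1).\<close>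

definition xi_sign :: "(complex \<Rightarrow> complex) \<Rightarrow> nat \<Rightarrow> int \<Rightarrow> complex msym" where
  "xi_sign f m s D =
     smult (1/2) (xi_sym f m D + smult (of_int s) (sym_act m (xi_sym f m) (mat2 (-1) 0 0 1) D))"

definition is_normalized_symbol :: "('a::field \<Rightarrow> real) \<Rightarrow> (complex \<Rightarrow> 'a) \<Rightarrow> 'a set \<Rightarrow>
    (complex \<Rightarrow> complex) \<Rightarrow> nat \<Rightarrow> int \<Rightarrow> 'a msym \<Rightarrow> bool" where
  "is_normalized_symbol nrm \<iota> K f m s \<phi> \<longleftrightarrow>
     (\<exists>\<Omega>::complex. \<Omega> \<noteq> 0 \<and> (\<forall>D\<in>Div0. \<forall>i.
        algebraic (coeff (xi_sign f m s D) i / \<Omega>) \<and>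
        coeff (\<phi> D) i = \<iota> (coeff (xi_sign f m s D) i / \<Omega>) \<and> coeff (\<phi> D) i \<in> K)) \<and>
     (\<forall>D\<in>Div0. \<forall>i. nrm (coeff (\<phi> D) i) \<le> 1) \<and>
     (\<exists>D\<in>Div0. \<exists>i. nrm (coeff (\<phi> D) i) = 1)"


section \<open>Mazur--Tate elements\<close>

text \<open>The coefficient of \<open>\<sigma>\<^sub>a\<close> in the \<open>j\<close>-th component at level \<open>p^n\<close>.\<close>

definition vartheta :: "nat \<Rightarrow> nat \<Rightarrow> 'a::field_char_0 msym \<Rightarrow> nat \<Rightarrow> nat \<Rightarrow> nat \<Rightarrow> 'a" where
  "vartheta p k \<phi> n j a =
     coeff (sym_act (k - 2) \<phi> (mat2 1 (- int a) 0 (int p ^ n))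
              (Poly_Mapping.single Infty 1 - Poly_Mapping.single (Rational 0) 1)) j
       / of_nat ((k - 2) choose j)"

definition teich :: "nat \<Rightarrow> ('a::field \<Rightarrow> real) \<Rightarrow> nat \<Rightarrow> 'a" where
  "teich p nrm a = (THE z. z ^ (p - 1) = 1 \<and> nrm (z - of_nat a) < 1)"

text \<open>\<open>u\<close> topologically generates \<open>1 + p Z\<^sub>p\<close>.\<close>

definition is_generator :: "nat \<Rightarrow> ('a::field_char_0 \<Rightarrow> real) \<Rightarrow> 'a \<Rightarrow> bool" where
  "is_generator p nrm u \<longleftrightarrow> u \<in> Qp nrm \<and> nrm (u - 1) \<le> 1 / real p \<and>
     (\<forall>x\<in>Qp nrm. nrm (x - 1) \<le> 1 / real p \<longrightarrow> (\<forall>e>0. \<exists>m::nat. nrm (x - u ^ m) < e))"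

text \<open>An element of the group ring of \<open>G\<^sub>n\<close> is given by its coefficients: the value at
  \<open>m < p^n\<close> is the coefficient of \<open>\<gamma>^m\<close>.  The element \<open>\<sigma>\<^sub>a\<close> has image
  \<open>\<gamma>^m\<close> in \<open>G\<^sub>n\<close> iff \<open>a\<close> is congruent to \<open>\<omega>(a) u^m\<close> modulo
  \<open>p^(n+1)\<close>.  The family \<open>\<phi>\<close> is indexed by the signs \<open>1, -1\<close>.\<close>

definition Theta :: "nat \<Rightarrow> ('a::field_char_0 \<Rightarrow> real) \<Rightarrow> 'a \<Rightarrow> nat \<Rightarrow> (int \<Rightarrow> 'a msym) \<Rightarrow>
    nat \<Rightarrow> nat \<Rightarrow> nat \<Rightarrow> nat \<Rightarrow> 'a" where
  "Theta p nrm u k \<phi> i n j m =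
     (\<Sum>a\<in>{a. a < p ^ (n + 1) \<and> coprime a p \<and>
             nrm (of_nat a - teich p nrm a * u ^ m) \<le> 1 / real p ^ (n + 1)}.
        vartheta p k (\<phi> ((-1) ^ i)) (n + 1) j a * teich p nrm a powi (int i - int j))"

definition gr_poly :: "nat \<Rightarrow> nat \<Rightarrow> (nat \<Rightarrow> 'a::comm_ring_1) \<Rightarrow> 'a poly" where
  "gr_poly p n \<theta> = (\<Sum>m<p ^ n. smult (\<theta> m) ([:1, 1:] ^ m))"

text \<open>\<open>\<nu>\<close> from level \<open>n\<close> to level \<open>n + 1\<close>: the coefficient at an element is the one at its image.\<close>

definition nu_map :: "nat \<Rightarrow> nat \<Rightarrow> (nat \<Rightarrow> 'a) \<Rightarrow> nat \<Rightarrow> 'a" where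
  "nu_map p n \<theta> m = \<theta> (m mod p ^ n)"

text \<open>For \<open>n \<ge> 1\<close>; \<open>e\<close> is the value of the nebentype at \<open>p\<close>.\<close>

definition Theta_stab :: "nat \<Rightarrow> ('a::field_char_0 \<Rightarrow> real) \<Rightarrow> 'a \<Rightarrow> nat \<Rightarrow> 'a \<Rightarrow> (int \<Rightarrow> 'a msym) \<Rightarrow>
    'a \<Rightarrow> nat \<Rightarrow> nat \<Rightarrow> nat \<Rightarrow> nat \<Rightarrow> 'a" where
  "Theta_stab p nrm u k e \<phi> \<Upsilon> i n j m =
     Theta p nrm u k \<phi> i n j m / \<Upsilon> ^ (n + 1)
     - e * of_nat p ^ (k - 2) / \<Upsilon> ^ (n + 2) * nu_map p (n - 1) (Theta p nrm u k \<phi> i (n - 1) j) m"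


section \<open>p-adic L-functions\<close>

definition omega :: "nat \<Rightarrow> nat \<Rightarrow> 'a::comm_ring_1 poly" where
  "omega p n = [:1, 1:] ^ (p ^ n) - 1"

definition omega_h :: "nat \<Rightarrow> 'a::field \<Rightarrow> nat \<Rightarrow> nat \<Rightarrow> 'a poly" where
  "omega_h p u n h =
     (\<Prod>j<h. pcompose (omega p n) [:u powi (- int j) - 1, u powi (- int j):])"

text \<open>\<open>F(u^j (1 + X) - 1)\<close>; the constant term \<open>u^j - 1\<close> is nonzero in general, so this is not a
  formal composition and the coefficients are p-adically convergent sums.\<close>

definition Tw :: "('a::field \<Rightarrow> real) \<Rightarrow> 'a \<Rightarrow> nat \<Rightarrow> 'a fps \<Rightarrow> 'a fps" where
  "Tw nrm u j F = Abs_fps (\<lambda>i. psuminf nrm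
     (\<lambda>m. fps_nth F m * coeff ([:u ^ j - 1, u ^ j:] ^ m) i))"

definition disc_convergent :: "('a::field \<Rightarrow> real) \<Rightarrow> 'a fps \<Rightarrow> bool" where
  "disc_convergent nrm F \<longleftrightarrow> (\<forall>r\<in>{0..<1}. (\<lambda>m. nrm (fps_nth F m) * r ^ m) \<longlonglongrightarrow> 0)"

text \<open>Congruences between unbounded series are taken in the ring of series converging on the
  open unit disc: among formal power series, \<open>omega p n\<close> is associated to \<open>X\<close>.\<close>

definition disc_cong :: "('a::field \<Rightarrow> real) \<Rightarrow> 'a fps \<Rightarrow> 'a fps \<Rightarrow> 'a poly \<Rightarrow> bool" where
  "disc_cong nrm F G w \<longleftrightarrow> (\<exists>H. disc_convergent nrm H \<and> F - G = fps_of_poly w * H)"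

text \<open>Uniform convergence on all closed discs of radius less than one; the limit agrees with the
  coefficientwise one, but this topology is compatible with \<open>disc_cong\<close>.\<close>

definition disc_lim :: "('a::field \<Rightarrow> real) \<Rightarrow> (nat \<Rightarrow> 'a fps) \<Rightarrow> 'a fps \<Rightarrow> bool" where
  "disc_lim nrm S F \<longleftrightarrow>
     (\<forall>r\<in>{0..<1}. \<forall>e>0. \<exists>n0. \<forall>n\<ge>n0. \<forall>m. nrm (fps_nth (S n) m - fps_nth F m) * r ^ m < e)"

definition fps_over :: "'a set \<Rightarrow> 'a::zero fps \<Rightarrow> bool" where
  "fps_over R F \<longleftrightarrow> (\<forall>m. fps_nth F m \<in> R)"

definition ord_p :: "nat \<Rightarrow> ('a::field \<Rightarrow> real) \<Rightarrow> 'a \<Rightarrow> real" where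
  "ord_p p nrm x = - log (real p) (nrm x)"

definition growth_order :: "('a::field \<Rightarrow> real) \<Rightarrow> real \<Rightarrow> 'a fps \<Rightarrow> bool" where
  "growth_order nrm r F \<longleftrightarrow> (\<exists>C. \<forall>m\<ge>1. nrm (fps_nth F m) \<le> C * real m powr r)"

definition is_Lp :: "nat \<Rightarrow> ('a::field_char_0 \<Rightarrow> real) \<Rightarrow> 'a \<Rightarrow> 'a set \<Rightarrow> nat \<Rightarrow> 'a \<Rightarrow> (int \<Rightarrow> 'a msym) \<Rightarrow>
    'a \<Rightarrow> nat \<Rightarrow> 'a fps \<Rightarrow> bool" where
  "is_Lp p nrm u K' k e \<phi> \<Upsilon> i L \<longleftrightarrow>
     fps_over K' L \<and> growth_order nrm (ord_p p nrm \<Upsilon>) L \<and>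
     (\<forall>j\<le>k - 2. \<forall>n\<ge>1. disc_cong nrm (Tw nrm u j L)
        (fps_of_poly (gr_poly p n (Theta_stab p nrm u k e \<phi> \<Upsilon> i n j))) (omega p n))"


section \<open>The logarithmic matrix\<close>

definition frob :: "nat \<Rightarrow> 'a::comm_ring_1 fps \<Rightarrow> 'a fps" where
  "frob p F = fps_compose F ((1 + fps_X) ^ p - 1)"

definition q_ser :: "nat \<Rightarrow> 'a::field fps" where
  "q_ser p = frob p fps_X / fps_X"

definition delta_ser :: "nat \<Rightarrow> 'a::field fps" where
  "delta_ser p = of_nat p / (q_ser p - fps_X ^ (p - 1))"

text \<open>The constant term of \<open>q_ser p\<close> is \<open>p\<close>, so it is invertible over a field of
  characteristic zero.\<close>

definition P_mat :: "nat \<Rightarrow> nat \<Rightarrow> 'a::field \<Rightarrow> 'a \<Rightarrow> 'a fps^2^2" where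
  "P_mat p k e ap =
     mat2 0 (- 1 / (fps_const e * q_ser p ^ (k - 1)))
          (delta_ser p ^ (k - 1)) (fps_const ap / (fps_const e * q_ser p ^ (k - 1)))"

definition A_mat :: "nat \<Rightarrow> nat \<Rightarrow> 'a::field \<Rightarrow> 'a \<Rightarrow> 'a^2^2" where
  "A_mat p k e ap = mat2 0 (- 1 / (e * of_nat p ^ (k - 1))) 1 (ap / (e * of_nat p ^ (k - 1)))"

definition Q_mat :: "'a::field \<Rightarrow> 'a \<Rightarrow> 'a^2^2" where
  "Q_mat \<alpha> \<beta> = mat2 \<alpha> (- \<beta>) (- \<alpha> * \<beta>) (\<alpha> * \<beta>)"

fun P_prod :: "nat \<Rightarrow> nat \<Rightarrow> 'a::field \<Rightarrow> 'a \<Rightarrow> nat \<Rightarrow> 'a fps^2^2" where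
  "P_prod p k e ap 0 = mat 1"
| "P_prod p k e ap (Suc n) =
     map_matrix (frob p ^^ Suc n) (matrix_inv (P_mat p k e ap)) ** P_prod p k e ap n"

definition gamma_act :: "'a::field_char_0 \<Rightarrow> 'a fps \<Rightarrow> 'a fps" where
  "gamma_act u F = fps_compose F (fps_binomial u - 1)"

text \<open>The Mellin transform on the Iwasawa algebra of \<open>G\<^sub>\<infinity>\<close>, with \<open>\<gamma> = 1 + X\<close>: the sum of
  \<open>c\<^sub>m (\<gamma> - 1)^m\<close> applied to \<open>1 + \<pi>\<close>.  The series \<open>(1 + \<pi>) \<phi>(F)\<close> lie in its image, as
  they correspond to measures supported on \<open>1 + p Z\<^sub>p\<close>.\<close>

definition mellin :: "('a::field_char_0 \<Rightarrow> real) \<Rightarrow> 'a \<Rightarrow> 'a fps \<Rightarrow> 'a fps" where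
  "mellin nrm u G = Abs_fps (\<lambda>i. psuminf nrm
     (\<lambda>m. fps_nth G m * fps_nth (((\<lambda>F. gamma_act u F - F) ^^ m) (1 + fps_X)) i))"

definition is_C_mat :: "nat \<Rightarrow> ('a::field_char_0 \<Rightarrow> real) \<Rightarrow> 'a \<Rightarrow> 'a set \<Rightarrow> nat \<Rightarrow> 'a \<Rightarrow> 'a \<Rightarrow> nat \<Rightarrow>
    'a poly^2^2 \<Rightarrow> bool" where
  "is_C_mat p nrm u K k e ap n C \<longleftrightarrow>
     (\<forall>i j. (\<forall>m. coeff (C$i$j) m \<in> int_ring nrm K) \<and> degree (C$i$j) < (k - 1) * p ^ n \<and>
        (\<exists>G H. fps_over (int_ring nrm K) G \<and> fps_over (int_ring nrm K) H \<and>
           mellin nrm u G = (1 + fps_X) * P_prod p k e ap n $ i $ j \<and>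
           fps_of_poly (C$i$j) - G = fps_of_poly (omega_h p u n (k - 1)) * H))"

definition is_Mlog :: "nat \<Rightarrow> ('a::field_char_0 \<Rightarrow> real) \<Rightarrow> nat \<Rightarrow> 'a \<Rightarrow> 'a \<Rightarrow>
    (nat \<Rightarrow> 'a poly^2^2) \<Rightarrow> 'a fps^2^2 \<Rightarrow> bool" where
  "is_Mlog p nrm k e ap C M \<longleftrightarrow>
     (\<forall>i j. disc_lim nrm
        (\<lambda>n. (((**) (map_matrix fps_const (A_mat p k e ap)) ^^ (n + 1))
                (map_matrix fps_of_poly (C n))) $ i $ j) (M $ i $ j))"

definition is_signed_pair :: "('a::field \<Rightarrow> real) \<Rightarrow> 'a set \<Rightarrow> 'a \<Rightarrow> 'a \<Rightarrow> 'a fps^2^2 \<Rightarrow>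
    'a fps \<Rightarrow> 'a fps \<Rightarrow> 'a fps \<Rightarrow> 'a fps \<Rightarrow> bool" where
  "is_signed_pair nrm K \<alpha> \<beta> M L\<alpha> L\<beta> Ls Lf \<longleftrightarrow>
     fps_over K Ls \<and> fps_over K Lf \<and>
     (\<exists>B. \<forall>m. nrm (fps_nth Ls m) \<le> B \<and> nrm (fps_nth Lf m) \<le> B) \<and>
     fps_const (1 / (\<alpha> - \<beta>)) *s vector [L\<alpha>, L\<beta>] =
       (map_matrix fps_const (matrix_inv (Q_mat \<alpha> \<beta>)) ** M) *v (vector [Ls, Lf] :: 'a fps^2)"

text \<open>\<open>p^(n-1) - p^(n-2) + ... + p - 1\<close> for even \<open>n \<ge> 2\<close> and
  \<open>p^(n-1) - p^(n-2) + ... + p^2 - p\<close> for odd \<open>n \<ge> 3\<close>.\<close>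

definition q_num :: "nat \<Rightarrow> nat \<Rightarrow> nat" where
  "q_num p n = nat (\<Sum>i\<in>{(if even n then 0 else 1)..<n}. (-1) ^ (n - 1 - i) * int p ^ i)"

end

theory Submission
  imports Defs
begin

no_notation fps_nth (infixl \<open>$\<close> 75)

text \<open>
  The rows \<open>(1, 1/\<alpha>)\<close> and \<open>(1, 1/\<beta>)\<close> of \<open>Q\<^sub>f\<inverse>\<close> are left eigenvectors of \<open>A\<^sub>f\<close>.
  Hence the congruences defining the unbounded and the signed p-adic L-functions combine, for
  \<open>j = 0\<close>, into \<open>\<Theta>\<^sub>n \<equiv> C\<^sub>1\<^sub>1 L\<^sup>\<sharp> + C\<^sub>1\<^sub>2 L\<^sup>\<flat>\<close> modulo \<open>\<omega>\<^sub>n\<close>, where \<open>C = C\<^sub>n\<close>; the congruence between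
  \<open>M\<^sub>l\<^sub>o\<^sub>g\<close> and \<open>A\<^sup>n\<^sup>+\<^sup>1 C\<^sub>n\<close> comes from \<open>P\<inverse> \<equiv> A\<inverse>\<close> modulo \<open>\<pi>\<close>.
  Modulo the maximal ideal \<open>P\<inverse>\<close> is antidiagonal, with a unit and a unit times
  \<open>\<pi>\<close> to the power \<open>(p - 1)(k - 1)\<close> as entries, and the Mellin transform multiplies the order of
  vanishing by \<open>p\<close>.  So one of \<open>C\<^sub>1\<^sub>1, C\<^sub>1\<^sub>2\<close> (according to the parity of \<open>n\<close>) vanishes modulo the
  maximal ideal and the other one has \<open>\<mu> = 0\<close> and \<open>\<lambda> = (k - 1) q\<^sub>n\<close>.  Since \<open>(k - 1) q\<^sub>n + \<lambda>\<close> is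
  eventually less than \<open>p\<^sup>n\<close>, reduction modulo \<open>\<omega>\<^sub>n\<close> preserves the invariants.
\<close>

section \<open>Non-archimedean estimates and division by distinguished polynomials\<close>

text \<open>Among formal power series a congruence modulo \<open>\<omega>\<^sub>n\<close> carries
  almost no information, since \<open>\<omega>\<^sub>n\<close> is X times a unit there. It gains
  force from a bound on quotients: if W is distinguished, h converges on the open unit disc and the
  coefficients of W * h from degree W on have norm at most B, then so have all coefficients of h.
  This bound, or its version on smaller discs, gives the uniqueness of remainders, the closedness of
  the multiples of \<open>\<omega>\<^sub>n\<close>, and the survival of the invariants under
  reduction. The other obstacle is that C is known only through its Mellin transform, while the
  recursion is visible on the side of the P-products. Pulling a congruence back costs one level:
  multiples of \<open>\<omega>\<^sub>n\<close> are sent to multiples of the next \<omega> in the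
  variable \<pi>, and conversely a polynomial of degree below p^n whose transform is such a multiple
  is zero, because the powers u^m with m < p^n are distinct modulo p^(n + 1).\<close>

locale nonarch =
  fixes nrm :: "'a::field_char_0 \<Rightarrow> real"
  assumes nonarch: "nonarch_abs nrm"
begin

lemma nrm_nonneg [simp]: "nrm x \<ge> 0"
  and nrm_eq_0_iff [simp]: "nrm x = 0 \<longleftrightarrow> x = 0"
  and nrm_mult: "nrm (x * y) = nrm x * nrm y"
  and nrm_add_le_max: "nrm (x + y) \<le> max (nrm x) (nrm y)"
  using nonarch by (auto simp: nonarch_abs_def)

lemma nrm_0 [simp]: "nrm 0 = 0"
  by simp

lemma nrm_1 [simp]: "nrm 1 = 1"
  using nrm_mult[of 1 1] by simp

lemma nrm_pos_iff [simp]: "nrm x > 0 \<longleftrightarrow> x \<noteq> 0"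
  using nrm_nonneg[of x] nrm_eq_0_iff[of x] by linarith

lemma nrm_minus [simp]: "nrm (- x) = nrm x"
proof -
  have "nrm (-1) ^ 2 = 1"
    using nrm_mult[of "-1" "-1"] by (simp add: power2_eq_square)
  then have "nrm (-1) = 1"
    using nrm_nonneg[of "-1"] by (simp add: power2_eq_1_iff)
  then show ?thesis
    using nrm_mult[of "-1" x] by simp
qed

lemma nrm_minus_commute: "nrm (x - y) = nrm (y - x)"
  using nrm_minus[of "x - y"] by simp

lemma nrm_diff_le_max: "nrm (x - y) \<le> max (nrm x) (nrm y)"
  using nrm_add_le_max[of x "- y"] by simp

lemma nrm_add_le: "nrm x \<le> B \<Longrightarrow> nrm y \<le> B \<Longrightarrow> nrm (x + y) \<le> B"
  and nrm_diff_le: "nrm x \<le> B \<Longrightarrow> nrm y \<le> B \<Longrightarrow> nrm (x - y) \<le> B"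
  and nrm_add_less: "nrm x < B \<Longrightarrow> nrm y < B \<Longrightarrow> nrm (x + y) < B"
  and nrm_diff_less: "nrm x < B \<Longrightarrow> nrm y < B \<Longrightarrow> nrm (x - y) < B"
  using nrm_add_le_max[of x y] nrm_diff_le_max[of x y] by auto

lemma nrm_add_eq: "nrm y < nrm x \<Longrightarrow> nrm (x + y) = nrm x"
  using nrm_add_le_max[of x y] nrm_diff_le_max[of "x + y" y] by auto

lemma nrm_power: "nrm (x ^ n) = nrm x ^ n"
  by (induction n) (auto simp: nrm_mult)

lemma nrm_inverse: "nrm (inverse x) = inverse (nrm x)"
proof (cases "x = 0")
  case False
  then have "nrm x * nrm (inverse x) = 1"
    using nrm_mult[of x "inverse x"] by simp
  then show ?thesis
    by (simp add: inverse_unique)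
qed auto

lemma nrm_divide: "nrm (x / y) = nrm x / nrm y"
  by (simp add: divide_inverse nrm_mult nrm_inverse)

lemma nrm_sum_le: "B \<ge> 0 \<Longrightarrow> (\<And>i. i \<in> A \<Longrightarrow> nrm (f i) \<le> B) \<Longrightarrow> nrm (sum f A) \<le> B"
  by (induction A rule: infinite_finite_induct) (auto intro!: nrm_add_le)

lemma nrm_sum_less: "B > 0 \<Longrightarrow> (\<And>i. i \<in> A \<Longrightarrow> nrm (f i) < B) \<Longrightarrow> nrm (sum f A) < B"
  by (induction A rule: infinite_finite_induct) (auto intro!: nrm_add_less)

lemma nrm_of_nat_le_1: "nrm (of_nat n) \<le> 1"
  by (induction n) (auto intro!: nrm_add_le)

lemma nrm_of_int_le_1: "nrm (of_int n) \<le> 1"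
  by (cases n) (auto simp: nrm_of_nat_le_1 simp del: of_nat_Suc)

lemma nrm_mult_le_1: "nrm x \<le> 1 \<Longrightarrow> nrm y \<le> 1 \<Longrightarrow> nrm (x * y) \<le> 1"
  by (simp add: nrm_mult mult_le_one)

lemma nrm_mult_less: "nrm x < B \<Longrightarrow> nrm y \<le> 1 \<Longrightarrow> nrm (x * y) < B"
  using mult_left_le[of "nrm y" "nrm x"] by (simp add: nrm_mult)

lemma nrm_power_le_1: "nrm x \<le> 1 \<Longrightarrow> nrm (x ^ n) \<le> 1"
  by (simp add: nrm_power power_le_one)

lemma nrm_power_diff_le: "nrm x \<le> 1 \<Longrightarrow> nrm y \<le> 1 \<Longrightarrow> nrm (x ^ n - y ^ n) \<le> nrm (x - y)"
proof (induction n)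
  case (Suc n)
  have "x ^ Suc n - y ^ Suc n = x * (x ^ n - y ^ n) + (x - y) * y ^ n"
    by (simp add: algebra_simps)
  moreover have "nrm (x * (x ^ n - y ^ n)) \<le> nrm (x - y)"
    using mult_mono[OF Suc.prems(1) Suc.IH[OF Suc.prems]] by (simp add: nrm_mult)
  moreover have "nrm ((x - y) * y ^ n) \<le> nrm (x - y)"
    using mult_left_mono[OF nrm_power_le_1[OF Suc.prems(2), of n] nrm_nonneg[of "x - y"]]
    by (simp add: nrm_mult)
  ultimately show ?case
    using nrm_add_le by metis
qed auto

section \<open>Limits for a non-archimedean absolute value\<close>

lemma plim_const: "plim nrm (\<lambda>n. c) c"
  by (simp add: plim_def)

lemma plim_eventually_const: "(\<And>n. n \<ge> n0 \<Longrightarrow> s n = c) \<Longrightarrow> plim nrm s c"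
  unfolding plim_def
  by (rule tendsto_eventually) (auto simp: eventually_sequentially intro!: exI[of _ n0])

lemma plimI_le:
  assumes "\<And>n. nrm (s n - l) \<le> t n" "t \<longlonglongrightarrow> 0"
  shows "plim nrm s l"
  unfolding plim_def
  by (rule tendsto_sandwich[OF _ _ tendsto_const assms(2)]) (use assms(1) in auto)

lemma plim_add: "plim nrm s l \<Longrightarrow> plim nrm t m \<Longrightarrow> plim nrm (\<lambda>n. s n + t n) (l + m)"
proof (rule plimI_le)
  show "nrm (s n + t n - (l + m)) \<le> max (nrm (s n - l)) (nrm (t n - m))" for n
    using nrm_add_le_max[of "s n - l" "t n - m"] by (simp add: algebra_simps)
  assume "plim nrm s l" "plim nrm t m"
  then show "(\<lambda>n. max (nrm (s n - l)) (nrm (t n - m))) \<longlonglongrightarrow> 0"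
    using tendsto_max[of "\<lambda>n. nrm (s n - l)" 0 sequentially "\<lambda>n. nrm (t n - m)" 0]
    by (simp add: plim_def)
qed

lemma plim_cmult: "plim nrm s l \<Longrightarrow> plim nrm (\<lambda>n. c * s n) (c * l)"
  using tendsto_mult_right_zero[of "\<lambda>n. nrm (s n - l)" sequentially "nrm c"]
  by (simp add: plim_def nrm_mult flip: right_diff_distrib)

lemma plim_minus: "plim nrm s l \<Longrightarrow> plim nrm (\<lambda>n. - s n) (- l)"
  using plim_cmult[of s l "-1"] by simp

lemma plim_diff: "plim nrm s l \<Longrightarrow> plim nrm t m \<Longrightarrow> plim nrm (\<lambda>n. s n - t n) (l - m)"
  using plim_add[of s l "\<lambda>n. - t n" "- m"] plim_minus by auto

lemma plim_sum: "(\<And>i. i \<in> A \<Longrightarrow> plim nrm (s i) (l i)) \<Longrightarrow>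
    plim nrm (\<lambda>n. \<Sum>i\<in>A. s i n) (\<Sum>i\<in>A. l i)"
  by (induction A rule: infinite_finite_induct) (auto intro: plim_add plim_const)

lemma plim_eventually_close:
  assumes "plim nrm s l" "e > 0"
  obtains n0 where "\<And>n. n \<ge> n0 \<Longrightarrow> nrm (s n - l) < e"
  using order_tendstoD(2)[OF assms(1)[unfolded plim_def] assms(2)]
  by (auto simp: eventually_sequentially)

lemma plim_le:
  assumes "plim nrm s l" "\<And>n. n \<ge> n0 \<Longrightarrow> nrm (s n) \<le> B" "B > 0"
  shows "nrm l \<le> B"
proof -
  obtain n1 where n1: "\<And>n. n \<ge> n1 \<Longrightarrow> nrm (s n - l) < B"
    using plim_eventually_close[OF assms(1,3)] by blast
  define n where "n = max n0 n1"
  have "nrm (s n - (s n - l)) \<le> B"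
    by (rule nrm_diff_le) (use assms(2)[of n] n1[of n] in \<open>auto simp: n_def\<close>)
  then show ?thesis by simp
qed

lemma plim_unique: "plim nrm s l \<Longrightarrow> plim nrm s m \<Longrightarrow> l = m"
proof (rule ccontr)
  assume lim: "plim nrm s l" "plim nrm s m" and "l \<noteq> m"
  have "plim nrm (\<lambda>n. 0) (l - m)"
    using plim_diff[OF lim] by simp
  then show False
    using plim_le[of "\<lambda>n. 0" "l - m" 0 "nrm (l - m) / 2"] \<open>l \<noteq> m\<close> by simp
qed

lemma psuminf_eqI: "plim nrm (\<lambda>n. \<Sum>i<n. s i) l \<Longrightarrow> psuminf nrm s = l"
  unfolding psuminf_def using plim_unique by blast

lemma plim_imp_pcauchy:
  assumes "plim nrm s l" shows "pcauchy nrm s"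
  unfolding pcauchy_def
proof (intro allI impI)
  fix e :: real assume "e > 0"
  then obtain n0 where n0: "\<And>n. n \<ge> n0 \<Longrightarrow> nrm (s n - l) < e"
    using plim_eventually_close[OF assms] by blast
  have "nrm (s m - s n) < e" if "m \<ge> n0" "n \<ge> n0" for m n
    using nrm_diff_less[OF n0[OF that(1)] n0[OF that(2)]] by simp
  then show "\<exists>n0. \<forall>m\<ge>n0. \<forall>n\<ge>n0. nrm (s m - s n) < e" by blast
qed

text \<open>A block of terms is no larger than its largest term, so it suffices that the terms tend
  to zero.\<close>

lemma pcauchy_partial_sums:
  assumes "(\<lambda>n. nrm (s n)) \<longlonglongrightarrow> 0"
  shows "pcauchy nrm (\<lambda>n. \<Sum>i<n. s i)"
  unfolding pcauchy_def
proof (intro allI impI)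
  fix e :: real assume e: "e > 0"
  obtain n0 where n0: "\<And>n. n \<ge> n0 \<Longrightarrow> nrm (s n) < e"
    using order_tendstoD(2)[OF assms e] by (auto simp: eventually_sequentially)
  have *: "nrm ((\<Sum>i<n. s i) - (\<Sum>i<m. s i)) < e" if "n0 \<le> m" "m \<le> n" for m n
  proof -
    have "(\<Sum>i<n. s i) - (\<Sum>i<m. s i) = (\<Sum>i\<in>{m..<n}. s i)"
      using that(2) by (simp add: lessThan_atLeast0 sum_diff_nat_ivl)
    also have "nrm \<dots> < e"
      using that n0 e by (intro nrm_sum_less) auto
    finally show ?thesis .
  qed
  have "nrm ((\<Sum>i<m. s i) - (\<Sum>i<n. s i)) < e" if "m \<ge> n0" "n \<ge> n0" for m n
    using *[of m n] *[of n m] that nrm_minus_commute[of "\<Sum>i<m. s i" "\<Sum>i<n. s i"]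
    by (cases "m \<le> n") auto
  then show "\<exists>n0. \<forall>m\<ge>n0. \<forall>n\<ge>n0. nrm ((\<Sum>i<m. s i) - (\<Sum>i<n. s i)) < e" by blast
qed

text \<open>The last maximizer of \<open>nrm (h i) * r ^ i\<close> gives a coefficient of \<open>W * h\<close> that no other term can cancel.\<close>

lemma quotient_bound_radius:
  fixes h :: "'a fps" and W :: "'a poly"
  assumes W: "lead_coeff W = 1" "degree W = N" "\<And>l. l < N \<Longrightarrow> nrm (coeff W l) \<le> \<theta>"
    and r: "0 < r" "r < 1" "\<theta> < r ^ N"
    and h: "(\<lambda>i. nrm (fps_nth h i) * r ^ i) \<longlonglongrightarrow> 0"
    and E: "E \<ge> 0" "\<And>i. nrm (fps_nth (fps_of_poly W * h) (N + i)) * r ^ i \<le> E"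
  shows "nrm (fps_nth h i) * r ^ i \<le> E"
proof (rule ccontr)
  define g where "g i = nrm (fps_nth h i) * r ^ i" for i
  assume "\<not> ?thesis"
  then have i: "g i > E" by (simp add: g_def)
  have fin: "finite {j. g j \<ge> g i}"
  proof -
    have "\<forall>\<^sub>F j in sequentially. g j < g i"
      using order_tendstoD(2)[of g 0 sequentially "g i"] h i E(1) unfolding g_def by auto
    then obtain n0 where "\<And>j. j \<ge> n0 \<Longrightarrow> g j < g i"
      by (auto simp: eventually_sequentially)
    then have "{j. g j \<ge> g i} \<subseteq> {..<n0}"
      by (force simp: not_le[symmetric])
    then show ?thesis using finite_subset by blast
  qed
  define S where "S = g ` {j. g j \<ge> g i}"
  have S: "finite S" "S \<noteq> {}" using fin by (auto simp: S_def)
  obtain j where j: "g j = Max S" "g j \<ge> g i"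
    using Max_in[OF S] by (auto simp: S_def)
  have mx: "g l \<le> g j" for l
  proof (cases "g l \<ge> g i")
    case True
    then show ?thesis using j(1) S by (auto simp: S_def)
  qed (use j(2) in auto)
  have gj: "g j > 0" "g j > E" using j i E(1) by auto
  \<comment> \<open>The factor r^(N - l) completes the weight to the one at index N + j - l, where g
    is at most \<open>g j\<close>; strictness comes from \<theta> < r^N \<le> r^(N - l).\<close>
  have small: "nrm (coeff W l * fps_nth h (N + j - l)) * r ^ j < g j" if "l < N" for l
  proof -
    have "nrm (coeff W l * fps_nth h (N + j - l)) * r ^ j * r ^ (N - l) 
      = nrm (coeff W l) * g (N + j - l)"
      using that by (simp add: g_def nrm_mult add.commute flip: power_add)
    also have "\<dots> \<le> \<theta> * g j"
      by (intro mult_mono W(3) mx) (use that gj W(3)[OF that] order_trans[OF nrm_nonneg] in \<open>auto simp: g_def r less_imp_le\<close>)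
    also have "\<dots> < r ^ N * g j"
      using gj r by simp
    also have "\<dots> \<le> r ^ (N - l) * g j"
      using gj r by (intro mult_right_mono power_decreasing) auto
    finally show ?thesis
      using r by (simp add: mult.commute)
  qed
  have "fps_nth (fps_of_poly W * h) (N + j) = (\<Sum>l\<le>N + j. coeff W l * fps_nth h (N + j - l))"
    by (simp add: fps_mult_nth atLeast0AtMost)
  also have "\<dots> = (\<Sum>l\<le>N. coeff W l * fps_nth h (N + j - l))"
    using W(2) by (intro sum.mono_neutral_right) (auto simp: coeff_eq_0)
  also have "\<dots> = fps_nth h j + (\<Sum>l<N. coeff W l * fps_nth h (N + j - l))"
    using W(1,2) by (simp add: lessThan_Suc_atMost[symmetric])
  finally have eq: "fps_nth (fps_of_poly W * h) (N + j)
    = fps_nth h j + (\<Sum>l<N. coeff W l * fps_nth h (N + j - l))" .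
  have "nrm (\<Sum>l<N. coeff W l * fps_nth h (N + j - l)) < nrm (fps_nth h j)"
  proof (rule nrm_sum_less)
    show "0 < nrm (fps_nth h j)"
      using gj r by (simp add: g_def zero_less_mult_iff)
    show "nrm (coeff W l * fps_nth h (N + j - l)) < nrm (fps_nth h j)" if "l \<in> {..<N}" for l
      using small[of l] that r by (simp add: g_def)
  qed
  then have "nrm (fps_nth (fps_of_poly W * h) (N + j)) = nrm (fps_nth h j)"
    unfolding eq by (rule nrm_add_eq)
  then show False
    using E(2)[of j] gj by (simp add: g_def)
qed

section \<open>Distinguished polynomials and bounds for quotients\<close>

definition distinguished :: "'a poly \<Rightarrow> bool" where
  "distinguished W \<longleftrightarrow> lead_coeff W = 1 \<and> (\<forall>l<degree W. nrm (coeff W l) < 1)"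

lemma distinguished_bound:
  assumes "distinguished W"
  obtains \<theta> where "\<theta> < 1" "\<theta> > 0" "\<And>l. l < degree W \<Longrightarrow> nrm (coeff W l) \<le> \<theta>"
proof -
  \<comment> \<open>Inserting 1/2 keeps the set nonempty in degree zero and the bound
    positive.\<close>
  define S where "S = insert (1/2) ((\<lambda>l. nrm (coeff W l)) ` {..<degree W})"
  have S: "finite S" "S \<noteq> {}" by (auto simp: S_def)
  show ?thesis
  proof (rule that[of "Max S"])
    show "Max S < 1"
      using assms S by (auto simp: Max_less_iff S_def distinguished_def)
    have "1/2 \<le> Max S" using S by (intro Max_ge) (auto simp: S_def)
    then show "Max S > 0" by simp
    show "nrm (coeff W l) \<le> Max S" if "l < degree W" for l
      using that S by (intro Max_ge) (auto simp: S_def)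
  qed
qed

lemma radius_exists:
  fixes \<theta> :: real
  assumes "\<theta> < 1" "0 \<le> s" "s < 1"
  obtains r where "s < r" "0 < r" "r < 1" "\<theta> < r ^ N"
proof -
  have "((\<lambda>r. r ^ N) \<longlongrightarrow> 1 ^ N) (at_left (1::real))"
    by (intro tendsto_intros)
  then have "\<forall>\<^sub>F r in at_left (1::real). \<theta> < r ^ N"
    using assms(1) by (intro order_tendstoD(1)) auto
  moreover have "\<forall>\<^sub>F r in at_left (1::real). s < r \<and> r < 1"
    using eventually_at_left_real[OF assms(3)] by eventually_elim auto
  ultimately have "\<forall>\<^sub>F r in at_left (1::real). \<theta> < r ^ N \<and> s < r \<and> r < 1"
    by eventually_elim auto
  then obtain r where "\<theta> < r ^ N \<and> s < r \<and> r < 1"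
    using eventually_happens'[OF trivial_limit_at_left_real] by blast
  then show ?thesis using that[of r] assms(2) by auto
qed

text \<open>A series converging on the open disc need not attain the supremum of its coefficients,
  so the estimate is made at a radius r < 1 and r then tends to 1. A radius close to 1 makes r^N
  exceed the norms of the non-leading coefficients of W.\<close>

lemma quotient_bound:
  fixes h :: "'a fps" and W :: "'a poly"
  assumes W: "distinguished W" and h: "disc_convergent nrm h"
    and B: "B \<ge> 0" "\<And>i. i \<ge> degree W \<Longrightarrow> nrm (fps_nth (fps_of_poly W * h) i) \<le> B"
  shows "nrm (fps_nth h i) \<le> B"
proof -
  obtain \<theta> where \<theta>: "\<theta> < 1" "\<theta> > 0" "\<And>l. l < degree W \<Longrightarrow> nrm (coeff W l) \<le> \<theta>"
    using distinguished_bound[OF W] by blast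
  obtain r0 where r0: "0 < r0" "r0 < 1" "\<theta> < r0 ^ degree W"
    using radius_exists[OF \<theta>(1), of 0 "degree W"] by auto
  have bd: "nrm (fps_nth h i) * r ^ i \<le> B" if "r0 < r" "r < 1" for r
  proof (rule quotient_bound_radius[of W "degree W" \<theta>])
    show "\<theta> < r ^ degree W"
      using r0 that power_mono[of r0 r "degree W"] by auto
    show "(\<lambda>i. nrm (fps_nth h i) * r ^ i) \<longlonglongrightarrow> 0"
      using h that r0 by (auto simp: disc_convergent_def)
    show "nrm (fps_nth (fps_of_poly W * h) (degree W + i)) * r ^ i \<le> B" for i
      using mult_mono[OF B(2)[of "degree W + i"] power_le_one[of r i]] that r0 B(1) by auto
  qed (use W \<theta> B that r0 in \<open>auto simp: distinguished_def\<close>)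
  have "((\<lambda>r. nrm (fps_nth h i) * r ^ i) \<longlongrightarrow> nrm (fps_nth h i) * 1 ^ i) (at_left 1)"
    by (intro tendsto_intros)
  then have "nrm (fps_nth h i) * 1 ^ i \<le> B"
    using bd eventually_at_left_real[OF r0(2)]
    by (intro tendsto_upperbound) (auto elim!: eventually_mono)
  then show ?thesis by simp
qed

lemma disc_convergent_bounded:
  assumes "\<And>i. nrm (fps_nth h i) \<le> B"
  shows "disc_convergent nrm h"
  unfolding disc_convergent_def
proof
  fix r :: real assume r: "r \<in> {0..<1}"
  show "(\<lambda>m. nrm (fps_nth h m) * r ^ m) \<longlonglongrightarrow> 0"
  proof (rule tendsto_sandwich[OF _ _ tendsto_const])
    show "(\<lambda>m. B * r ^ m) \<longlonglongrightarrow> 0"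
      using r by (intro tendsto_mult_right_zero LIMSEQ_realpow_zero) auto
  qed (use assms r in \<open>auto intro!: mult_right_mono always_eventually\<close>)
qed

lemma disc_convergent_poly: "disc_convergent nrm (fps_of_poly P)"
proof -
  have "nrm (fps_nth (fps_of_poly P) i) \<le> Max (insert 0 ((\<lambda>i. nrm (coeff P i)) ` {..degree P}))" for i
    by (cases "i \<le> degree P") (auto simp: coeff_eq_0 simp del: Max_insert intro!: Max_ge)
  then show ?thesis by (rule disc_convergent_bounded)
qed

text \<open>Uniqueness of remainders: P has no coefficients from degree W on, so the bound for the
  quotient holds with B = 0.\<close>

lemma quotient_zero:
  assumes W: "distinguished W" and h: "disc_convergent nrm h"
    and P: "degree P < degree W" "fps_of_poly P = fps_of_poly W * h"
  shows "P = 0"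
proof -
  have "nrm (fps_nth h i) \<le> 0" for i
    by (rule quotient_bound[OF W h]) (use P in \<open>auto simp flip: P(2) simp: coeff_eq_0\<close>)
  then have "nrm (fps_nth h i) = 0" for i
    by (intro antisym nrm_nonneg)
  then have "h = 0" by (simp add: fps_eq_iff)
  then show ?thesis using P(2) by simp
qed

section \<open>Operations on series that converge on the open unit disc\<close>

lemma disc_convergent_add:
  assumes "disc_convergent nrm F" "disc_convergent nrm G"
  shows "disc_convergent nrm (F + G)"
  unfolding disc_convergent_def
proof
  fix r :: real assume r: "r \<in> {0..<1}"
  have "(\<lambda>m. max (nrm (fps_nth F m) * r ^ m) (nrm (fps_nth G m) * r ^ m)) \<longlonglongrightarrow> 0"
    using tendsto_max[of "\<lambda>m. nrm (fps_nth F m) * r ^ m" 0 sequentially "\<lambda>m. nrm (fps_nth G m) * r ^ m" 0]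
      assms r by (auto simp: disc_convergent_def)
  then show "(\<lambda>m. nrm (fps_nth (F + G) m) * r ^ m) \<longlonglongrightarrow> 0"
  proof (rule tendsto_sandwich[OF always_eventually always_eventually tendsto_const, rotated 2]; intro allI)
    show "nrm (fps_nth (F + G) m) * r ^ m \<le> max (nrm (fps_nth F m) * r ^ m) (nrm (fps_nth G m) * r ^ m)" for m
    using mult_right_mono[OF nrm_add_le_max[of "fps_nth F m" "fps_nth G m"], of "r ^ m"] r
      by (simp add: max_mult_distrib_right)
  qed (use r in auto)
qed

lemma disc_convergent_cmult:
  assumes "disc_convergent nrm F" shows "disc_convergent nrm (fps_const c * F)"
  unfolding disc_convergent_def
proof
  fix r :: real assume "r \<in> {0..<1}"
  then have "(\<lambda>m. nrm c * (nrm (fps_nth F m) * r ^ m)) \<longlonglongrightarrow> 0"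
    using assms by (intro tendsto_mult_right_zero) (auto simp: disc_convergent_def)
  then show "(\<lambda>m. nrm (fps_nth (fps_const c * F) m) * r ^ m) \<longlonglongrightarrow> 0"
    by (simp add: nrm_mult mult.assoc)
qed

lemma disc_convergent_diff:
  "disc_convergent nrm F \<Longrightarrow> disc_convergent nrm G \<Longrightarrow> disc_convergent nrm (F - G)"
  using disc_convergent_add[of F "fps_const (-1) * G"] disc_convergent_cmult[of G "-1"]
  by (metis diff_conv_add_uminus fps_const_1_eq_1 fps_const_neg mult_minus1)

lemma disc_convergent_mult_bounded:
  assumes F: "disc_convergent nrm F" and G: "\<And>i. nrm (fps_nth G i) \<le> B"
  shows "disc_convergent nrm (F * G)"
  unfolding disc_convergent_def
proof
  fix r :: real assume r: "r \<in> {0..<1}"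
  \<comment> \<open>An intermediate radius: F is bounded by C there, and (r / s)^m supplies the
    decay at radius r.\<close>
  define s where "s = (r + 1) / 2"
  have s: "0 < s" "s < 1" "r < s" using r by (auto simp: s_def)
  have B: "B \<ge> 0" using G[of 0] nrm_nonneg order_trans by blast
  have "(\<lambda>m. nrm (fps_nth F m) * s ^ m) \<longlonglongrightarrow> 0"
    using F s by (auto simp: disc_convergent_def)
  from convergent_imp_Bseq[OF convergentI[OF this]]
  obtain C where C: "C > 0" "\<And>m. nrm (fps_nth F m) * s ^ m \<le> C"
    using s by (auto simp: Bseq_def)
  have bound: "nrm (fps_nth (F * G) m) \<le> C * B / s ^ m" for m
    unfolding fps_mult_nth
  proof (rule nrm_sum_le)
    fix l assume "l \<in> {0..m}"
    then have "nrm (fps_nth F l) * s ^ m \<le> nrm (fps_nth F l) * s ^ l"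
      using s by (intro mult_left_mono power_decreasing) auto
    then have "nrm (fps_nth F l) \<le> C / s ^ m"
      using C(2)[of l] s by (simp add: pos_le_divide_eq)
    then show "nrm (fps_nth F l * fps_nth G (m - l)) \<le> C * B / s ^ m"
      using mult_mono[OF _ G[of "m - l"], of "nrm (fps_nth F l)" "C / s ^ m"] C(1) s by (simp add: nrm_mult)
  qed (use B C s in auto)
  show "(\<lambda>m. nrm (fps_nth (F * G) m) * r ^ m) \<longlonglongrightarrow> 0"
  proof (rule tendsto_sandwich[OF always_eventually always_eventually tendsto_const, rotated 2]; (intro allI)?)
    show "(\<lambda>m. C * B * (r / s) ^ m) \<longlonglongrightarrow> 0"
      using r s by (intro tendsto_mult_right_zero LIMSEQ_realpow_zero) auto
    show "nrm (fps_nth (F * G) m) * r ^ m \<le> C * B * (r / s) ^ m" for m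
      using mult_right_mono[OF bound, of "r ^ m"] r by (simp add: power_divide)
  qed (use r in auto)
qed

lemma fps_mult_nth_bound:
  assumes "\<And>i. nrm (fps_nth F i) \<le> A" "\<And>i. nrm (fps_nth G i) \<le> B"
  shows "nrm (fps_nth (F * G) m) \<le> A * B"
proof -
  have "A \<ge> 0" "B \<ge> 0" using assms[of 0] nrm_nonneg order_trans by blast+
  then show ?thesis
    unfolding fps_mult_nth using assms by (intro nrm_sum_le) (auto simp: nrm_mult intro!: mult_mono)
qed

end

section \<open>Integral power series and completeness\<close>

text \<open>The law ((1 + X)^b)^a = (1 + X)^(ab) for exponents that need not be integers: both sides
  have constant term 1 and solve (1 + X) F' = ab F, whose solution is unique.\<close>

lemma fps_binomial_compose:
  fixes a b :: "'a::field_char_0"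
  shows "fps_binomial a oo (fps_binomial b - 1) = fps_binomial (a * b)"
proof -
  let ?g = "fps_binomial b - 1"
  have unit: "(1 + fps_X) * (F / (1 + fps_X)) = F" for F :: "'a fps"
  proof -
    have "(1 + fps_X) * (F / (1 + fps_X)) = F * (inverse (1 + fps_X) * (1 + fps_X))"
      by (subst fps_divide_unit) (simp_all only: mult_ac, simp)
    also have "\<dots> = F" by (subst inverse_mult_eq_1) auto
    finally show ?thesis .
  qed
  have deriv: "(1 + fps_X) * fps_deriv (fps_binomial c) = fps_const c * fps_binomial c" for c :: 'a
    unfolding fps_binomial_deriv by (rule unit)
  have g0: "fps_nth ?g 0 = 0" by simp
  have "(1 + fps_X) * fps_deriv (fps_binomial a oo ?g)
      = ((1 + fps_X) * fps_deriv (fps_binomial b)) * (fps_deriv (fps_binomial a) oo ?g)"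
    by (simp add: fps_compose_deriv[OF g0] mult_ac)
  also have "\<dots> = fps_const b * (((1 + fps_X) * fps_deriv (fps_binomial a)) oo ?g)"
    unfolding deriv[of b] by (simp add: fps_compose_mult_distrib[OF g0] fps_compose_add_distrib mult_ac)
  also have "\<dots> = fps_const (a * b) * (fps_binomial a oo ?g)"
    unfolding deriv[of a] by (simp add: fps_compose_mult_distrib[OF g0] mult_ac flip: fps_const_mult)
  finally have "fps_deriv (fps_binomial a oo ?g) = fps_const (a * b) * (fps_binomial a oo ?g) / (1 + fps_X)"
    by (metis unit mult_left_cancel fps_binomial_1 fps_X_nth fps_one_nth fps_add_nth add_0_right fps_zero_nth zero_neq_one)
  then show ?thesis
    using fps_binomial_ODE_unique[of "fps_binomial a oo ?g" "a * b"] by simp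
qed

text \<open>Written as a polynomial in the upper argument so that it can be expanded into monomials,
  on which the Mellin transform acts diagonally.\<close>

definition gchoose_poly :: "nat \<Rightarrow> 'a::field_char_0 poly" where
  "gchoose_poly i = smult (inverse (fact i)) (\<Prod>l<i. [:- of_nat l, 1:])"

lemma poly_gchoose_poly: "poly (gchoose_poly i) x = x gchoose i"
  by (simp add: gchoose_poly_def poly_prod gbinomial_prod_rev atLeast0LessThan divide_inverse)

lemma plim_fps_mult_nth:
  "nonarch_abs nrm \<Longrightarrow> (\<And>j. plim nrm (\<lambda>n. fps_nth (F n) j) (fps_nth L j)) \<Longrightarrow>
     plim nrm (\<lambda>n. fps_nth (F n * G) i) (fps_nth (L * G) i)"
  for nrm :: "'a::field_char_0 \<Rightarrow> real"
proof -
  assume "nonarch_abs nrm" and lim: "\<And>j. plim nrm (\<lambda>n. fps_nth (F n) j) (fps_nth L j)"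
  then interpret nonarch nrm by unfold_locales
  show ?thesis
    unfolding fps_mult_nth
    by (intro plim_sum) (subst (1 2) mult.commute, rule plim_cmult[OF lim])
qed

section \<open>Integral power series and divisibility with integral quotient\<close>

context nonarch
begin

lemma nrm_trans_less: "nrm (x - y) < e \<Longrightarrow> nrm (y - z) < e \<Longrightarrow> nrm (x - z) < e"
  using nrm_add_less[of "x - y" e "y - z"] by simp

definition int_fps :: "'a fps \<Rightarrow> bool" where
  "int_fps F \<longleftrightarrow> (\<forall>i. nrm (fps_nth F i) \<le> 1)"

lemma int_fps_0 [simp]: "int_fps 0" and int_fps_1 [simp]: "int_fps 1" and int_fps_X [simp]: "int_fps fps_X"
  by (auto simp: int_fps_def fps_X_def)

lemma int_fps_const: "nrm c \<le> 1 \<Longrightarrow> int_fps (fps_const c)"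
  by (simp add: int_fps_def fps_nth_fps_const)

lemma int_fps_add [intro]: "int_fps F \<Longrightarrow> int_fps G \<Longrightarrow> int_fps (F + G)"
  and int_fps_diff [intro]: "int_fps F \<Longrightarrow> int_fps G \<Longrightarrow> int_fps (F - G)"
  and int_fps_minus [intro]: "int_fps F \<Longrightarrow> int_fps (- F)"
  by (auto simp: int_fps_def intro: nrm_add_le nrm_diff_le)

lemma int_fps_mult [intro]: "int_fps F \<Longrightarrow> int_fps G \<Longrightarrow> int_fps (F * G)"
  unfolding int_fps_def fps_mult_nth by (auto intro!: nrm_sum_le nrm_mult_le_1)

lemma int_fps_power [intro]: "int_fps F \<Longrightarrow> int_fps (F ^ n)"
  by (induction n) auto

lemma int_fps_compose [intro]: "int_fps F \<Longrightarrow> int_fps G \<Longrightarrow> int_fps (F oo G)"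
  unfolding int_fps_def fps_compose_nth
  using int_fps_power[unfolded int_fps_def] by (auto intro!: nrm_sum_le nrm_mult_le_1)

lemma int_fps_shift: "int_fps F \<Longrightarrow> int_fps (fps_shift n F)"
  by (simp add: int_fps_def)

lemma int_fps_disc_convergent: "int_fps F \<Longrightarrow> disc_convergent nrm F"
  unfolding int_fps_def using disc_convergent_bounded by blast

text \<open>The integrality of the quotient is the content: for \<open>\<omega>\<^sub>n\<close>,
  divisibility over the field says only that the constant term vanishes.\<close>

definition int_dvd :: "'a fps \<Rightarrow> 'a fps \<Rightarrow> bool" where
  "int_dvd W F \<longleftrightarrow> (\<exists>h. int_fps h \<and> F = W * h)"

lemma int_dvd_add: "int_dvd W F \<Longrightarrow> int_dvd W G \<Longrightarrow> int_dvd W (F + G)"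
  and int_dvd_diff: "int_dvd W F \<Longrightarrow> int_dvd W G \<Longrightarrow> int_dvd W (F - G)"
  unfolding int_dvd_def by (metis int_fps_add distrib_left, metis int_fps_diff right_diff_distrib)

lemma int_dvd_0 [simp]: "int_dvd W 0"
  unfolding int_dvd_def by (intro exI[of _ 0]) auto

lemma int_dvd_mult: "int_dvd W F \<Longrightarrow> int_fps G \<Longrightarrow> int_dvd W (G * F)"
  unfolding int_dvd_def by (metis int_fps_mult mult.left_commute)

lemma int_dvd_sum: "(\<And>i. i \<in> A \<Longrightarrow> int_dvd W (F i)) \<Longrightarrow> int_dvd W (sum F A)"
  by (induction A rule: infinite_finite_induct) (auto intro: int_dvd_add)

text \<open>Over a field such a \<open>W\<close> is \<open>fps_X\<close> times a unit, so the quotient depends continuously on the dividend.\<close>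

lemma quotient_converges:
  assumes W: "fps_nth W 0 = 0" "fps_nth W 1 \<noteq> 0"
    and S: "\<And>n. S n = W * h n" and lim: "\<And>i. plim nrm (\<lambda>n. fps_nth (S n) i) (fps_nth F i)"
  obtains H where "F = W * H" "\<And>i. plim nrm (\<lambda>n. fps_nth (h n) i) (fps_nth H i)"
proof
  define U where "U = fps_shift 1 W"
  define V where "V = inverse U"
  have WX: "W = fps_X * U"
    using W(1) by (auto simp: fps_eq_iff U_def)
  have V: "V * U = 1"
    unfolding V_def using W(2) by (intro inverse_mult_eq_1) (auto simp: U_def)
  have "fps_nth F 0 = 0"
    using plim_unique[OF lim[of 0], of 0] plim_const[of 0] W(1) by (simp add: S)
  then have FX: "F = fps_X * fps_shift 1 F"
    by (auto simp: fps_eq_iff)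
  have "W * (fps_shift 1 F * V) = fps_X * fps_shift 1 F * (V * U)"
    unfolding WX by (simp only: mult_ac)
  then show "F = W * (fps_shift 1 F * V)"
    using FX V by (metis mult_1_right)
  have "fps_shift 1 (S n) = U * h n" for n
    unfolding S WX by (simp add: fps_eq_iff mult.assoc)
  then have h: "h n = fps_shift 1 (S n) * V" for n
    using V by (metis mult.commute mult.left_commute mult_1)
  show "plim nrm (\<lambda>n. fps_nth (h n) i) (fps_nth (fps_shift 1 F * V) i)" for i
    unfolding h by (rule plim_fps_mult_nth[OF nonarch]) (use lim in auto)
qed

text \<open>The quotients converge coefficientwise and the bound 1 passes to the limit, so the ideal
  is closed.\<close>

lemma int_dvd_limit:
  assumes "fps_nth W 0 = 0" "fps_nth W 1 \<noteq> 0" "\<And>n. int_dvd W (S n)"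
    and "\<And>i. plim nrm (\<lambda>n. fps_nth (S n) i) (fps_nth F i)"
  shows "int_dvd W F"
proof -
  obtain h where h: "\<And>n. int_fps (h n)" "\<And>n. S n = W * h n"
    using assms(3) unfolding int_dvd_def by metis
  obtain H where H: "F = W * H" "\<And>i. plim nrm (\<lambda>n. fps_nth (h n) i) (fps_nth H i)"
    using quotient_converges[OF assms(1,2) h(2) assms(4)] by blast
  have "int_fps H"
    unfolding int_fps_def by (rule allI, rule plim_le[OF H(2), of 0]) (use h(1) in \<open>auto simp: int_fps_def\<close>)
  then show ?thesis using H(1) by (auto simp: int_dvd_def)
qed

lemma disc_lim_imp_plim:
  assumes "disc_lim nrm S F" shows "plim nrm (\<lambda>n. fps_nth (S n) i) (fps_nth F i)"
  unfolding plim_def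
proof (rule LIMSEQ_I)
  fix e :: real assume "e > 0"
  \<comment> \<open>Any positive radius would do; the weight (1/2)^i of the fixed index i is
    absorbed into the tolerance.\<close>
  then obtain n0 where "\<And>n m. n \<ge> n0 \<Longrightarrow> nrm (fps_nth (S n) m - fps_nth F m) * (1/2) ^ m < e * (1/2) ^ i"
    using assms[unfolded disc_lim_def, rule_format, of "1/2" "e * (1/2) ^ i"] by auto
  from this[of _ i] show "\<exists>no. \<forall>n\<ge>no. norm (nrm (fps_nth (S n) i - fps_nth F i) - 0) < e"
    by (intro exI[of _ n0]) auto
qed

text \<open>The multiples of W are closed under uniform convergence on smaller discs. The quotient H
  exists coefficientwise; it converges on the open disc because the approximating quotients are
  polynomials that are uniformly Cauchy at each radius close to 1.\<close>

lemma disc_lim_quotient: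
  assumes W: "distinguished W" "coeff W 0 = 0" "coeff W 1 \<noteq> 0"
    and S: "\<And>n. S n = fps_of_poly (W * q n)" and lim: "disc_lim nrm S F"
  obtains H where "disc_convergent nrm H" "F = fps_of_poly W * H"
proof -
  obtain H where H: "F = fps_of_poly W * H"
    "\<And>i. plim nrm (\<lambda>n. fps_nth (fps_of_poly (q n)) i) (fps_nth H i)"
    using quotient_converges[of "fps_of_poly W" S "\<lambda>n. fps_of_poly (q n)" F] W(2,3)
      disc_lim_imp_plim[OF lim] by (auto simp: S fps_of_poly_mult)
  obtain \<theta> where \<theta>: "\<theta> < 1" "\<theta> > 0" "\<And>l. l < degree W \<Longrightarrow> nrm (coeff W l) \<le> \<theta>"
    using distinguished_bound[OF W(1)] by blast
  have "disc_convergent nrm H"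
    unfolding disc_convergent_def
  proof
    fix s :: real assume s: "s \<in> {0..<1}"
    then obtain r where r: "s < r" "0 < r" "r < 1" "\<theta> < r ^ degree W"
      using radius_exists[OF \<theta>(1), of s] by auto
    show "(\<lambda>i. nrm (fps_nth H i) * s ^ i) \<longlonglongrightarrow> 0"
    proof (rule LIMSEQ_I)
      fix e :: real assume e: "e > 0"
      \<comment> \<open>Coefficient \<open>degree W + i\<close> of the product controls coefficient
        i of the quotient; the power of r pays for this shift.\<close>
      define e' where "e' = e / 2 * r ^ degree W"
      have e': "e' > 0" using e r by (simp add: e'_def)
      obtain n0 where n0: "\<And>n i. n \<ge> n0 \<Longrightarrow> nrm (fps_nth (S n) i - fps_nth F i) * r ^ i < e'"
        using lim[unfolded disc_lim_def, rule_format, of r e'] r e' by auto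
      have dq: "nrm (coeff (q n) i - coeff (q m) i) * r ^ i \<le> e / 2" if "n \<ge> n0" "m \<ge> n0" for n m i
      proof -
        have eq: "fps_of_poly W * fps_of_poly (q n - q m) = S n - S m"
          by (simp add: S algebra_simps fps_of_poly_mult fps_of_poly_diff)
        have "nrm (fps_nth (fps_of_poly (q n - q m)) i) * r ^ i \<le> e / 2"
        proof (rule quotient_bound_radius[of W "degree W" \<theta>])
          show "(\<lambda>i. nrm (fps_nth (fps_of_poly (q n - q m)) i) * r ^ i) \<longlonglongrightarrow> 0"
            using disc_convergent_poly[of "q n - q m"] r unfolding disc_convergent_def by auto
          fix i
          let ?i = "degree W + i"
          have "nrm (fps_nth (S n) ?i - fps_nth (S m) ?i) * r ^ ?i \<le> e'"
          proof -
            have "nrm (fps_nth (S n) ?i - fps_nth (S m) ?i) 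
              \<le> max (nrm (fps_nth (S n) ?i - fps_nth F ?i)) (nrm (fps_nth (S m) ?i - fps_nth F ?i))"
              using nrm_diff_le_max[of "fps_nth (S n) ?i - fps_nth F ?i" "fps_nth (S m) ?i - fps_nth F ?i"]
              by simp
            then have "nrm (fps_nth (S n) ?i - fps_nth (S m) ?i) * r ^ ?i
              \<le> max (nrm (fps_nth (S n) ?i - fps_nth F ?i) * r ^ ?i) (nrm (fps_nth (S m) ?i - fps_nth F ?i) * r ^ ?i)"
              using r by (auto simp: max_def intro: mult_right_mono split: if_splits)
            also have "\<dots> \<le> e'" using n0[of n ?i] n0[of m ?i] that by auto
            finally show ?thesis .
          qed
          then have "nrm (fps_nth (S n - S m) ?i) * r ^ i * r ^ degree W \<le> e / 2 * r ^ degree W"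
            by (simp add: e'_def power_add mult_ac)
          then show "nrm (fps_nth (fps_of_poly W * fps_of_poly (q n - q m)) ?i) * r ^ i \<le> e / 2"
            unfolding eq using r by (simp add: mult_le_cancel_right)
        qed (use W(1) \<theta> r e in \<open>auto simp: distinguished_def\<close>)
        then show ?thesis by simp
      qed
      \<comment> \<open>Past its degree \<open>q n0\<close> has zero coefficients, so the Cauchy
        estimate bounds the coefficients of every later \<open>q n\<close> and hence those of
        H.\<close>
      have bd: "nrm (fps_nth H i) * r ^ i \<le> e / 2" if i: "i > degree (q n0)" for i
      proof -
        have "nrm (fps_nth H i) \<le> e / 2 / r ^ i"
        proof (rule plim_le[OF H(2), of n0])
          fix n assume "n \<ge> n0"
          then have "nrm (coeff (q n) i) * r ^ i \<le> e / 2"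
            using dq[of n n0 i] i by (simp add: coeff_eq_0)
          then show "nrm (fps_nth (fps_of_poly (q n)) i) \<le> e / 2 / r ^ i"
            using r by (simp add: field_simps)
        qed (use e r in auto)
        then show ?thesis using r by (simp add: field_simps)
      qed
      have "nrm (fps_nth H i) * s ^ i < e" if i: "i > degree (q n0)" for i
      proof -
        have "nrm (fps_nth H i) * s ^ i \<le> nrm (fps_nth H i) * r ^ i"
          using s r by (intro mult_left_mono power_mono) auto
        then show ?thesis using bd[OF i] e by linarith
      qed
      then show "\<exists>no. \<forall>i\<ge>no. norm (nrm (fps_nth H i) * s ^ i - 0) < e"
        using s by (intro exI[of _ "Suc (degree (q n0))"]) auto
    qed
  qed
  then show ?thesis using that H(1) by blast
qed

end

text \<open>Completeness is asked only of sequences of rationals: the intended field is an algebraic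
  closure of Q_p, which is not complete. The existence of limits is derived for Q_p and then for
  finite extensions.\<close>

locale padic = nonarch nrm for nrm :: "'a::field_char_0 \<Rightarrow> real" +
  fixes p :: nat
  assumes prime_p: "prime p" and nrm_p: "nrm (of_nat p) = 1 / real p"
    and rat_complete: "\<And>s :: nat \<Rightarrow> rat. pcauchy nrm (\<lambda>n. of_rat (s n)) \<Longrightarrow> \<exists>x. plim nrm (\<lambda>n. of_rat (s n)) x"
begin

lemma p_gt_1: "p > 1"
  using prime_p prime_gt_1_nat by blast

lemma nrm_of_nat_multiple: "p ^ N dvd n \<Longrightarrow> nrm (of_nat n) \<le> 1 / real p ^ N"
  using mult_left_mono[OF nrm_of_nat_le_1, of "1 / real p ^ N"]
  by (auto elim!: dvdE simp: nrm_mult nrm_power nrm_p power_one_over)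

lemma nrm_of_int_multiple: "int p ^ N dvd n \<Longrightarrow> nrm (of_int n) \<le> 1 / real p ^ N"
  using mult_left_mono[OF nrm_of_int_le_1, of "1 / real p ^ N"]
  by (auto elim!: dvdE simp: nrm_mult nrm_power nrm_p power_one_over)

text \<open>Otherwise a Bezout relation between n and p would write 1 as a sum of two elements of
  norm below 1.\<close>

lemma nrm_of_int_coprime:
  assumes "coprime n (int p)" shows "nrm (of_int n) = 1"
proof (rule ccontr)
  assume "nrm (of_int n) \<noteq> 1"
  then have n: "nrm (of_int n) < 1" using nrm_of_int_le_1[of n] by simp
  obtain x y where "x * n + y * int p = 1"
    using assms bezout_int[of n "int p"] by (auto simp: coprime_iff_gcd_eq_1)
  then have "(of_int n * of_int x + of_nat p * of_int y :: 'a) = 1"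
    by (metis (no_types, lifting) mult.commute of_int_1 of_int_add of_int_mult of_int_of_nat_eq)
  moreover have "nrm (of_int n * of_int x + of_nat p * of_int y) < 1"
    using n p_gt_1 by (intro nrm_add_less nrm_mult_less nrm_of_int_le_1) (auto simp: nrm_p)
  ultimately show False by simp
qed

section \<open>The field Q_p, its integers, and the completeness of finite-dimensional spaces over
  it\<close>

lemma Qp_of_rat: "of_rat r \<in> Qp nrm"
  unfolding Qp_def using plim_const[of "of_rat r"] by (intro CollectI exI[of _ "\<lambda>_. r"])

lemma Qp_of_nat: "of_nat n \<in> Qp nrm"
  using Qp_of_rat[of "of_nat n"] by simp

lemma Qp_approx:
  assumes "x \<in> Qp nrm" "e > 0"
  obtains r where "nrm (x - of_rat r) < e"
proof -
  from assms(1) obtain s where s: "plim nrm (\<lambda>n. of_rat (s n)) x"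
    by (auto simp: Qp_def)
  obtain n0 where "\<And>n. n \<ge> n0 \<Longrightarrow> nrm (of_rat (s n) - x) < e"
    using plim_eventually_close[OF s assms(2)] by blast
  from this[of n0] show ?thesis
    using that[of "s n0"] nrm_minus_commute[of x] by simp
qed

lemma QpI:
  assumes "\<And>e. e > 0 \<Longrightarrow> \<exists>r. nrm (x - of_rat r) < e"
  shows "x \<in> Qp nrm"
proof -
  have "\<exists>s. \<forall>n. nrm (x - of_rat (s n)) < inverse (real (Suc n))"
    using assms by (intro choice) auto
  then obtain s where s: "\<And>n. nrm (x - of_rat (s n)) < inverse (real (Suc n))"
    by blast
  have "plim nrm (\<lambda>n. of_rat (s n)) x"
    by (rule plimI_le[OF _ LIMSEQ_inverse_real_of_nat]) (use s nrm_minus_commute in \<open>metis less_imp_le\<close>)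
  then show ?thesis by (auto simp: Qp_def)
qed

lemma Qp_add: "x \<in> Qp nrm \<Longrightarrow> y \<in> Qp nrm \<Longrightarrow> x + y \<in> Qp nrm"
proof (rule QpI)
  fix e :: real assume xy: "x \<in> Qp nrm" "y \<in> Qp nrm" and e: "e > 0"
  obtain r s where "nrm (x - of_rat r) < e" "nrm (y - of_rat s) < e"
    using Qp_approx[OF xy(1) e] Qp_approx[OF xy(2) e] by metis
  then have "nrm ((x - of_rat r) + (y - of_rat s)) < e"
    by (rule nrm_add_less)
  then show "\<exists>r. nrm (x + y - of_rat r) < e"
    by (intro exI[of _ "r + s"]) (simp add: of_rat_add algebra_simps)
qed

lemma Qp_mult: "x \<in> Qp nrm \<Longrightarrow> y \<in> Qp nrm \<Longrightarrow> x * y \<in> Qp nrm"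
proof -
  assume "x \<in> Qp nrm" "y \<in> Qp nrm"
  then obtain s t where s: "plim nrm (\<lambda>n. of_rat (s n)) x" and t: "plim nrm (\<lambda>n. of_rat (t n)) y"
    by (auto simp: Qp_def)
  have "x * of_rat r \<in> Qp nrm" for r
    using plim_cmult[OF s, of "of_rat r"] unfolding Qp_def 
    by (auto simp: mult.commute simp flip: of_rat_mult)
  then show "x * y \<in> Qp nrm"
  proof (intro QpI)
    fix e :: real assume rat: "\<And>r. x * of_rat r \<in> Qp nrm" and e: "e > 0"
    obtain n where n: "nrm (x * of_rat (t n) - x * y) < e"
      using plim_eventually_close[OF plim_cmult[OF t] e] by blast
    obtain r where "nrm (x * of_rat (t n) - of_rat r) < e"
      using Qp_approx[OF rat e] by blast
    with n show "\<exists>r. nrm (x * y - of_rat r) < e"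
      using nrm_trans_less[of "x * y" "x * of_rat (t n)"] nrm_minus_commute by metis
  qed
qed

lemma Qp_minus: "x \<in> Qp nrm \<Longrightarrow> - x \<in> Qp nrm"
  using Qp_mult[of "of_rat (-1)" x] Qp_of_rat[of "-1"] by simp

lemma Qp_diff: "x \<in> Qp nrm \<Longrightarrow> y \<in> Qp nrm \<Longrightarrow> x - y \<in> Qp nrm"
  using Qp_add[of x "- y"] Qp_minus by simp

lemma Qp_power: "x \<in> Qp nrm \<Longrightarrow> x ^ n \<in> Qp nrm"
  using Qp_of_nat[of 1] by (induction n) (auto intro: Qp_mult)

lemma Qp_inverse: "x \<in> Qp nrm \<Longrightarrow> inverse x \<in> Qp nrm"
proof (cases "x = 0")
  case True
  then show ?thesis using Qp_of_nat[of 0] by simp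
next
  case False
  assume x: "x \<in> Qp nrm"
  show ?thesis
  proof (rule QpI)
    fix e :: real assume e: "e > 0"
    \<comment> \<open>The first bound forces \<open>of_rat r\<close> to have the norm of x; the
      second absorbs the division by the product of x and \<open>of_rat r\<close>.\<close>
    define d where "d = min (nrm x) (e * nrm x ^ 2)"
    have "d > 0" using e False by (simp add: d_def)
    then obtain r where r: "nrm (x - of_rat r) < d"
      using Qp_approx[OF x] by blast
    have eq: "nrm (of_rat r) = nrm x"
      using nrm_add_eq[of "of_rat r - x" x] r nrm_minus_commute[of x "of_rat r"] by (simp add: d_def)
    have "of_rat r \<noteq> (0 :: 'a)" using eq False by auto
    then have "inverse x - of_rat (inverse r) = (of_rat r - x) / (x * of_rat r)"
      unfolding of_rat_inverse using False by (simp add: field_simps)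
    then have "nrm (inverse x - of_rat (inverse r)) = nrm (x - of_rat r) / nrm x ^ 2"
      by (simp add: nrm_divide nrm_mult eq power2_eq_square nrm_minus_commute)
    also have "\<dots> < e" using r False by (simp add: d_def field_simps)
    finally show "\<exists>r. nrm (inverse x - of_rat r) < e" by blast
  qed
qed

text \<open>In lowest terms the denominator is prime to p, for otherwise the numerator would have
  norm 1 and the fraction norm above 1. So the denominator can be inverted modulo p^N.\<close>

lemma rat_approx_nat:
  assumes "nrm (of_rat r) \<le> 1"
  obtains m :: nat where "nrm (of_rat r - of_nat m) \<le> 1 / real p ^ N"
proof -
  obtain a b where ab: "quotient_of r = (a, b)" by force
  then have r: "r = of_int a / of_int b" and b: "b > 0" and cop: "coprime a b"
    using quotient_of_div quotient_of_denom_pos quotient_of_coprime by blast+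
  have rr: "(of_rat r :: 'a) = of_int a / of_int b" by (simp add: r of_rat_divide)
  have pb: "\<not> int p dvd b"
  proof
    assume dvd: "int p dvd b"
    then have "coprime a (int p)"
      using cop coprime_divisors dvd_refl by blast
    then have "nrm (of_int a) = 1" by (rule nrm_of_int_coprime)
    moreover have "nrm (of_int b) \<le> 1 / real p"
      using nrm_of_int_multiple[of 1 b] dvd by simp
    moreover have "nrm (of_int a) \<le> nrm (of_int b)"
      using assms b divide_le_eq_1_pos[of "nrm (of_int b)" "nrm (of_int a)"] by (simp add: rr nrm_divide)
    moreover have "1 / real p < 1" using p_gt_1 by simp
    ultimately show False by linarith
  qed
  then have "coprime (int p) b"
    using prime_p by (intro prime_imp_coprime) auto
  then have cb: "coprime b (int p)" by (simp add: coprime_commute)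
  then have "coprime b (int p ^ N)" by simp
  then obtain x y where xy: "x * b + y * int p ^ N = 1"
    using bezout_int[of b "int p ^ N"] by (auto simp: coprime_iff_gcd_eq_1)
  define m where "m = nat ((a * x) mod int p ^ N)"
  have m: "int m = (a * x) mod int p ^ N"
    using p_gt_1 by (simp add: m_def)
  have "int p ^ N dvd a * x - int m"
    unfolding m by (simp add: minus_mod_eq_mult_div)
  moreover have "a - b * int m = b * (a * x - int m) + a * y * int p ^ N"
  proof -
    have "a = a * (x * b + y * int p ^ N)" using xy by simp
    then show ?thesis by (simp add: algebra_simps)
  qed
  ultimately have "int p ^ N dvd a - b * int m" by simp
  then have "nrm (of_int (a - b * int m)) \<le> 1 / real p ^ N"
    by (rule nrm_of_int_multiple)
  moreover have "of_rat r - of_nat m = (of_int (a - b * int m) / of_int b :: 'a)"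
    using b by (simp add: rr field_simps)
  moreover have "nrm (of_int b) = 1" by (rule nrm_of_int_coprime[OF cb])
  ultimately have "nrm (of_rat r - of_nat m) \<le> 1 / real p ^ N"
    by (simp add: nrm_divide)
  then show ?thesis using that by blast
qed

definition Zp :: "'a set" where "Zp = {x \<in> Qp nrm. nrm x \<le> 1}"

lemma Zp_approx_nat:
  assumes "x \<in> Zp"
  obtains m where "m < p ^ N" "nrm (x - of_nat m) \<le> 1 / real p ^ N"
proof -
  have p0: "1 / real p ^ N > 0" "1 / real p ^ N \<le> 1" using p_gt_1 by auto
  obtain r where r: "nrm (x - of_rat r) < 1 / real p ^ N"
    using assms Qp_approx p0(1) unfolding Zp_def by blast
  have "nrm (x - (x - of_rat r)) \<le> 1"
    using less_le_trans[OF r p0(2)] assms nrm_diff_le[of x 1 "x - of_rat r"] unfolding Zp_def by simp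
  then obtain m where m: "nrm (of_rat r - of_nat m) \<le> 1 / real p ^ N"
    using rat_approx_nat[of r N] by auto
  have "nrm (of_nat m - of_nat (m mod p ^ N)) \<le> 1 / real p ^ N"
    using nrm_of_nat_multiple[of N "m - m mod p ^ N"] by (simp add: of_nat_diff dvd_minus_mod)
  then have "nrm ((x - of_rat r) + ((of_rat r - of_nat m) + (of_nat m - of_nat (m mod p ^ N)))) \<le> 1 / real p ^ N"
    using r m by (intro nrm_add_le) auto
  then show ?thesis using that[of "m mod p ^ N"] p_gt_1 by simp
qed

text \<open>Natural numbers have integral binomial coefficients and are dense in the p-adic
  integers. Choosing m so close to x that x - m is at most as large as i! makes up for the division
  by i! in the difference of the two binomial coefficients.\<close>

lemma gchoose_le_1:
  assumes "x \<in> Zp" shows "nrm (x gchoose i) \<le> 1"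
proof -
  have xn: "nrm (x - of_nat l) \<le> 1" for l
    using assms by (intro nrm_diff_le nrm_of_nat_le_1) (auto simp: Zp_def)
  obtain N where "(1 / real p) ^ N < nrm (fact i)"
    using real_arch_pow_inv[of "nrm (fact i)" "1 / real p"] p_gt_1 by auto
  then have N: "1 / real p ^ N \<le> nrm (fact i)" by (simp add: power_one_over)
  obtain m where "nrm (x - of_nat m) \<le> 1 / real p ^ N"
    using Zp_approx_nat[OF assms] by blast
  then have m: "nrm (x - of_nat m) \<le> nrm (fact i)" using N by simp
  have diff: "nrm ((\<Prod>l<j. x - of_nat l) - (\<Prod>l<j. of_nat m - of_nat l)) \<le> nrm (x - of_nat m)" for j
  proof (induction j)
    case (Suc j)
    let ?P = "\<Prod>l<j. x - of_nat l" and ?Q = "\<Prod>l<j. of_nat m - of_nat l :: 'a"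
    have Q: "nrm ?Q \<le> 1"
    proof (induction j)
      case (Suc j)
      have "nrm (of_nat m - of_nat j) \<le> 1" by (intro nrm_diff_le nrm_of_nat_le_1)
      then show ?case using Suc.IH by (auto intro!: nrm_mult_le_1)
    qed auto
    have "(\<Prod>l<Suc j. x - of_nat l) - (\<Prod>l<Suc j. of_nat m - of_nat l)
      = (?P - ?Q) * (x - of_nat j) + (x - of_nat m) * ?Q"
      by (simp add: algebra_simps)
    also have "nrm \<dots> \<le> nrm (x - of_nat m)"
    proof (rule nrm_add_le)
      show "nrm ((?P - ?Q) * (x - of_nat j)) \<le> nrm (x - of_nat m)"
        using mult_mono[OF Suc.IH xn[of j]] by (simp add: nrm_mult)
      show "nrm ((x - of_nat m) * ?Q) \<le> nrm (x - of_nat m)"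
        using mult_left_mono[OF Q, of "nrm (x - of_nat m)"] by (simp add: nrm_mult)
    qed
    finally show ?case .
  qed auto
  have "(x gchoose i) - of_nat (m choose i) = ((\<Prod>l<i. x - of_nat l) - (\<Prod>l<i. of_nat m - of_nat l)) / fact i"
    by (simp add: binomial_gbinomial gbinomial_prod_rev atLeast0LessThan diff_divide_distrib)
  then have "nrm ((x gchoose i) - of_nat (m choose i)) \<le> 1"
    using diff[of i] m by (simp add: nrm_divide divide_le_eq_1)
  then have "nrm (((x gchoose i) - of_nat (m choose i)) + of_nat (m choose i)) \<le> 1"
    by (intro nrm_add_le nrm_of_nat_le_1)
  then show ?thesis by simp
qed

lemma int_fps_binomial: "x \<in> Zp \<Longrightarrow> int_fps (fps_binomial x)"
  by (simp add: int_fps_def gchoose_le_1)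

lemma Qp_complete:
  assumes "pcauchy nrm s" "\<And>n. s n \<in> Qp nrm"
  obtains l where "l \<in> Qp nrm" "plim nrm s l"
proof -
  have "\<exists>r. \<forall>n. nrm (s n - of_rat (r n)) < inverse (real (Suc n))"
    using Qp_approx[OF assms(2)] by (intro choice) (metis inverse_positive_iff_positive of_nat_0_less_iff zero_less_Suc)
  then obtain r where r: "\<And>n. nrm (s n - of_rat (r n)) < inverse (real (Suc n))"
    by blast
  then have d: "plim nrm (\<lambda>n. s n - of_rat (r n)) 0"
    by (intro plimI_le[OF _ LIMSEQ_inverse_real_of_nat]) (auto intro: less_imp_le)
  have "pcauchy nrm (\<lambda>n. of_rat (r n))"
    unfolding pcauchy_def
  proof (intro allI impI)
    fix e :: real assume e: "e > 0"
    obtain n0 where n0: "\<And>n. n \<ge> n0 \<Longrightarrow> nrm (s n - of_rat (r n) - 0) < e"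
      using plim_eventually_close[OF d e] by blast
    obtain n1 where n1: "\<And>m n. m \<ge> n1 \<Longrightarrow> n \<ge> n1 \<Longrightarrow> nrm (s m - s n) < e"
      using assms(1) e unfolding pcauchy_def by blast
    have "nrm (of_rat (r m) - of_rat (r n)) < e" if "m \<ge> max n0 n1" "n \<ge> max n0 n1" for m n
    proof -
      have "nrm (of_rat (r m) - s n) < e"
        using nrm_trans_less[of "of_rat (r m)" "s m"] n0[of m] n1[of m n] that nrm_minus_commute[of "s m"]
        by auto
      then show ?thesis
        using nrm_trans_less[of "of_rat (r m)" "s n" e "of_rat (r n)"] n0[of n] that by auto
    qed
    then show "\<exists>n0. \<forall>m\<ge>n0. \<forall>n\<ge>n0. nrm (of_rat (r m) - of_rat (r n)) < e" by blast
  qed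
  then obtain l where l: "plim nrm (\<lambda>n. of_rat (r n)) l" using rat_complete by blast
  then have "l \<in> Qp nrm" by (auto simp: Qp_def)
  moreover have "plim nrm s l" using plim_add[OF d l] by simp
  ultimately show ?thesis using that by blast
qed

definition Qp_span :: "'a set \<Rightarrow> 'a set" where
  "Qp_span B = {x. \<exists>c. (\<forall>b\<in>B. c b \<in> Qp nrm) \<and> x = (\<Sum>b\<in>B. c b * b)}"

lemma Qp_spanE:
  assumes "x \<in> Qp_span B"
  obtains c where "\<And>b. b \<in> B \<Longrightarrow> c b \<in> Qp nrm" "x = (\<Sum>b\<in>B. c b * b)"
proof -
  from assms obtain c where c: "(\<forall>b\<in>B. c b \<in> Qp nrm) \<and> x = (\<Sum>b\<in>B. c b * b)"
    unfolding Qp_span_def mem_Collect_eq by (elim exE)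
  show ?thesis by (rule that[of c]) (use c in auto)
qed

lemma Qp_spanI: "(\<And>b. b \<in> B \<Longrightarrow> c b \<in> Qp nrm) \<Longrightarrow> x = (\<Sum>b\<in>B. c b * b) \<Longrightarrow> x \<in> Qp_span B"
  unfolding Qp_span_def by blast

lemma Qp_span_scale: "x \<in> Qp_span B \<Longrightarrow> c \<in> Qp nrm \<Longrightarrow> c * x \<in> Qp_span B"
  by (erule Qp_spanE, rule Qp_spanI[of _ "\<lambda>b. c * d b" for d])
    (auto simp: Qp_mult sum_distrib_left mult.assoc)

lemma Qp_span_diff: "x \<in> Qp_span B \<Longrightarrow> y \<in> Qp_span B \<Longrightarrow> x - y \<in> Qp_span B"
  by (erule Qp_spanE, erule Qp_spanE, rule Qp_spanI[of _ "\<lambda>b. d b - e b" for d e])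
    (auto simp: Qp_diff sum_subtractf left_diff_distrib)

lemma Qp_span_insert:
  "finite B \<Longrightarrow> b \<notin> B \<Longrightarrow> x \<in> Qp_span (insert b B) \<longleftrightarrow> (\<exists>c\<in>Qp nrm. \<exists>v\<in>Qp_span B. x = v + c * b)"
proof
  assume B: "finite B" "b \<notin> B"
  {
    assume "x \<in> Qp_span (insert b B)"
    then obtain d where d: "\<And>b'. b' \<in> insert b B \<Longrightarrow> d b' \<in> Qp nrm" "x = (\<Sum>b\<in>insert b B. d b * b)"
      by (elim Qp_spanE) (rule that)
    have "(\<Sum>b\<in>B. d b * b) \<in> Qp_span B"
      by (rule Qp_spanI[of _ d]) (use d(1) in auto)
    moreover have "x = (\<Sum>b\<in>B. d b * b) + d b * b"
      using B d(2) by (simp add: add.commute)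
    ultimately show "\<exists>c\<in>Qp nrm. \<exists>v\<in>Qp_span B. x = v + c * b"
      using d(1)[of b] by blast
  next
    assume "\<exists>c\<in>Qp nrm. \<exists>v\<in>Qp_span B. x = v + c * b"
    then obtain c v where c: "c \<in> Qp nrm" "x = v + c * b" and v: "v \<in> Qp_span B" by blast
    from v obtain d where d: "\<And>b. b \<in> B \<Longrightarrow> d b \<in> Qp nrm" "v = (\<Sum>b\<in>B. d b * b)"
      by (elim Qp_spanE) (rule that)
    have "(\<Sum>b'\<in>B. (d(b := c)) b' * b') = v"
      unfolding d(2) using B by (intro sum.cong) auto
    then have "x = (\<Sum>b'\<in>insert b B. (d(b := c)) b' * b')"
      using B c(2) by (simp add: add.commute)
    then show "x \<in> Qp_span (insert b B)"
      by (rule Qp_spanI[rotated]) (use c d in auto)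
  }
qed

text \<open>Induction on the spanning set. If b is not in the span of the others, it has positive
  distance from that span, which is complete by induction and therefore closed. Hence the
  coordinates at b of a Cauchy sequence are Cauchy, and so is the remaining part.\<close>

lemma Qp_span_complete:
  assumes "finite B" "pcauchy nrm s" "\<And>n. s n \<in> Qp_span B"
  shows "\<exists>l\<in>Qp_span B. plim nrm s l"
  using assms
proof (induction B arbitrary: s rule: finite_induct)
  case empty
  then have "s = (\<lambda>n. 0)" "0 \<in> Qp_span {}" by (auto simp: Qp_span_def)
  then show ?case using plim_const[of 0] by auto
next
  case (insert b B)
  obtain c v where cv: "\<And>n. c n \<in> Qp nrm" "\<And>n. v n \<in> Qp_span B" "\<And>n. s n = v n + c n * b"
    using insert.prems(2) unfolding Qp_span_insert[OF insert.hyps] by metis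
  show ?case
  proof (cases "b \<in> Qp_span B")
    case True
    have "v n + c n * b \<in> Qp_span B" for n
      using Qp_span_diff[OF cv(2)[of n] Qp_span_scale[OF True Qp_minus[OF cv(1)[of n]]]] by simp
    then obtain l where "l \<in> Qp_span B" "plim nrm s l"
      using insert.IH[OF insert.prems(1)] unfolding cv(3) by blast
    moreover from this have "l \<in> Qp_span (insert b B)"
      unfolding Qp_span_insert[OF insert.hyps] using Qp_of_nat[of 0] by force
    ultimately show ?thesis by blast
  next
    case False
    have "\<exists>d>0. \<forall>v\<in>Qp_span B. d \<le> nrm (v + b)"
    proof (rule ccontr)
      assume "\<not> ?thesis"
      then have "\<exists>w. \<forall>n. w n \<in> Qp_span B \<and> nrm (w n + b) < inverse (real (Suc n))"
        by (intro choice) (metis inverse_positive_iff_positive not_le of_nat_0_less_iff zero_less_Suc)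
      then obtain w where w: "\<And>n. w n \<in> Qp_span B" "\<And>n. nrm (w n + b) < inverse (real (Suc n))"
        by blast
      have lim: "plim nrm w (- b)"
        by (rule plimI_le[OF _ LIMSEQ_inverse_real_of_nat]) (use w(2) in \<open>auto intro: less_imp_le\<close>)
      obtain l where l: "l \<in> Qp_span B" "plim nrm w l"
        using insert.IH[OF plim_imp_pcauchy[OF lim] w(1)] by blast
      then have "- b \<in> Qp_span B" using plim_unique[OF lim l(2)] by simp
      from Qp_span_scale[OF this, of "-1"] False show False
        using Qp_minus[OF Qp_of_nat[of 1]] by simp
    qed
    then obtain d where d: "d > 0" "\<And>v. v \<in> Qp_span B \<Longrightarrow> d \<le> nrm (v + b)" by blast
    have dc: "nrm x * d \<le> nrm (w + x * b)" if "x \<in> Qp nrm" "w \<in> Qp_span B" for x w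
    proof (cases "x = 0")
      case False
      have "d \<le> nrm (inverse x * w + b)"
        by (intro d Qp_span_scale Qp_inverse that)
      then have "nrm x * d \<le> nrm (x * (inverse x * w + b))"
        by (simp add: nrm_mult mult_left_mono)
      then show ?thesis using False by (simp add: distrib_left flip: mult.assoc)
    qed auto
    have "pcauchy nrm c"
      unfolding pcauchy_def
    proof (intro allI impI)
      fix e :: real assume "e > 0"
      then obtain n0 where n0: "\<And>m n. m \<ge> n0 \<Longrightarrow> n \<ge> n0 \<Longrightarrow> nrm (s m - s n) < e * d"
        using insert.prems(1) d(1) unfolding pcauchy_def by (meson mult_pos_pos)
      have "nrm (c m - c n) < e" if "m \<ge> n0" "n \<ge> n0" for m n
      proof -
        have "nrm (c m - c n) * d \<le> nrm ((v m - v n) + (c m - c n) * b)"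
          by (intro dc Qp_diff Qp_span_diff cv)
        also have "\<dots> = nrm (s m - s n)" by (simp add: cv(3) algebra_simps)
        also have "\<dots> < e * d" using n0 that by blast
        finally show ?thesis using d(1) by simp
      qed
      then show "\<exists>n0. \<forall>m\<ge>n0. \<forall>n\<ge>n0. nrm (c m - c n) < e" by blast
    qed
    then obtain c' where c': "c' \<in> Qp nrm" "plim nrm c c'"
      using Qp_complete cv(1) by blast
    have "pcauchy nrm v"
      unfolding pcauchy_def
    proof (intro allI impI)
      fix e :: real assume e: "e > 0"
      obtain n0 where n0: "\<And>m n. m \<ge> n0 \<Longrightarrow> n \<ge> n0 \<Longrightarrow> nrm (s m - s n) < e"
        using insert.prems(1) e unfolding pcauchy_def by meson
      obtain n1 where n1: "\<And>m n. m \<ge> n1 \<Longrightarrow> n \<ge> n1 \<Longrightarrow> nrm (b * c m - b * c n) < e"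
        using plim_imp_pcauchy[OF plim_cmult[OF c'(2), of b]] e unfolding pcauchy_def by meson
      have "nrm (v m - v n) < e" if "m \<ge> max n0 n1" "n \<ge> max n0 n1" for m n
      proof -
        have "nrm ((s m - s n) - (b * c m - b * c n)) < e"
          using that by (intro nrm_diff_less n0 n1) auto
        then show ?thesis by (simp add: cv(3) algebra_simps)
      qed
      then show "\<exists>n0. \<forall>m\<ge>n0. \<forall>n\<ge>n0. nrm (v m - v n) < e" by blast
    qed
    then obtain v' where v': "v' \<in> Qp_span B" "plim nrm v v'"
      using insert.IH cv(2) by blast
    have "s = (\<lambda>n. v n + b * c n)"
      using cv(3) by (auto simp: mult.commute)
    then have "plim nrm s (v' + c' * b)"
      using plim_add[OF v'(2) plim_cmult[OF c'(2), of b]] by (simp add: mult.commute)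
    moreover have "v' + c' * b \<in> Qp_span (insert b B)"
      unfolding Qp_span_insert[OF insert.hyps] using v' c' by blast
    ultimately show ?thesis by blast
  qed
qed

end

section \<open>The Mellin transform\<close>

definition subring_set :: "'a::comm_ring_1 set \<Rightarrow> bool" where
  "subring_set R \<longleftrightarrow> 0 \<in> R \<and> 1 \<in> R \<and> (\<forall>x\<in>R. \<forall>y\<in>R. x + y \<in> R \<and> x * y \<in> R) \<and> (\<forall>x\<in>R. - x \<in> R)"

lemma subring_setD:
  assumes "subring_set R"
  shows "0 \<in> R" "1 \<in> R" "x \<in> R \<Longrightarrow> y \<in> R \<Longrightarrow> x + y \<in> R" "x \<in> R \<Longrightarrow> y \<in> R \<Longrightarrow> x * y \<in> R"
    "x \<in> R \<Longrightarrow> - x \<in> R" "x \<in> R \<Longrightarrow> y \<in> R \<Longrightarrow> x - y \<in> R"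
  using assms unfolding subring_set_def by (blast, blast, blast, blast, blast, metis diff_conv_add_uminus)

lemma subring_set_sum: "subring_set R \<Longrightarrow> (\<And>i. i \<in> A \<Longrightarrow> f i \<in> R) \<Longrightarrow> sum f A \<in> R"
  by (induction A rule: infinite_finite_induct) (auto intro: subring_setD)

lemma subring_set_prod: "subring_set R \<Longrightarrow> (\<And>i. i \<in> A \<Longrightarrow> f i \<in> R) \<Longrightarrow> prod f A \<in> R"
  by (induction A rule: infinite_finite_induct) (auto intro: subring_setD)

lemma subring_set_of_nat: "subring_set R \<Longrightarrow> of_nat n \<in> R"
  by (induction n) (auto intro: subring_setD)

lemma fps_over_subring: "subring_set R \<Longrightarrow> subring_set {F. fps_over R F}"
  unfolding subring_set_def[of "{F. fps_over R F}"]
  by (auto simp: fps_over_def fps_mult_nth fps_one_nth intro: subring_setD subring_set_sum)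

lemma fps_over_mult: "subring_set R \<Longrightarrow> fps_over R F \<Longrightarrow> fps_over R G \<Longrightarrow> fps_over R (F * G)"
  and fps_over_add: "subring_set R \<Longrightarrow> fps_over R F \<Longrightarrow> fps_over R G \<Longrightarrow> fps_over R (F + G)"
  and fps_over_diff: "subring_set R \<Longrightarrow> fps_over R F \<Longrightarrow> fps_over R G \<Longrightarrow> fps_over R (F - G)"
  and fps_over_const: "subring_set R \<Longrightarrow> c \<in> R \<Longrightarrow> fps_over R (fps_const c)"
  and fps_over_1: "subring_set R \<Longrightarrow> fps_over R 1"
  and fps_over_X: "subring_set R \<Longrightarrow> fps_over R fps_X"
  using subring_setD[OF fps_over_subring[of R]] subring_setD(1,2)[of R]
  by (auto simp: fps_over_def fps_nth_fps_const fps_X_def)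

lemma fps_over_power: "subring_set R \<Longrightarrow> fps_over R F \<Longrightarrow> fps_over R (F ^ n)"
  by (induction n) (auto intro: fps_over_1 fps_over_mult)

lemma fps_over_prod: "subring_set R \<Longrightarrow> (\<And>i. i \<in> A \<Longrightarrow> fps_over R (F i)) \<Longrightarrow> fps_over R (prod F A)"
  using subring_set_prod[OF fps_over_subring, of R A F] by auto

lemma fps_over_compose: "subring_set R \<Longrightarrow> fps_over R F \<Longrightarrow> fps_over R G \<Longrightarrow> fps_over R (F oo G)"
  using fps_over_power[of R G]
  by (auto simp: fps_over_def fps_compose_nth intro!: subring_set_sum intro: subring_setD)

lemma fps_of_poly_omega: "fps_of_poly (omega p n) = (1 + fps_X) ^ (p ^ n) - 1"
  by (simp add: omega_def fps_of_poly_diff fps_of_poly_power fps_of_poly_pCons)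

lemma fps_of_poly_omega_binomial: "fps_of_poly (omega p n) = fps_binomial (of_nat (p ^ n) :: 'a::field_char_0) - 1"
  unfolding fps_of_poly_omega fps_binomial_of_nat ..

lemma coeff_omega:
  "coeff (omega p n :: 'a::field_char_0 poly) l = of_nat (p ^ n choose l) - (if l = 0 then 1 else 0)"
proof -
  have "coeff (omega p n :: 'a poly) l = fps_nth (fps_of_poly (omega p n)) l" by simp
  also have "\<dots> = of_nat (p ^ n choose l) - (if l = 0 then 1 else 0)"
    unfolding fps_of_poly_omega_binomial
    by (simp add: binomial_gbinomial flip: of_nat_power)
  finally show ?thesis .
qed

lemma omega_Suc: "omega p (Suc n) = (omega p n :: 'a::comm_ring_1 poly) * (\<Sum>i<p. ([:1, 1:] ^ (p ^ n)) ^ i)"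
proof -
  have "([:1, 1:] :: 'a poly) ^ (p ^ Suc n) = ([:1, 1:] ^ (p ^ n)) ^ p"
    by (simp only: power_Suc mult.commute[of p] power_mult)
  then show ?thesis
    unfolding omega_def using power_diff_1_eq[of "([:1, 1:] :: 'a poly) ^ (p ^ n)" p] by simp
qed

section \<open>The polynomials \<open>omega p n\<close> and p-adic powers of 1 + X\<close>

context padic
begin

abbreviation omega_fps :: "nat \<Rightarrow> 'a fps" where
  "omega_fps n \<equiv> fps_of_poly (omega p n)"

lemma omega_distinguished:
  "distinguished (omega p n)" "degree (omega p n :: 'a poly) = p ^ n"
  "coeff (omega p n :: 'a poly) 0 = 0" "coeff (omega p n :: 'a poly) 1 \<noteq> 0"
proof -
  have pn: "p ^ n > 0" using p_gt_1 by simp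
  have top: "coeff (omega p n :: 'a poly) (p ^ n) = 1"
    using pn by (simp add: coeff_omega)
  have "coeff (omega p n :: 'a poly) l = 0" if "l > p ^ n" for l
    using that pn by (auto simp: coeff_omega binomial_eq_0)
  then have "degree (omega p n :: 'a poly) \<le> p ^ n"
    by (intro degree_le) auto
  then show deg: "degree (omega p n :: 'a poly) = p ^ n"
    using top by (intro antisym le_degree) auto
  show "coeff (omega p n :: 'a poly) 0 = 0" "coeff (omega p n :: 'a poly) 1 \<noteq> 0"
    using pn by (simp_all add: coeff_omega)
  have "nrm (coeff (omega p n) l) < 1" if "l < p ^ n" for l
  proof (cases "l = 0")
    case False
    \<comment> \<open>From l * (p^n choose l) = p^n * (p^n - 1 choose l - 1): a binomial coefficient
      prime to p would force p^n to divide l.\<close>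
    have "p dvd (p ^ n choose l)"
    proof (rule ccontr)
      assume "\<not> p dvd (p ^ n choose l)"
      then have "coprime (p ^ n) (p ^ n choose l)"
        using prime_p by (simp add: prime_imp_coprime)
      moreover have "p ^ n dvd l * (p ^ n choose l)"
        using times_binomial_minus1_eq[of l "p ^ n"] False by simp
      ultimately have "p ^ n dvd l"
        by (simp add: coprime_dvd_mult_left_iff)
      with that False show False by (auto dest: dvd_imp_le)
    qed
    then have "nrm (of_nat (p ^ n choose l)) \<le> 1 / real p"
      using nrm_of_nat_multiple[of 1] by simp
    also have "\<dots> < 1" using p_gt_1 by simp
    finally show ?thesis using False by (simp add: coeff_omega)
  qed (simp add: coeff_omega)
  then show "distinguished (omega p n)"
    using deg top by (simp add: distinguished_def)
qed

lemma int_fps_omega: "int_fps (omega_fps n)"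
  unfolding fps_of_poly_omega by (intro int_fps_diff int_fps_power int_fps_add) auto

lemma subring_set_Qp: "subring_set (Qp nrm)"
  unfolding subring_set_def using Qp_of_nat[of 0] Qp_of_nat[of 1]
  by (auto intro: Qp_add Qp_mult Qp_minus)

lemma gchoose_Qp: "x \<in> Qp nrm \<Longrightarrow> x gchoose i \<in> Qp nrm"
  unfolding gbinomial_prod_rev divide_inverse fact_prod_Suc
  by (intro Qp_mult Qp_inverse subring_set_prod[OF subring_set_Qp]) (auto intro: Qp_diff Qp_of_nat simp flip: of_nat_Suc of_nat_prod)

lemma Zp_of_nat: "of_nat n \<in> Zp"
  by (simp add: Zp_def Qp_of_nat nrm_of_nat_le_1)

lemma Zp_mult: "x \<in> Zp \<Longrightarrow> y \<in> Zp \<Longrightarrow> x * y \<in> Zp"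
  by (auto simp: Zp_def Qp_mult nrm_mult_le_1)

lemma Zp_power: "x \<in> Zp \<Longrightarrow> x ^ n \<in> Zp"
  by (auto simp: Zp_def Qp_power nrm_power_le_1)

lemma fps_binomial_minus_1: "fps_binomial x - 1 = fps_X * fps_shift 1 (fps_binomial x :: 'a fps)"
  by (auto simp: fps_eq_iff)

text \<open>With \<open>x - y = p ^ n * w\<close> the difference is a multiple of \<open>(1 + \<omega>\<^sub>n) ^ w - 1\<close>.\<close>

lemma int_dvd_binomial_diff:
  assumes xy: "x \<in> Zp" "y \<in> Zp" and close: "nrm (x - y) \<le> 1 / real p ^ n"
  shows "int_dvd (omega_fps n) (fps_binomial x - fps_binomial y)"
proof -
  define w where "w = inverse (of_nat (p ^ n)) * (x - y)"
  have pn: "(of_nat (p ^ n) :: 'a) \<noteq> 0" using p_gt_1 by simp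
  have "nrm w = real p ^ n * nrm (x - y)"
    by (simp add: w_def nrm_mult nrm_inverse nrm_power nrm_p power_inverse flip: inverse_eq_divide)
  then have "nrm w \<le> 1"
    using close p_gt_1 by (simp add: field_simps)
  moreover have "w \<in> Qp nrm"
    unfolding w_def using xy by (intro Qp_mult Qp_inverse Qp_of_nat Qp_diff) (auto simp: Zp_def)
  ultimately have w: "w \<in> Zp" by (simp add: Zp_def)
  let ?W = "omega_fps n :: 'a fps"
  have W0: "fps_nth ?W 0 = 0" using omega_distinguished(3) by simp
  have xyw: "x = y + w * of_nat (p ^ n)"
    using pn by (simp add: w_def field_simps)
  have "fps_binomial (w * of_nat (p ^ n)) = fps_binomial w oo ?W"
    unfolding fps_of_poly_omega_binomial fps_binomial_compose ..
  then have "fps_binomial x - fps_binomial y = fps_binomial y * ((fps_binomial w - 1) oo ?W)"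
    unfolding xyw fps_binomial_add_mult by (simp add: fps_compose_sub_distrib algebra_simps)
  also have "\<dots> = fps_binomial y * (?W * (fps_shift 1 (fps_binomial w) oo ?W))"
    unfolding fps_binomial_minus_1 fps_compose_mult_distrib[OF W0] fps_X_fps_compose_startby0[OF W0] ..
  finally have "fps_binomial x - fps_binomial y = fps_binomial y * (?W * (fps_shift 1 (fps_binomial w) oo ?W))" .
  moreover have "int_dvd ?W (?W * (fps_shift 1 (fps_binomial w) oo ?W))"
    unfolding int_dvd_def using int_fps_binomial[OF w] int_fps_omega
    by (intro exI[of _ "fps_shift 1 (fps_binomial w) oo ?W"]) (auto intro: int_fps_shift)
  ultimately show ?thesis
    using int_dvd_mult[OF _ int_fps_binomial[OF xy(2)]] by simp
qed

end

section \<open>Finite extensions, the topological generator, and convergence of the Mellin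
  transform\<close>

locale padic_ext = padic nrm p
  for nrm :: "'a::field_char_0 \<Rightarrow> real" and p :: nat +
  fixes K :: "'a set" and u :: 'a
  assumes odd_p: "odd p" and finite_ext: "is_finite_ext nrm K" and generator: "is_generator p nrm u"
begin

abbreviation OK :: "'a set" where "OK \<equiv> int_ring nrm K"

lemma K_subfield: "is_subfield K" and Qp_subset_K: "Qp nrm \<subseteq> K"
  using finite_ext by (auto simp: is_finite_ext_def)

lemma subring_set_K: "subring_set K"
  using K_subfield unfolding subring_set_def is_subfield_def by auto

lemma subring_set_OK: "subring_set OK"
  unfolding subring_set_def int_ring_def using subring_setD[OF subring_set_K]
  by (auto intro: nrm_add_le nrm_mult_le_1)

lemma fps_over_OK_iff: "fps_over OK F \<longleftrightarrow> fps_over K F \<and> int_fps F"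
  by (auto simp: fps_over_def int_ring_def int_fps_def)

lemma K_complete:
  assumes "pcauchy nrm s" "\<And>n. s n \<in> K"
  obtains l where "l \<in> K" "plim nrm s l"
proof -
  obtain B where B: "finite B" "B \<subseteq> K" "\<And>x. x \<in> K \<Longrightarrow> \<exists>c. (\<forall>b\<in>B. c b \<in> Qp nrm) \<and> x = (\<Sum>b\<in>B. c b * b)"
    using finite_ext unfolding is_finite_ext_def by blast
  have "s n \<in> Qp_span B" for n
    using B(3)[OF assms(2)[of n]] unfolding Qp_span_def by simp
  then obtain l where l: "l \<in> Qp_span B" "plim nrm s l"
    using Qp_span_complete[OF B(1) assms(1)] by blast
  from l(1) obtain c where c: "\<And>b. b \<in> B \<Longrightarrow> c b \<in> Qp nrm" "l = (\<Sum>b\<in>B. c b * b)"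
    by (elim Qp_spanE) (rule that)
  have "l \<in> K"
    unfolding c(2) using c(1) B(2) Qp_subset_K
    by (intro subring_set_sum[OF subring_set_K] subring_setD(4)[OF subring_set_K]) auto
  then show ?thesis using that l(2) by blast
qed

lemma u_Zp: "u \<in> Zp" and nrm_u_minus_1_le: "nrm (u - 1) \<le> 1 / real p" and nrm_u: "nrm u = 1"
proof -
  show le: "nrm (u - 1) \<le> 1 / real p" using generator by (simp add: is_generator_def)
  have "1 / real p < 1" using p_gt_1 by simp
  then show "nrm u = 1"
    using nrm_add_eq[of "u - 1" 1] le by simp
  then show "u \<in> Zp" using generator by (simp add: Zp_def is_generator_def)
qed

lemma u_K: "u \<in> K"
  using u_Zp Qp_subset_K by (auto simp: Zp_def)

lemma nrm_u_power_minus_1_le: "nrm (u ^ s - 1) \<le> 1 / real p"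
  using nrm_power_diff_le[of u 1 s] nrm_u nrm_u_minus_1_le by simp

text \<open>Powers of u have to approximate 1 + p, which is at distance exactly 1 / p from 1. If u
  were closer to 1 than that, so would be all its powers.\<close>

lemma nrm_u_minus_1: "nrm (u - 1) = 1 / real p"
proof (rule ccontr)
  assume "\<not> ?thesis"
  then have less: "nrm (u - 1) < 1 / real p" using nrm_u_minus_1_le by simp
  have p: "1 / real p > 0" using p_gt_1 by simp
  have "nrm (of_nat (1 + p) - 1) \<le> 1 / real p" by (simp add: nrm_p)
  then obtain m where "nrm (of_nat (1 + p) - u ^ m) < 1 / real p"
    using generator Qp_of_nat[of "1 + p"] p unfolding is_generator_def by meson
  moreover have "nrm (u ^ m - 1) < 1 / real p"
    using nrm_power_diff_le[of u 1 m] nrm_u less by simp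
  ultimately have "nrm (of_nat (1 + p) - 1) < 1 / real p"
    by (rule nrm_trans_less)
  then show False by (simp add: nrm_p)
qed

text \<open>In x^p - 1 = (x - 1) * (1 + x + ... + x^(p - 1)) all powers of x are congruent to 1
  modulo p, so the second factor is congruent to p and contributes 1 / p.\<close>

lemma nrm_power_p_minus_1_le:
  assumes x: "nrm (x - 1) \<le> 1 / real p ^ s" and s: "s \<ge> 1"
  shows "nrm (x ^ p - 1) \<le> 1 / real p ^ (s + 1)"
proof -
  have "1 / real p ^ s \<le> 1 / real p" 
    using s p_gt_1 by (simp add: frac_le self_le_power)
  then have xp: "nrm (x - 1) \<le> 1 / real p" using x by simp
  have "1 / real p \<le> 1" using p_gt_1 by simp
  then have nx: "nrm x \<le> 1"
    using nrm_add_le[of "x - 1" 1 1] xp by simp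
  have "nrm (\<Sum>i<p. x ^ i - 1) \<le> 1 / real p"
    using order_trans[OF nrm_power_diff_le[of x 1] xp] nx by (intro nrm_sum_le) auto
  moreover have "(\<Sum>i<p. x ^ i) = (\<Sum>i<p. x ^ i - 1) + of_nat p"
    by (simp add: sum_subtractf)
  ultimately have "nrm (\<Sum>i<p. x ^ i) \<le> 1 / real p"
    using nrm_add_le[of "\<Sum>i<p. x ^ i - 1" "1 / real p" "of_nat p"] nrm_p by simp
  then have "nrm ((x - 1) * (\<Sum>i<p. x ^ i)) \<le> (1 / real p ^ s) * (1 / real p)"
    unfolding nrm_mult using x by (intro mult_mono) auto
  then show ?thesis by (simp add: power_diff_1_eq mult.commute)
qed

lemma nrm_u_power_p_power_minus_1_le: "nrm (u ^ (p ^ n) - 1) \<le> 1 / real p ^ (n + 1)"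
proof (induction n)
  case (Suc n)
  from nrm_power_p_minus_1_le[OF this] show ?case
    by (simp add: mult.commute flip: power_mult)
qed (use nrm_u_minus_1_le in auto)

lemma gamma_act_binomial: "gamma_act u (fps_binomial x) = fps_binomial (x * u)"
  by (simp add: gamma_act_def fps_binomial_compose)

definition gamma_diff :: "'a fps \<Rightarrow> 'a fps" where
  "gamma_diff F = gamma_act u F - F"

lemma gamma_diff_diff: "gamma_diff (F - G) = gamma_diff F - gamma_diff G"
  by (simp add: gamma_diff_def gamma_act_def fps_compose_sub_distrib)

lemma funpow_gamma_diff_diff: "(gamma_diff ^^ m) (F - G) = (gamma_diff ^^ m) F - (gamma_diff ^^ m) G"
  by (induction m) (simp_all add: gamma_diff_diff)

lemma int_fps_gamma_act: "int_fps F \<Longrightarrow> int_fps (gamma_act u F)"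
  unfolding gamma_act_def using int_fps_compose[OF _ int_fps_diff[OF int_fps_binomial[OF u_Zp] int_fps_1]] .

lemma int_fps_funpow_gamma_diff: "int_fps F \<Longrightarrow> int_fps ((gamma_diff ^^ m) F)"
  by (induction m) (auto simp: gamma_diff_def intro: int_fps_gamma_act)

text \<open>The coefficients of \<open>(1 + \<pi>) ^ x\<close> are polynomials in \<open>x\<close>, and on the function \<open>x ^ s\<close>
  the operator \<open>\<gamma> - 1\<close> acts as multiplication by \<open>u ^ s - 1\<close>.\<close>

lemma funpow_gamma_diff_binomial_nth:
  "fps_nth ((gamma_diff ^^ m) (fps_binomial x)) i =
     (\<Sum>s\<le>degree (gchoose_poly i :: 'a poly). coeff (gchoose_poly i) s * (u ^ s - 1) ^ m * x ^ s)"
proof (induction m arbitrary: x)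
  case 0
  show ?case by (simp add: poly_altdef flip: poly_gchoose_poly)
next
  case (Suc m)
  have step: "(gamma_diff ^^ Suc m) (fps_binomial x)
      = (gamma_diff ^^ m) (fps_binomial (x * u)) - (gamma_diff ^^ m) (fps_binomial x)"
    unfolding funpow_Suc_right o_apply funpow_gamma_diff_diff[symmetric]
    by (simp only: gamma_diff_def gamma_act_binomial)
  show ?case
    unfolding step fps_sub_nth Suc sum_subtractf[symmetric]
    by (intro sum.cong) (simp_all add: algebra_simps power_mult_distrib power_commutes flip: power_mult)
qed

abbreviation mellin_basis :: "nat \<Rightarrow> 'a fps" where
  "mellin_basis m \<equiv> (gamma_diff ^^ m) (1 + fps_X)"

lemma mellin_eq: "mellin nrm u G = Abs_fps (\<lambda>i. psuminf nrm (\<lambda>m. fps_nth G m * fps_nth (mellin_basis m) i))"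
proof -
  have "(\<lambda>F. gamma_act u F - F) = gamma_diff" by (auto simp: gamma_diff_def)
  then show ?thesis by (simp add: mellin_def)
qed

lemma mellin_basis_nth:
  "fps_nth (mellin_basis m) i =
     (\<Sum>s\<le>degree (gchoose_poly i :: 'a poly). coeff (gchoose_poly i) s * (u ^ s - 1) ^ m)"
  using funpow_gamma_diff_binomial_nth[of m 1 i] by (simp add: fps_binomial_1)

lemma int_fps_mellin_basis: "int_fps (mellin_basis m)"
  by (intro int_fps_funpow_gamma_diff int_fps_add) auto

lemma fps_over_Qp_gamma_diff: "fps_over (Qp nrm) F \<Longrightarrow> fps_over (Qp nrm) (gamma_diff F)"
proof -
  have "fps_over (Qp nrm) (fps_binomial u)"
    using u_Zp by (simp add: fps_over_def gchoose_Qp Zp_def)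
  then show "fps_over (Qp nrm) F \<Longrightarrow> fps_over (Qp nrm) (gamma_diff F)"
    unfolding gamma_diff_def gamma_act_def
    by (intro fps_over_diff fps_over_compose fps_over_1 subring_set_Qp)
qed

lemma fps_over_Qp_mellin_basis: "fps_over (Qp nrm) (mellin_basis m)"
  by (induction m) (auto intro!: fps_over_Qp_gamma_diff fps_over_add fps_over_1 fps_over_X subring_set_Qp)

text \<open>Every u^s - 1 is divisible by p, so its m-th power decays geometrically. C depends on i
  through the denominators of \<open>gchoose_poly i\<close>.\<close>

lemma mellin_basis_small:
  obtains C where "C \<ge> 0" "\<And>m. nrm (fps_nth (mellin_basis m) i) \<le> C * (1 / real p) ^ m"
proof
  define C where "C = (\<Sum>s\<le>degree (gchoose_poly i :: 'a poly). nrm (coeff (gchoose_poly i) s))"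
  show "C \<ge> 0" unfolding C_def by (intro sum_nonneg) auto
  fix m
  show "nrm (fps_nth (mellin_basis m) i) \<le> C * (1 / real p) ^ m"
    unfolding mellin_basis_nth
  proof (rule nrm_sum_le)
    fix s assume "s \<in> {..degree (gchoose_poly i :: 'a poly)}"
    then have "nrm (coeff (gchoose_poly i) s) \<le> C"
      unfolding C_def by (intro member_le_sum) auto
    then show "nrm (coeff (gchoose_poly i) s * (u ^ s - 1) ^ m) \<le> C * (1 / real p) ^ m"
      unfolding nrm_mult nrm_power using nrm_u_power_minus_1_le[of s] \<open>C \<ge> 0\<close>
      by (intro mult_mono power_mono) auto
  qed (use \<open>C \<ge> 0\<close> in auto)
qed

text \<open>\<open>psuminf\<close> is a definite description, so a limit has to be exhibited. The
  terms decay geometrically and lie in K, which is complete.\<close>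

lemma mellin_converges:
  assumes "fps_over OK G"
  shows "plim nrm (\<lambda>n. \<Sum>m<n. fps_nth G m * fps_nth (mellin_basis m) i) (fps_nth (mellin nrm u G) i)"
proof -
  let ?t = "\<lambda>m. fps_nth G m * fps_nth (mellin_basis m) i"
  have G: "fps_nth G m \<in> K" "nrm (fps_nth G m) \<le> 1" for m
    using assms by (auto simp: fps_over_def int_ring_def)
  obtain C where C: "\<And>m. nrm (fps_nth (mellin_basis m) i) \<le> C * (1 / real p) ^ m"
    using mellin_basis_small by blast
  have lim: "(\<lambda>m. C * (1 / real p) ^ m) \<longlonglongrightarrow> 0"
    using p_gt_1 by (intro tendsto_mult_right_zero LIMSEQ_realpow_zero) auto
  have "nrm (?t m) \<le> C * (1 / real p) ^ m" for m
    using mult_mono[OF G(2) C] by (simp add: nrm_mult)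
  then have "(\<lambda>m. nrm (?t m)) \<longlonglongrightarrow> 0"
    using plimI_le[of ?t 0 "\<lambda>m. C * (1 / real p) ^ m"] lim by (simp add: plim_def)
  then have "pcauchy nrm (\<lambda>n. \<Sum>m<n. ?t m)"
    by (rule pcauchy_partial_sums)
  moreover have "(\<Sum>m<n. ?t m) \<in> K" for n
    using G(1) fps_over_Qp_mellin_basis Qp_subset_K unfolding fps_over_def
    by (intro subring_set_sum[OF subring_set_K] subring_setD(4)[OF subring_set_K]) auto
  ultimately obtain l where l: "plim nrm (\<lambda>n. \<Sum>m<n. ?t m) l"
    using K_complete by blast
  then show ?thesis
    using psuminf_eqI[OF l] by (simp add: mellin_eq)
qed

lemma mellin_diff:
  assumes "fps_over OK F" "fps_over OK G"
  shows "mellin nrm u (F - G) = mellin nrm u F - mellin nrm u G"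
proof (rule fps_ext)
  fix i
  have "fps_over OK (F - G)" using assms fps_over_diff[OF subring_set_OK] by blast
  note lim = mellin_converges[OF this, where i = i]
  have "plim nrm (\<lambda>n. \<Sum>m<n. fps_nth (F - G) m * fps_nth (mellin_basis m) i)
    (fps_nth (mellin nrm u F) i - fps_nth (mellin nrm u G) i)"
    using plim_diff[OF mellin_converges[OF assms(1), where i = i] mellin_converges[OF assms(2), where i = i]]
    by (simp add: left_diff_distrib sum_subtractf)
  from plim_unique[OF lim this]
  show "fps_nth (mellin nrm u (F - G)) i = fps_nth (mellin nrm u F - mellin nrm u G) i"
    by simp
qed

lemma mellin_cmult:
  assumes "c \<in> OK" "fps_over OK G"
  shows "mellin nrm u (fps_const c * G) = fps_const c * mellin nrm u G"
proof (rule fps_ext)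
  fix i
  have "fps_over OK (fps_const c * G)"
    using assms by (intro fps_over_mult fps_over_const subring_set_OK)
  note lim = mellin_converges[OF this, where i = i]
  have "plim nrm (\<lambda>n. \<Sum>m<n. fps_nth (fps_const c * G) m * fps_nth (mellin_basis m) i)
    (c * fps_nth (mellin nrm u G) i)"
    using plim_cmult[OF mellin_converges[OF assms(2), where i = i], of c]
    by (simp add: sum_distrib_left mult.assoc)
  from plim_unique[OF lim this]
  show "fps_nth (mellin nrm u (fps_const c * G)) i = fps_nth (fps_const c * mellin nrm u G) i"
    by simp
qed

lemma int_fps_mellin:
  assumes "fps_over OK G" shows "int_fps (mellin nrm u G)"
  unfolding int_fps_def
proof
  fix i
  have "nrm (\<Sum>m<n. fps_nth G m * fps_nth (mellin_basis m) i) \<le> 1" for n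
    using assms int_fps_mellin_basis unfolding fps_over_OK_iff int_fps_def
    by (intro nrm_sum_le nrm_mult_le_1) auto
  then show "nrm (fps_nth (mellin nrm u G) i) \<le> 1"
    using plim_le[OF mellin_converges[OF assms, where i = i], of 0 1] by auto
qed

text \<open>Closed form of the transform on polynomials: \<gamma> multiplies x^s by u^s, so
  P(\<gamma> - 1) multiplies it by P(u^s - 1). Being finite, the sum raises no question of
  convergence.\<close>

definition mellin_poly :: "'a poly \<Rightarrow> 'a fps" where
  "mellin_poly P = Abs_fps (\<lambda>i. \<Sum>s\<le>degree (gchoose_poly i :: 'a poly). coeff (gchoose_poly i) s * poly P (u ^ s - 1))"

lemma mellin_of_poly: "mellin nrm u (fps_of_poly P) = mellin_poly P"
proof (rule fps_ext)
  fix i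
  have "(\<Sum>m<n. coeff P m * fps_nth (mellin_basis m) i) = fps_nth (mellin_poly P) i" if "n \<ge> Suc (degree P)" for n
  proof -
    have "poly P x = (\<Sum>m<n. coeff P m * x ^ m)" for x
      unfolding poly_altdef using that by (intro sum.mono_neutral_left) (auto simp: coeff_eq_0)
    then show ?thesis
      unfolding mellin_basis_nth mellin_poly_def
      by (simp add: sum_distrib_left mult_ac) (rule sum.swap)
  qed
  then have "plim nrm (\<lambda>n. \<Sum>m<n. fps_nth (fps_of_poly P) m * fps_nth (mellin_basis m) i) (fps_nth (mellin_poly P) i)"
    by (intro plim_eventually_const[of "Suc (degree P)"]) auto
  then show "fps_nth (mellin nrm u (fps_of_poly P)) i = fps_nth (mellin_poly P) i"
    using psuminf_eqI by (simp add: mellin_eq)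
qed

lemma mellin_poly_0 [simp]: "mellin_poly 0 = 0"
  and mellin_poly_add: "mellin_poly (P + Q) = mellin_poly P + mellin_poly Q"
  and mellin_poly_smult: "mellin_poly (smult c P) = fps_const c * mellin_poly P"
  by (auto simp: mellin_poly_def fps_eq_iff algebra_simps sum.distrib sum_subtractf sum_distrib_left)

lemma mellin_poly_sum: "mellin_poly (sum P A) = (\<Sum>i\<in>A. mellin_poly (P i))"
  by (induction A rule: infinite_finite_induct) (auto simp: mellin_poly_add)

lemma mellin_poly_power: "mellin_poly ([:1, 1:] ^ m) = fps_binomial (u ^ m)"
proof (rule fps_ext)
  fix i
  have "poly ([:1, 1:] ^ m) (u ^ s - 1) = (u ^ m) ^ s" for s
    by (simp add: mult.commute flip: power_mult)
  then show "fps_nth (mellin_poly ([:1, 1:] ^ m)) i = fps_nth (fps_binomial (u ^ m)) i"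
    unfolding fps_binomial_nth poly_gchoose_poly[symmetric] poly_altdef[of "gchoose_poly i"]
    by (simp add: mellin_poly_def)
qed

lemma mellin_poly_omega_monom:
  "mellin_poly (omega p n * monom 1 j) = (gamma_diff ^^ j) (fps_binomial (u ^ (p ^ n)) - fps_binomial 1)"
  unfolding funpow_gamma_diff_diff
  by (auto simp: fps_eq_iff funpow_gamma_diff_binomial_nth mellin_poly_def omega_def poly_monom algebra_simps
      simp flip: sum_subtractf power_mult intro!: sum.cong)

text \<open>The ideal of \<open>\<omega>\<^sub>n\<close> is stable under \<gamma>: the generator
  goes to (1 + X)^(p^n u) - 1, and p^n u is congruent to 0 modulo p^n.\<close>

lemma int_dvd_funpow_gamma_diff:
  assumes "int_dvd (omega_fps n) F"
  shows "int_dvd (omega_fps n) ((gamma_diff ^^ j) F)"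
proof (induction j)
  case (Suc j)
  let ?W = "omega_fps n :: 'a fps"
  obtain h where h: "int_fps h" "(gamma_diff ^^ j) F = ?W * h"
    using Suc unfolding int_dvd_def by blast
  have act: "gamma_act u (?W * h) = gamma_act u h * gamma_act u ?W"
    unfolding gamma_act_def by (subst fps_compose_mult_distrib) (auto simp: mult.commute)
  have "gamma_act u ?W = fps_binomial (of_nat (p ^ n) * u) - fps_binomial 0"
    unfolding fps_of_poly_omega_binomial
    by (simp add: gamma_act_def fps_compose_sub_distrib fps_binomial_compose)
  moreover have "int_dvd ?W \<dots>"
  proof (rule int_dvd_binomial_diff)
    show "nrm (of_nat (p ^ n) * u - 0) \<le> 1 / real p ^ n"
      using nrm_of_nat_multiple[of n "p ^ n"] nrm_u by (simp add: nrm_mult)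
  qed (use u_Zp Zp_of_nat[of 0] Zp_of_nat[of "p ^ n"] in \<open>auto intro: Zp_mult simp del: of_nat_power\<close>)
  ultimately have "int_dvd ?W (gamma_act u (?W * h))"
    unfolding act by (metis int_dvd_mult int_fps_gamma_act h(1))
  then have "int_dvd ?W (gamma_diff (?W * h))"
    unfolding gamma_diff_def using h(1) by (intro int_dvd_diff) (auto simp: int_dvd_def)
  then show ?case using h(2) by simp
qed (use assms in auto)

text \<open>The level rises because \<open>\<omega>\<^sub>n\<close> stands for \<gamma>^(p^n) - 1,
  which takes 1 + \<pi> to (1 + \<pi>)^(u^(p^n)) - (1 + \<pi>), and u^(p^n) is congruent to 1 modulo
  p^(n + 1), not only modulo p^n.\<close>

lemma int_dvd_mellin_poly_omega:
  assumes "\<And>j. nrm (coeff T j) \<le> 1"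
  shows "int_dvd (omega_fps (n + 1)) (mellin_poly (omega p n * T))"
proof -
  have "omega p n * T = (\<Sum>j\<le>degree T. smult (coeff T j) (omega p n * monom 1 j))"
    by (subst (1) poly_as_sum_of_monoms[symmetric]) (simp add: sum_distrib_left smult_monom flip: mult_smult_right)
  moreover have "int_dvd (omega_fps (n + 1)) (mellin_poly (omega p n * monom 1 j))" for j
    unfolding mellin_poly_omega_monom
    using nrm_u_power_p_power_minus_1_le[of n] Zp_of_nat[of 1]
    by (intro int_dvd_funpow_gamma_diff int_dvd_binomial_diff Zp_power u_Zp) auto
  ultimately show ?thesis
    by (simp add: mellin_poly_sum mellin_poly_smult assms int_dvd_sum int_dvd_mult int_fps_const)
qed

lemma fps_over_OK_omega: "fps_over OK (omega_fps n)"
  unfolding fps_of_poly_omega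
  by (intro fps_over_diff fps_over_power fps_over_add fps_over_1 fps_over_X subring_set_OK)

text \<open>Truncating H reduces this to polynomials. In each coefficient the transform of the
  discarded tail is O(p^(-M)), and the ideal is closed under limits.\<close>

lemma int_dvd_mellin_omega:
  assumes H: "fps_over OK H"
  shows "int_dvd (omega_fps (n + 1)) (mellin nrm u (omega_fps n * H))"
proof (rule int_dvd_limit)
  show "fps_nth (omega_fps (n + 1) :: 'a fps) 0 = 0"
    "fps_nth (omega_fps (n + 1) :: 'a fps) 1 \<noteq> 0"
    using omega_distinguished[of "n + 1"] by simp_all
  show "int_dvd (omega_fps (n + 1)) (mellin_poly (omega p n * truncate_fps M H))" for M
    using H by (intro int_dvd_mellin_poly_omega) (auto simp: coeff_truncate_fps fps_over_OK_iff int_fps_def)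
  fix i
  let ?W = "omega_fps n :: 'a fps"
  obtain C where C: "C \<ge> 0" "\<And>m. nrm (fps_nth (mellin_basis m) i) \<le> C * (1 / real p) ^ m"
    using mellin_basis_small by blast
  show "plim nrm (\<lambda>M. fps_nth (mellin_poly (omega p n * truncate_fps M H)) i) (fps_nth (mellin nrm u (?W * H)) i)"
  proof (rule plimI_le)
    show "(\<lambda>M. (C + 1) * (1 / real p) ^ M) \<longlonglongrightarrow> 0"
      using p_gt_1 by (intro tendsto_mult_right_zero LIMSEQ_realpow_zero) auto
    fix M
    have over: "fps_over OK (?W * H)" "fps_over OK (?W * fps_cutoff M H)"
      using H subring_setD(1)[OF subring_set_OK]
      by (intro fps_over_mult subring_set_OK fps_over_OK_omega; simp add: fps_over_def)+
    let ?D = "?W * H - ?W * fps_cutoff M H"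
    have D: "fps_over OK ?D" by (rule fps_over_diff[OF subring_set_OK over])
    have D0: "fps_nth ?D m = 0" if "m < M" for m
      unfolding right_diff_distrib[symmetric] fps_mult_nth using that by (intro sum.neutral) auto
    \<comment> \<open>C + 1 in place of C: \<open>plim_le\<close> asks for a positive bound, and C
      is only known to be nonnegative.\<close>
    have pos: "(C + 1) * (1 / real p) ^ M > 0" using C(1) p_gt_1 by simp
    have "nrm (fps_nth (mellin nrm u ?D) i) \<le> (C + 1) * (1 / real p) ^ M"
    proof (rule plim_le[OF mellin_converges[OF D] _ pos])
      fix n' show "nrm (\<Sum>m<n'. fps_nth ?D m * fps_nth (mellin_basis m) i) \<le> (C + 1) * (1 / real p) ^ M"
      proof (rule nrm_sum_le)
        fix m
        show "nrm (fps_nth ?D m * fps_nth (mellin_basis m) i) \<le> (C + 1) * (1 / real p) ^ M"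
        proof (cases "m < M")
          case False
          have "nrm (fps_nth ?D m * fps_nth (mellin_basis m) i) \<le> 1 * nrm (fps_nth (mellin_basis m) i)"
            unfolding nrm_mult using D by (intro mult_right_mono) (auto simp: fps_over_OK_iff int_fps_def)
          also have "\<dots> \<le> C * (1 / real p) ^ m" using C(2) by simp
          also have "\<dots> \<le> (C + 1) * (1 / real p) ^ M"
            using False C(1) p_gt_1 by (intro mult_mono power_decreasing) auto
          finally show ?thesis .
        qed (use D0 pos in auto)
      qed (use pos in auto)
    qed
    moreover have "mellin nrm u ?D = mellin nrm u (?W * H) - mellin_poly (omega p n * truncate_fps M H)"
      using over by (subst mellin_diff) (auto simp: fps_of_poly_mult simp flip: mellin_of_poly)
    ultimately show "nrm (fps_nth (mellin_poly (omega p n * truncate_fps M H)) i - fps_nth (mellin nrm u (?W * H)) i)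
        \<le> (C + 1) * (1 / real p) ^ M"
      using nrm_minus_commute by simp
  qed
qed

text \<open>\<open>a m\<close> is the residue of u^m modulo p^(n + 1). Injectivity is by counting:
  all p^n residues of the form 1 + p j are reached, since u is a generator and u^(p^n) is trivial
  modulo p^(n + 1).\<close>

lemma nat_approx_u_powers:
  obtains a where "\<And>m. a m < p ^ (n + 1)" "\<And>m. nrm (u ^ m - of_nat (a m)) \<le> 1 / real p ^ (n + 1)"
    "inj_on a {..<p ^ n}"
proof -
  have "\<exists>a. \<forall>m. a m < p ^ (n + 1) \<and> nrm (u ^ m - of_nat (a m)) \<le> 1 / real p ^ (n + 1)"
    using Zp_approx_nat[OF Zp_power[OF u_Zp]] by (intro choice) metis
  then obtain a where a: "\<And>m. a m < p ^ (n + 1)" "\<And>m. nrm (u ^ m - of_nat (a m)) \<le> 1 / real p ^ (n + 1)"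
    by blast
  have p1: "real p > 1" using p_gt_1 by simp
  \<comment> \<open>This turns p-adic closeness of two residues below p^(n + 1) into equality: a
    nonzero integer of smaller absolute value is not divisible by p^(n + 1).\<close>
  have small: "\<bar>z\<bar> < int p ^ (n + 1) \<Longrightarrow> nrm (of_int z) \<le> 1 / real p ^ (n + 1) \<Longrightarrow> z = 0" for z
  proof (rule ccontr)
    assume z: "\<bar>z\<bar> < int p ^ (n + 1)" "nrm (of_int z) \<le> 1 / real p ^ (n + 1)" "z \<noteq> 0"
    define e where "e = multiplicity (int p) z"
    obtain w where w: "z = int p ^ e * w" "\<not> int p dvd w"
      using multiplicity_decompose'[of z "int p"] z(3) prime_p unfolding e_def by (metis not_prime_unit prime_nat_int_transfer)
    have "coprime w (int p)"
      using w(2) prime_p by (metis coprime_commute prime_imp_coprime prime_nat_int_transfer)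
    then have "nrm (of_int z) = (1 / real p) ^ e"
      by (simp add: w(1) nrm_mult nrm_power nrm_p nrm_of_int_coprime)
    then have "(1 / real p) ^ e \<le> (1 / real p) ^ (n + 1)"
      using z(2) by (simp add: power_one_over)
    then have "n + 1 \<le> e"
      using p1 power_strict_decreasing[of e "n + 1" "1 / real p"] by force
    then have "int p ^ (n + 1) dvd z"
      unfolding w(1) by (intro dvd_mult2 le_imp_power_dvd)
    then show False using z(1,3) zdvd_imp_le[of "int p ^ (n + 1)" "\<bar>z\<bar>"] by simp
  qed
  have surj: "(\<lambda>j. 1 + p * j) ` {..<p ^ n} \<subseteq> a ` {..<p ^ n}"
  proof
    fix x assume "x \<in> (\<lambda>j. 1 + p * j) ` {..<p ^ n}"
    then obtain j where j: "x = 1 + p * j" "j < p ^ n" by auto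
    have "p * (j + 1) \<le> p * p ^ n" using j(2) by (intro mult_left_mono) auto
    then have x: "x < p ^ (n + 1)" using j(1) p_gt_1 by simp
    have "nrm (of_nat x - 1) \<le> 1 / real p"
      using nrm_of_nat_multiple[of 1 "p * j"] by (simp add: j(1))
    moreover have "1 / real p ^ (n + 1) > 0" using p1 by simp
    ultimately obtain m where m: "nrm (of_nat x - u ^ m) < 1 / real p ^ (n + 1)"
      using generator Qp_of_nat[of x] unfolding is_generator_def by meson
    define m' where "m' = m mod p ^ n"
    have "u ^ m = u ^ m' * (u ^ (p ^ n)) ^ (m div p ^ n)"
      unfolding m'_def power_mult[symmetric] power_add[symmetric] by simp
    then have "u ^ m - u ^ m' = u ^ m' * ((u ^ (p ^ n)) ^ (m div p ^ n) - 1 ^ (m div p ^ n))"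
      by (simp add: algebra_simps)
    also have "nrm \<dots> \<le> 1 * nrm (u ^ (p ^ n) - 1)"
      unfolding nrm_mult by (intro mult_mono nrm_power_diff_le) (auto simp: nrm_power nrm_u)
    finally have m': "nrm (u ^ m - u ^ m') \<le> 1 / real p ^ (n + 1)"
      using nrm_u_power_p_power_minus_1_le[of n] by simp
    have "nrm ((of_nat x - u ^ m) + ((u ^ m - u ^ m') + (u ^ m' - of_nat (a m')))) \<le> 1 / real p ^ (n + 1)"
      using m m' a(2)[of m'] by (intro nrm_add_le) auto
    then have "nrm (of_int (int x - int (a m'))) \<le> 1 / real p ^ (n + 1)"
      by simp
    moreover have "\<bar>int x - int (a m')\<bar> < int p ^ (n + 1)"
      unfolding of_nat_power[symmetric] using x a(1)[of m'] by linarith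
    ultimately have "int x - int (a m') = 0" by (rule small[rotated])
    moreover have "m' < p ^ n" using p_gt_1 by (simp add: m'_def)
    ultimately show "x \<in> a ` {..<p ^ n}" by auto
  qed
  have "card ((\<lambda>j. 1 + p * j) ` {..<p ^ n}) = p ^ n"
    using p_gt_1 by (subst card_image) (auto simp: inj_on_def)
  then have "p ^ n \<le> card (a ` {..<p ^ n})"
    using card_mono[OF _ surj] by simp
  then have "card (a ` {..<p ^ n}) = card {..<p ^ n}"
    using card_image_le[of "{..<p ^ n}" a] by simp
  then have "inj_on a {..<p ^ n}" by (intro eq_card_imp_inj_on) auto
  then show ?thesis using that a by blast
qed

lemma pcompose_power: "pcompose (P ^ n) Q = pcompose P Q ^ n" for P Q :: "'b::comm_semiring_1 poly"
  by (induction n) (simp_all add: pcompose_1 pcompose_mult)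

lemma poly_in_powers_of_1_X:
  fixes R :: "'a poly"
  assumes "degree R < N"
  shows "R = (\<Sum>m<N. smult (coeff (pcompose R [:-1, 1:]) m) ([:1, 1:] ^ m))"
proof -
  let ?S = "pcompose R [:-1, 1:]"
  have inv: "pcompose [:-1, 1:] [:1, 1:] = ([:0, 1:] :: 'a poly)"
    by (simp add: pcompose_pCons)
  have S: "degree ?S < N"
    using assms by (simp add: degree_pcompose)
  have "?S = (\<Sum>m<N. monom (coeff ?S m) m)"
    using S by (intro poly_eqI) (auto simp: coeff_sum coeff_eq_0)
  then have "pcompose ?S [:1, 1:] = pcompose (\<Sum>m<N. monom (coeff ?S m) m) [:1, 1:]"
    by (rule arg_cong)
  also have "\<dots> = (\<Sum>m<N. pcompose (monom (coeff ?S m) m) [:1, 1:])"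
    by (rule pcompose_sum)
  finally have "pcompose ?S [:1, 1:] = (\<Sum>m<N. pcompose (monom (coeff ?S m) m) [:1, 1:])" .
  moreover have "pcompose ?S [:1, 1:] = R"
    by (simp only: pcompose_assoc[symmetric] inv pcompose_idR)
  moreover have "pcompose (monom c m) [:1, 1:] = smult c ([:1, 1:] ^ m)" for c :: 'a and m
    by (simp add: monom_altdef pcompose_smult pcompose_power pcompose_pCons)
  ultimately show ?thesis by simp
qed

text \<open>Expand R in the powers (1 + X)^m with m < p^n. Its transform is a combination of the (1
  + \<pi>)^(u^m), in which u^m may be replaced by the natural number \<open>a m\<close>. The
  resulting polynomial has degree below p^(n + 1), so divisibility makes it zero; its exponents are
  distinct, so all coefficients of the expansion vanish.\<close>

lemma omega_dvd_if_mellin: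
  assumes R: "\<And>i. nrm (coeff R i) \<le> 1" "degree R < p ^ n"
    and dvd: "int_dvd (omega_fps (n + 1)) (mellin_poly R)"
  shows "R = 0"
proof -
  define r where "r m = coeff (pcompose R [:-1, 1:]) m" for m
  have r: "nrm (r m) \<le> 1" for m
  proof -
    have "coeff (pcompose R [:-1, 1:]) m \<in> {x. nrm x \<le> 1}"
      by (rule coeff_pcompose_semiring_closed)
        (use R(1) in \<open>auto simp: coeff_pCons nrm_add_le nrm_mult_le_1 split: nat.splits\<close>)
    then show ?thesis by (simp add: r_def)
  qed
  obtain a where a: "\<And>m. a m < p ^ (n + 1)" "\<And>m. nrm (u ^ m - of_nat (a m)) \<le> 1 / real p ^ (n + 1)"
    "inj_on a {..<p ^ n}"
    using nat_approx_u_powers by blast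
  define P where "P = (\<Sum>m<p ^ n. smult (r m) ([:1, 1:] ^ a m))"
  let ?W = "omega_fps (n + 1) :: 'a fps"
  have Req: "R = (\<Sum>m<p ^ n. smult (r m) ([:1, 1:] ^ m))"
    unfolding r_def by (rule poly_in_powers_of_1_X[OF R(2)])
  have "mellin_poly R = (\<Sum>m<p ^ n. fps_const (r m) * fps_binomial (u ^ m))"
    by (subst Req) (simp add: mellin_poly_sum mellin_poly_smult mellin_poly_power)
  moreover have "fps_of_poly P = (\<Sum>m<p ^ n. fps_const (r m) * fps_binomial (of_nat (a m)))"
    by (simp add: P_def fps_of_poly_sum fps_of_poly_smult fps_of_poly_power fps_of_poly_pCons fps_binomial_of_nat)
  ultimately have "mellin_poly R - fps_of_poly P
      = (\<Sum>m<p ^ n. fps_const (r m) * (fps_binomial (u ^ m) - fps_binomial (of_nat (a m))))"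
    by (simp add: right_diff_distrib sum_subtractf)
  moreover have "int_dvd ?W \<dots>"
    using r a(2) by (intro int_dvd_sum int_dvd_mult int_dvd_binomial_diff Zp_power u_Zp Zp_of_nat int_fps_const) auto
  ultimately have "int_dvd ?W (fps_of_poly P)"
    using int_dvd_diff[OF dvd] by (metis diff_diff_eq2 add_diff_cancel_left')
  then obtain h where h: "int_fps h" "fps_of_poly P = ?W * h" by (auto simp: int_dvd_def)
  have "degree P \<le> p ^ (n + 1) - 1"
    unfolding P_def
  proof (rule degree_sum_le)
    fix m
    have "degree (smult (r m) ([:1, 1:] ^ a m)) \<le> a m"
      by (rule order_trans[OF degree_smult_le]) (simp add: degree_power_eq)
    then show "degree (smult (r m) ([:1, 1:] ^ a m)) \<le> p ^ (n + 1) - 1"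
      using a(1)[of m] by linarith
  qed auto
  then have "degree P < degree (omega p (n + 1) :: 'a poly)"
    using p_gt_1 omega_distinguished(2)[of "n + 1"] by (simp add: le_less_trans diff_less)
  then have "P = 0"
    using quotient_zero[OF omega_distinguished(1) int_fps_disc_convergent[OF h(1)] _ h(2)] by blast
  \<comment> \<open>Substituting X - 1 turns the powers of 1 + X into monomials.\<close>
  then have "pcompose P [:-1, 1:] = 0" by simp
  then have "(\<Sum>m<p ^ n. smult (r m) ([:0, 1:] ^ a m)) = 0"
    by (simp add: P_def pcompose_sum pcompose_smult pcompose_power pcompose_pCons)
  then have mono: "(\<Sum>m<p ^ n. monom (r m) (a m)) = 0"
    by (simp add: monom_altdef)
  have "r m = 0" if m: "m < p ^ n" for m
  proof -
    have "0 = coeff (\<Sum>m<p ^ n. monom (r m) (a m)) (a m)" using mono by simp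
    also have "\<dots> = (\<Sum>m'<p ^ n. if m' = m then r m else 0)"
      unfolding coeff_sum using a(3) m by (intro sum.cong) (auto simp: inj_on_def)
    finally show ?thesis using m by simp
  qed
  then show ?thesis by (subst Req) simp
qed

end

section \<open>Reduction modulo the maximal ideal\<close>

lemma matrix_inv_unique_right_left:
  fixes A B :: "'b::comm_ring_1^2^2"
  assumes "A ** B = mat 1" "B ** A = mat 1"
  shows "matrix_inv A = B"
proof -
  have "A ** matrix_inv A = mat 1"
    unfolding matrix_inv_def by (rule someI2[of _ B]) (use assms in auto)
  then have "B ** (A ** matrix_inv A) = B" by simp
  then show ?thesis using assms(2) by (simp add: matrix_mul_assoc)
qed

lemma mat2_mult:
  fixes a b c d :: "'b::comm_ring_1"
  shows "mat2 a b c d ** mat2 a' b' c' d' = mat2 (a * a' + b * c') (a * b' + b * d') (c * a' + d * c') (c * b' + d * d')"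
  by (simp add: vec_eq_iff forall_2 matrix_matrix_mult_def sum_2)

lemma mat2_1: "mat2 1 0 0 1 = (mat 1 :: 'b::comm_ring_1^2^2)"
  by (simp add: vec_eq_iff forall_2 mat_def)

locale padic_red = padic_ext nrm p K u
  for nrm :: "'a::field_char_0 \<Rightarrow> real" and p :: nat and K :: "'a set" and u :: 'a +
  fixes red :: "'a \<Rightarrow> 'f::field"
  assumes residue_map: "is_residue_map nrm red"
begin

lemma red_1: "red 1 = 1"
  and red_add: "nrm x \<le> 1 \<Longrightarrow> nrm y \<le> 1 \<Longrightarrow> red (x + y) = red x + red y"
  and red_mult: "nrm x \<le> 1 \<Longrightarrow> nrm y \<le> 1 \<Longrightarrow> red (x * y) = red x * red y"
  and red_eq_0_iff: "nrm x \<le> 1 \<Longrightarrow> red x = 0 \<longleftrightarrow> nrm x < 1"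
  using residue_map unfolding is_residue_map_def by blast+

lemma red_0: "red 0 = 0"
  using red_eq_0_iff[of 0] by simp

lemma red_diff: "nrm x \<le> 1 \<Longrightarrow> nrm y \<le> 1 \<Longrightarrow> red (x - y) = red x - red y"
  using red_add[of "x - y" y] nrm_diff_le[of x 1 y] by simp

lemma red_sum: "(\<And>i. i \<in> A \<Longrightarrow> nrm (f i) \<le> 1) \<Longrightarrow> red (sum f A) = (\<Sum>i\<in>A. red (f i))"
proof (induction A rule: infinite_finite_induct)
  case (insert i A)
  then show ?case using red_add[of "f i" "sum f A"] nrm_sum_le[of 1 A f] by simp
qed (simp_all add: red_0)

lemma red_of_nat: "red (of_nat n) = of_nat n"
  by (induction n) (simp_all add: red_0 red_1 red_add nrm_of_nat_le_1)

lemma red_close: "nrm x \<le> 1 \<Longrightarrow> nrm (x - y) < 1 \<Longrightarrow> red x = red y"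
  using nrm_diff_le[of x 1 "x - y"] red_diff[of x "x - y"] red_eq_0_iff[of "x - y"] by simp

lemma CHAR_residue: "CHAR('f) = p"
proof -
  have "nrm (of_nat p) < 1" using p_gt_1 by (simp add: nrm_p)
  then have "(of_nat p :: 'f) = 0"
    using red_eq_0_iff[of "of_nat p"] by (simp add: red_of_nat)
  then have "CHAR('f) dvd p" by (simp add: of_nat_eq_0_iff_char_dvd)
  then show ?thesis
    using prime_p CHAR_not_1'[where ?'a = 'f] by (auto simp: prime_nat_iff)
qed

definition red_fps :: "'a fps \<Rightarrow> 'f fps" where
  "red_fps F = Abs_fps (\<lambda>i. red (fps_nth F i))"

lemma red_fps_nth [simp]: "fps_nth (red_fps F) i = red (fps_nth F i)"
  by (simp add: red_fps_def)

lemma red_fps_0: "red_fps 0 = 0" and red_fps_1: "red_fps 1 = 1" and red_fps_X: "red_fps fps_X = fps_X"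
  by (auto simp: fps_eq_iff red_0 red_1 fps_X_def)

lemma red_fps_const: "red_fps (fps_const c) = fps_const (red c)"
  by (auto simp: fps_eq_iff red_0 fps_nth_fps_const)

lemma red_fps_add: "int_fps F \<Longrightarrow> int_fps G \<Longrightarrow> red_fps (F + G) = red_fps F + red_fps G"
  and red_fps_diff: "int_fps F \<Longrightarrow> int_fps G \<Longrightarrow> red_fps (F - G) = red_fps F - red_fps G"
  by (auto simp: fps_eq_iff int_fps_def red_add red_diff)

lemma red_fps_mult: "int_fps F \<Longrightarrow> int_fps G \<Longrightarrow> red_fps (F * G) = red_fps F * red_fps G"
  by (auto simp: fps_eq_iff int_fps_def fps_mult_nth red_mult red_sum nrm_mult_le_1)

lemma red_fps_power: "int_fps F \<Longrightarrow> red_fps (F ^ n) = red_fps F ^ n"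
  by (induction n) (auto simp: red_fps_1 red_fps_mult int_fps_power)

lemma red_fps_compose:
  assumes F: "int_fps F" and G: "int_fps G" shows "red_fps (F oo G) = red_fps F oo red_fps G"
proof (rule fps_ext)
  fix n
  have "nrm (fps_nth F i) \<le> 1" "nrm (fps_nth (G ^ i) n) \<le> 1" for i
    using F int_fps_power[OF G, of i] by (simp_all add: int_fps_def)
  then show "fps_nth (red_fps (F oo G)) n = fps_nth (red_fps F oo red_fps G) n"
    by (simp add: fps_compose_nth red_sum red_mult nrm_mult_le_1 flip: red_fps_power[OF G])
qed

lemma red_fps_omega: "red_fps (omega_fps n) = fps_X ^ (p ^ n)"
proof -
  have char: "CHAR('f fps) = p" by (simp add: CHAR_residue)
  have "red_fps (omega_fps n) = (1 + fps_X) ^ (p ^ n) - 1"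
    unfolding fps_of_poly_omega
    by (simp add: red_fps_diff red_fps_power red_fps_add int_fps_power int_fps_add red_fps_1 red_fps_X)
  also have "(1 + fps_X :: 'f fps) ^ (p ^ n) = 1 ^ (p ^ n) + fps_X ^ (p ^ n)"
    by (rule freshmans_dream') (use prime_p char in auto)
  finally show ?thesis by simp
qed

section \<open>The order of vanishing of Mellin transforms over the residue field\<close>

definition v_gen :: 'a where "v_gen = (u - 1) / of_nat p"

lemma u_eq: "u = 1 + v_gen * of_nat p"
  using p_gt_1 by (simp add: v_gen_def)

lemma nrm_v_gen: "nrm v_gen = 1"
  using p_gt_1 by (simp add: v_gen_def nrm_divide nrm_u_minus_1 nrm_p)

lemma v_gen_Zp: "v_gen \<in> Zp"
  using u_Zp Qp_of_nat[of 1] nrm_v_gen unfolding Zp_def v_gen_def divide_inverse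
  by (auto intro: Qp_mult Qp_diff Qp_inverse Qp_of_nat)

text \<open>The operator \<gamma> - 1 transported to f along f \<mapsto> (1 + \<pi>)
  f(\<open>\<omega>\<^sub>1\<close>). Iterating it on f itself isolates the composition with
  \<open>\<omega>\<^sub>1\<close>, the source of the factor p in the order of vanishing.\<close>

definition twisted_diff :: "'a fps \<Rightarrow> 'a fps" where
  "twisted_diff f = fps_binomial v_gen * (f oo (fps_binomial u - 1)) - f"

lemma int_fps_u: "int_fps (fps_binomial u - 1)"
  using int_fps_binomial[OF u_Zp] by auto

lemma int_fps_twisted_diff: "int_fps f \<Longrightarrow> int_fps (twisted_diff f)"
  unfolding twisted_diff_def using int_fps_u int_fps_binomial[OF v_gen_Zp] by auto

lemma omega_1: "omega_fps 1 = (fps_binomial (of_nat p) - 1 :: 'a fps)"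
  using fps_of_poly_omega_binomial[of p 1] by simp

text \<open>Write \<open>u = 1 + p v\<close>; then \<open>(1 + \<pi>) ^ u = (1 + \<pi>) * (1 + \<omega>\<^sub>1) ^ v\<close>.\<close>

lemma gamma_diff_twisted:
  "gamma_diff ((1 + fps_X) * (f oo omega_fps 1)) = (1 + fps_X) * (twisted_diff f oo omega_fps 1)"
proof -
  let ?W = "omega_fps 1 :: 'a fps" and ?U = "fps_binomial u - 1"
  have W0: "fps_nth ?W 0 = 0" using omega_distinguished(3) by simp
  have U0: "fps_nth ?U 0 = 0" by simp
  have "?W oo ?U = fps_binomial (of_nat p * u) - 1"
    unfolding omega_1 by (simp add: fps_compose_sub_distrib fps_binomial_compose)
  also have "\<dots> = ?U oo ?W"
    unfolding omega_1 by (simp add: fps_compose_sub_distrib fps_binomial_compose mult.commute)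
  finally have comm: "?W oo ?U = ?U oo ?W" .
  have "fps_binomial u = fps_binomial 1 * fps_binomial (v_gen * of_nat p)"
    by (subst u_eq) (simp add: fps_binomial_add_mult)
  also have "\<dots> = (1 + fps_X) * (fps_binomial v_gen oo ?W)"
    unfolding omega_1 fps_binomial_compose fps_binomial_1 ..
  finally have bu: "fps_binomial u = (1 + fps_X) * (fps_binomial v_gen oo ?W)" .
  have "gamma_act u ((1 + fps_X) * (f oo ?W)) = fps_binomial u * ((f oo ?W) oo ?U)"
    unfolding gamma_act_def fps_compose_mult_distrib[OF U0]
    by (simp add: fps_compose_add_distrib)
  also have "(f oo ?W) oo ?U = (f oo ?U) oo ?W"
    unfolding fps_compose_assoc[OF U0 W0, symmetric] fps_compose_assoc[OF W0 U0, symmetric] comm ..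
  also have "fps_binomial u * ((f oo ?U) oo ?W) = (1 + fps_X) * ((fps_binomial v_gen * (f oo ?U)) oo ?W)"
    unfolding bu fps_compose_mult_distrib[OF W0] by (simp add: mult.assoc)
  finally show ?thesis
    by (simp add: gamma_diff_def twisted_diff_def fps_compose_sub_distrib right_diff_distrib)
qed

lemma mellin_basis_twisted:
  "mellin_basis m = (1 + fps_X) * ((twisted_diff ^^ m) 1 oo omega_fps 1)"
  by (induction m) (simp_all add: gamma_diff_twisted del: One_nat_def)

lemma int_fps_funpow_twisted_diff: "int_fps ((twisted_diff ^^ m) 1)"
  by (induction m) (auto intro: int_fps_twisted_diff)

text \<open>The second coefficient \<open>u (u - 1) / 2\<close> vanishes in the residue field because \<open>p\<close> is odd.\<close>

lemma red_fps_u: "\<exists>g. red_fps (fps_binomial u - 1) = fps_X * (1 + fps_X ^ 2 * g)"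
proof
  let ?F = "red_fps (fps_binomial u - 1)"
  have "nrm (u - 1) < 1" using nrm_u_minus_1 p_gt_1 by simp
  then have c1: "red u = 1" using red_close[of u 1] nrm_u red_1 by simp
  have "coprime (int 2) (int p)" using odd_p by (simp add: coprime_right_2_iff_odd coprime_commute)
  then have "nrm 2 = 1" using nrm_of_int_coprime[of 2] by simp
  then have "nrm (u gchoose 2) < 1"
    using nrm_u nrm_u_minus_1 p_gt_1 by (simp add: gbinomial_prod_rev numeral_2_eq_2 nrm_divide nrm_mult)
  then have c2: "red (u gchoose 2) = 0"
    using red_eq_0_iff[of "u gchoose 2"] by simp
  have c: "fps_nth ?F 0 = 0" "fps_nth ?F 1 = 1" "fps_nth ?F 2 = 0"
    using c1 c2 by (simp_all add: red_0)
  have "fps_X * (1 + fps_X ^ 2 * fps_shift 3 ?F) = fps_X + fps_X ^ 3 * fps_shift 3 ?F"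
    by (simp add: algebra_simps power3_eq_cube power2_eq_square)
  also have "\<dots> = ?F"
  proof (rule fps_ext)
    fix i
    show "fps_nth (fps_X + fps_X ^ 3 * fps_shift 3 ?F) i = fps_nth ?F i"
    proof (cases "i < 3")
      case True
      then have "i = 0 \<or> i = 1 \<or> i = 2" by auto
      then show ?thesis using c by (auto simp: fps_X_power_mult_nth simp del: red_fps_nth)
    qed (auto simp: fps_X_power_mult_nth simp del: red_fps_nth)
  qed
  finally show "?F = fps_X * (1 + fps_X ^ 2 * fps_shift 3 ?F)" ..
qed

text \<open>Over the residue field (1 + \<pi>)^u - 1 agrees with \<pi> in degrees up to 2, so the
  substitution leaves the two lowest coefficients of f alone. In the difference the leading terms
  cancel, and the next coefficient is the leading one times the reduction of \<open>v_gen\<close>,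
  which is a unit.\<close>

lemma red_twisted_diff_step:
  assumes f: "int_fps f" and ord: "\<And>i. i < m \<Longrightarrow> red (fps_nth f i) = 0" "red (fps_nth f m) \<noteq> 0"
  shows "\<And>i. i < Suc m \<Longrightarrow> red (fps_nth (twisted_diff f) i) = 0" "red (fps_nth (twisted_diff f) (Suc m)) \<noteq> 0"
proof -
  obtain g where g: "red_fps (fps_binomial u - 1) = fps_X * (1 + fps_X ^ 2 * g)"
    using red_fps_u by blast
  define f1 where "f1 = fps_shift m (red_fps f)"
  have f1: "red_fps f = fps_X ^ m * f1"
    unfolding f1_def using ord(1) by (auto simp: fps_eq_iff fps_X_power_mult_nth)
  let ?U = "fps_X * (1 + fps_X ^ 2 * g)" and ?b = "red_fps (fps_binomial v_gen)"
  have U0: "fps_nth ?U 0 = 0" by simp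
  define h where "h = (1 + fps_X ^ 2 * g) ^ m * (f1 oo ?U)"
  have "red_fps (twisted_diff f) = ?b * (red_fps f oo ?U) - red_fps f"
    unfolding twisted_diff_def using f int_fps_u int_fps_binomial[OF v_gen_Zp]
    by (subst red_fps_diff red_fps_mult red_fps_compose; (intro int_fps_mult int_fps_compose)?; simp add: g)+
  also have "red_fps f oo ?U = fps_X ^ m * h"
    unfolding f1 fps_compose_mult_distrib[OF U0] fps_compose_power[OF U0, symmetric]
      fps_X_fps_compose_startby0[OF U0] h_def by (simp only: power_mult_distrib mult_ac)
  also have "?b * (fps_X ^ m * h) - red_fps f = fps_X ^ m * (?b * h - f1)"
    unfolding f1 by (simp add: algebra_simps)
  finally have eq: "red_fps (twisted_diff f) = fps_X ^ m * (?b * h - f1)" .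
  have pw: "fps_nth ((1 + fps_X ^ 2 * g) ^ m) 0 = 1 \<and> fps_nth ((1 + fps_X ^ 2 * g) ^ m) 1 = 0" for m
    by (induction m) (auto simp: fps_mult_nth_1 fps_X_power_mult_nth)
  have comp1: "fps_nth (f1 oo ?U) 1 = fps_nth f1 1"
    by (simp add: fps_compose_nth fps_X_power_mult_nth)
  have h: "fps_nth h 0 = fps_nth f1 0" "fps_nth h 1 = fps_nth f1 1"
    using pw[of m] comp1 by (simp_all add: h_def fps_mult_nth_1)
  have b: "fps_nth ?b 0 = 1" "fps_nth ?b 1 = red v_gen" by (simp_all add: red_1)
  have w0: "fps_nth (?b * h - f1) 0 = 0" using b h by simp
  have "fps_nth (?b * h - f1) 1 = red v_gen * fps_nth f1 0"
    using b h by (simp add: fps_mult_nth_1 del: red_fps_nth)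
  moreover have "red v_gen \<noteq> 0" using red_eq_0_iff[of v_gen] nrm_v_gen by simp
  moreover have "fps_nth f1 0 \<noteq> 0" using ord(2) by (simp add: f1_def)
  ultimately have w1: "fps_nth (?b * h - f1) 1 \<noteq> 0" by simp
  show "red (fps_nth (twisted_diff f) i) = 0" if "i < Suc m" for i
    using arg_cong[OF eq, of "\<lambda>F. fps_nth F i"] that w0 by (cases "i = m") (auto simp: fps_X_power_mult_nth)
  show "red (fps_nth (twisted_diff f) (Suc m)) \<noteq> 0"
    using arg_cong[OF eq, of "\<lambda>F. fps_nth F (Suc m)"] w1 by (simp add: fps_X_power_mult_nth)
qed

lemma red_funpow_twisted_diff:
  "(\<forall>i<m. red (fps_nth ((twisted_diff ^^ m) 1) i) = 0) \<and> red (fps_nth ((twisted_diff ^^ m) 1) m) \<noteq> 0"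
proof (induction m)
  case 0
  then show ?case by (simp add: red_1)
next
  case (Suc m)
  with red_twisted_diff_step[OF int_fps_funpow_twisted_diff, of m m] show ?case by auto
qed

text \<open>\<open>\<omega>\<^sub>1\<close> reduces to X^p, which multiplies the order m of the
  twisted factor by p; the factor 1 + X is a unit.\<close>

lemma red_mellin_basis:
  "i < p * m \<Longrightarrow> red (fps_nth (mellin_basis m) i) = 0" "red (fps_nth (mellin_basis m) (p * m)) \<noteq> 0"
proof -
  let ?e = "red_fps ((twisted_diff ^^ m) 1)"
  have e: "?e \<noteq> 0" "subdegree ?e = m"
    using red_funpow_twisted_diff[of m] by (auto intro!: subdegreeI simp: fps_eq_iff)
  have red: "red_fps (mellin_basis m) = (1 + fps_X) * (?e oo fps_X ^ p)"
    unfolding mellin_basis_twisted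
    using red_fps_omega[of 1] int_fps_omega[of 1] int_fps_funpow_twisted_diff[of m]
    by (simp add: red_fps_mult red_fps_add red_fps_compose int_fps_add int_fps_compose red_fps_1 red_fps_X)
  have p0: "fps_nth (fps_X ^ p :: 'f fps) 0 = 0" using p_gt_1 by simp
  have ne: "?e oo fps_X ^ p \<noteq> 0"
    using e(1) p0 p_gt_1 by (simp add: fps_compose_eq_0_iff)
  have "(1 + fps_X :: 'f fps) \<noteq> 0" "subdegree (1 + fps_X :: 'f fps) = 0"
    by (auto simp: subdegree_eq_0_iff fps_eq_iff intro!: exI[of _ 0])
  then have sub: "subdegree (red_fps (mellin_basis m)) = p * m" "red_fps (mellin_basis m) \<noteq> 0"
    unfolding red using ne e p0 by (auto simp: mult.commute subdegree_mult)
  show "i < p * m \<Longrightarrow> red (fps_nth (mellin_basis m) i) = 0"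
    using nth_less_subdegree_zero[of i "red_fps (mellin_basis m)"] sub(1) by simp
  show "red (fps_nth (mellin_basis m) (p * m)) \<noteq> 0"
    using nth_subdegree_nonzero[OF sub(2)] sub(1) by simp
qed

text \<open>A partial sum at distance below 1 from the limit has the same reduction. The equation is
  given for all large n, so that the cut-off can be moved past any prescribed index.\<close>

lemma red_mellin_nth:
  assumes "fps_over OK G"
  shows "\<exists>n0. \<forall>n\<ge>n0. red (fps_nth (mellin nrm u G) i) = (\<Sum>m<n. red (fps_nth G m) * red (fps_nth (mellin_basis m) i))"
proof -
  let ?s = "\<lambda>n. \<Sum>m<n. fps_nth G m * fps_nth (mellin_basis m) i"
  obtain n0 where n0: "\<And>n. n \<ge> n0 \<Longrightarrow> nrm (?s n - fps_nth (mellin nrm u G) i) < 1"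
    using plim_eventually_close[OF mellin_converges[OF assms, where i = i], of 1] by auto
  have int: "nrm (fps_nth G m) \<le> 1" "nrm (fps_nth (mellin_basis m) i) \<le> 1" for m
    using assms int_fps_mellin_basis[of m] unfolding fps_over_OK_iff int_fps_def by auto
  show ?thesis
  proof (intro exI[of _ n0] allI impI)
    fix n assume n: "n \<ge> n0"
    have "nrm (?s n) \<le> 1" by (intro nrm_sum_le nrm_mult_le_1 int) auto
    from red_close[OF this n0[OF n]] have "red (fps_nth (mellin nrm u G) i) = red (?s n)" ..
    then show "red (fps_nth (mellin nrm u G) i) = (\<Sum>m<n. red (fps_nth G m) * red (fps_nth (mellin_basis m) i))"
      by (simp add: red_sum red_mult int nrm_mult_le_1)
  qed
qed

text \<open>The m-th basis series starts exactly in degree p * m. With d the order of G, only the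
  term d survives in degree p * d, and none in lower degrees.\<close>

lemma subdegree_red_mellin:
  assumes G: "fps_over OK G" "red_fps G \<noteq> 0"
  shows "red_fps (mellin nrm u G) \<noteq> 0" "subdegree (red_fps (mellin nrm u G)) = p * subdegree (red_fps G)"
proof -
  define d where "d = subdegree (red_fps G)"
  have lo: "red (fps_nth G m) = 0" if "m < d" for m
    using nth_less_subdegree_zero[of m "red_fps G"] that by (simp add: d_def)
  have hi: "red (fps_nth G d) \<noteq> 0"
    using nth_subdegree_nonzero[OF G(2)] by (simp add: d_def)
  have z: "red (fps_nth (mellin nrm u G) i) = 0" if "i < p * d" for i
  proof -
    obtain n where n: "\<And>n'. n' \<ge> n \<Longrightarrow> red (fps_nth (mellin nrm u G) i) = (\<Sum>m<n'. red (fps_nth G m) * red (fps_nth (mellin_basis m) i))"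
      using red_mellin_nth[OF G(1), of i] by blast
    have zero: "red (fps_nth G m) * red (fps_nth (mellin_basis m) i) = 0" for m
    proof (cases "m < d")
      case False
      then have "p * d \<le> p * m" by simp
      then show ?thesis using red_mellin_basis(1)[OF less_le_trans[OF that]] by simp
    qed (simp add: lo)
    show ?thesis unfolding n[OF order_refl] by (intro sum.neutral ballI zero)
  qed
  obtain n0 where n0: "\<And>n. n \<ge> n0 \<Longrightarrow>
      red (fps_nth (mellin nrm u G) (p * d)) = (\<Sum>m<n. red (fps_nth G m) * red (fps_nth (mellin_basis m) (p * d)))"
    using red_mellin_nth[OF G(1), of "p * d"] by blast
  have "red (fps_nth (mellin nrm u G) (p * d))
      = (\<Sum>m<max n0 (Suc d). red (fps_nth G m) * red (fps_nth (mellin_basis m) (p * d)))"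
    by (rule n0) simp
  also have "\<dots> = (\<Sum>m\<in>{d}. red (fps_nth G m) * red (fps_nth (mellin_basis m) (p * d)))"
  proof (rule sum.mono_neutral_right)
    show "\<forall>m\<in>{..<max n0 (Suc d)} - {d}. red (fps_nth G m) * red (fps_nth (mellin_basis m) (p * d)) = 0"
    proof
      fix m assume "m \<in> {..<max n0 (Suc d)} - {d}"
      then consider "m < d" | "m > d" by force
      then show "red (fps_nth G m) * red (fps_nth (mellin_basis m) (p * d)) = 0"
      proof cases
        case 2
        then have "p * d < p * m" using p_gt_1 by simp
        then show ?thesis using red_mellin_basis(1) by simp
      qed (simp add: lo)
    qed
  qed auto
  finally have nz: "red (fps_nth (mellin nrm u G) (p * d)) \<noteq> 0"
    using hi red_mellin_basis(2)[of d] by simp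
  then show "red_fps (mellin nrm u G) \<noteq> 0" by (metis red_fps_nth fps_zero_nth)
  show "subdegree (red_fps (mellin nrm u G)) = p * subdegree (red_fps G)"
    unfolding d_def[symmetric] using nz z by (intro subdegreeI) auto
qed

lemma red_mellin_eq_0:
  assumes G: "fps_over OK G" "red_fps G = 0" shows "red_fps (mellin nrm u G) = 0"
proof (rule fps_ext)
  fix i
  have zero: "red (fps_nth G m) = 0" for m using G(2) by (metis red_fps_nth fps_zero_nth)
  obtain n where "\<And>n'. n' \<ge> n \<Longrightarrow> red (fps_nth (mellin nrm u G) i) = (\<Sum>m<n'. red (fps_nth G m) * red (fps_nth (mellin_basis m) i))"
    using red_mellin_nth[OF G(1), of i] by blast
  from this[OF order_refl] show "fps_nth (red_fps (mellin nrm u G)) i = fps_nth 0 i"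
    using zero by simp
qed

lemma red_fps_via_mellin:
  assumes G: "fps_over OK G" "mellin nrm u G = (1 + fps_X) * F" and F: "int_fps F"
  shows "red_fps G = 0 \<longleftrightarrow> red_fps F = 0"
    and "red_fps F \<noteq> 0 \<Longrightarrow> subdegree (red_fps F) = p * subdegree (red_fps G)"
proof -
  have eq: "red_fps (mellin nrm u G) = (1 + fps_X) * red_fps F"
    using F by (simp add: G(2) red_fps_mult red_fps_add int_fps_add red_fps_1 red_fps_X)
  have ne: "(1 + fps_X :: 'f fps) \<noteq> 0" "subdegree (1 + fps_X :: 'f fps) = 0"
    by (auto simp: subdegree_eq_0_iff fps_eq_iff intro!: exI[of _ 0])
  show iff: "red_fps G = 0 \<longleftrightarrow> red_fps F = 0"
    using red_mellin_eq_0[OF G(1)] subdegree_red_mellin(1)[OF G(1)] eq ne(1) by auto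
  assume "red_fps F \<noteq> 0"
  then show "subdegree (red_fps F) = p * subdegree (red_fps G)"
    using subdegree_red_mellin(2)[OF G(1)] iff ne by (simp add: eq subdegree_mult)
qed

end

section \<open>The matrices P and their Frobenius products\<close>

context padic
begin

lemma frob_eq: "frob p F = F oo omega_fps 1"
  by (simp add: frob_def fps_of_poly_omega)

lemma funpow_frob: "(frob p ^^ n) F = F oo omega_fps n" for F :: "'a fps"
proof (induction n)
  case 0
  have "omega_fps 0 = (fps_X :: 'a fps)" by (simp add: fps_of_poly_omega)
  then show ?case by simp
next
  case (Suc n)
  have W0: "fps_nth (omega_fps n :: 'a fps) 0 = 0" for n using omega_distinguished(3) by simp
  have eq: "omega_fps n oo omega_fps 1 = (omega_fps (Suc n) :: 'a fps)"
    unfolding fps_of_poly_omega_binomial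
    using fps_binomial_compose[of "of_nat (p ^ n)" "of_nat (p ^ 1) :: 'a"]
    by (simp add: fps_compose_sub_distrib mult.commute)
  have "(frob p ^^ Suc n) F = frob p (F oo omega_fps n)"
    by (simp add: Suc)
  also have "\<dots> = F oo omega_fps n oo omega_fps 1" by (rule frob_eq)
  finally show ?case
    unfolding fps_compose_assoc[OF W0 W0, symmetric] eq .
qed

text \<open>F is congruent to its constant term modulo \<pi>, and the n-th iterate of Frobenius
  substitutes \<open>\<omega>\<^sub>n\<close> for \<pi>.\<close>

lemma int_dvd_funpow_frob_diff:
  assumes "int_fps F"
  shows "int_dvd (omega_fps n) ((frob p ^^ n) F - fps_const (fps_nth F 0))"
proof -
  let ?W = "omega_fps n :: 'a fps"
  have W0: "fps_nth ?W 0 = 0" using omega_distinguished(3) by simp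
  have "F = fps_const (fps_nth F 0) + fps_X * fps_shift 1 F"
    by (auto simp: fps_eq_iff fps_nth_fps_const)
  then have "F oo ?W = fps_const (fps_nth F 0) + ?W * (fps_shift 1 F oo ?W)"
    using fps_compose_add_distrib[of "fps_const (fps_nth F 0)" "fps_X * fps_shift 1 F" ?W]
    unfolding fps_compose_mult_distrib[OF W0] fps_X_fps_compose_startby0[OF W0] by simp
  then show ?thesis
    unfolding int_dvd_def funpow_frob using assms int_fps_omega
    by (intro exI[of _ "fps_shift 1 F oo ?W"]) (auto intro: int_fps_shift)
qed

text \<open>The series (q - \<pi>^(p - 1)) / p with explicit coefficients, which are integral
  because p divides the inner binomial coefficients; in the quotient defining
  \<open>delta_ser\<close> integrality is not visible.\<close>

definition delta_inv :: "'a fps" where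
  "delta_inv = Abs_fps (\<lambda>j. if j < p - 1 then of_nat (p choose Suc j) / of_nat p else 0)"

lemma q_ser_nth: "fps_nth (q_ser p :: 'a fps) j = of_nat (p choose Suc j)"
proof -
  have "q_ser p = fps_shift 1 (omega_fps 1 :: 'a fps)"
    using omega_distinguished(3)[of 1] by (simp add: q_ser_def frob_eq)
  then show ?thesis by (simp add: coeff_omega)
qed

lemma delta_inv_0: "fps_nth delta_inv 0 = 1"
  using p_gt_1 by (simp add: delta_inv_def)

lemma int_fps_q_ser: "int_fps (q_ser p)"
  by (simp add: int_fps_def q_ser_nth nrm_of_nat_le_1 del: binomial_Suc_Suc)

lemma int_fps_delta_inv: "int_fps delta_inv"
  unfolding int_fps_def
proof
  fix j
  show "nrm (fps_nth delta_inv j) \<le> 1"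
  proof (cases "j < p - 1")
    case True
    then have "p dvd (p choose Suc j)" using prime_p by (intro dvd_choose_prime) auto
    then have "nrm (of_nat (p choose Suc j)) \<le> 1 / real p"
      using nrm_of_nat_multiple[of 1] by simp
    then have "nrm (of_nat (p choose Suc j)) * real p \<le> 1"
      using p_gt_1 by (simp add: field_simps)
    then show ?thesis
      using True by (simp add: delta_inv_def nrm_divide nrm_p del: binomial_Suc_Suc)
  qed (simp add: delta_inv_def)
qed

lemma q_ser_eq: "q_ser p - fps_X ^ (p - 1) = of_nat p * delta_inv"
proof (rule fps_ext)
  fix j
  have "Suc j = p \<longleftrightarrow> j = p - 1" using p_gt_1 by auto
  then show "fps_nth (q_ser p - fps_X ^ (p - 1)) j = fps_nth (of_nat p * delta_inv) j"
    using p_gt_1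
    by (auto simp: q_ser_nth delta_inv_def fps_X_power_nth binomial_eq_0 simp flip: fps_of_nat simp del: binomial_Suc_Suc)
qed

lemma delta_ser_mult: "delta_ser p * delta_inv = 1"
proof -
  have p0: "(of_nat p :: 'a) \<noteq> 0" using p_gt_1 by simp
  have "fps_nth (of_nat p * delta_inv) 0 \<noteq> 0"
    using p0 by (simp add: delta_inv_0)
  then have "delta_ser p = of_nat p * inverse (of_nat p * delta_inv)"
    unfolding delta_ser_def q_ser_eq by (rule fps_divide_unit)
  then have "delta_ser p * delta_inv = inverse (of_nat p * delta_inv) * (of_nat p * delta_inv)"
    by (simp only: mult_ac)
  also have "\<dots> = 1" by (rule inverse_mult_eq_1) fact
  finally show ?thesis .
qed

text \<open>Integral, unlike \<open>P_mat\<close>, which has powers of q in the denominator although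
  q has constant term p.\<close>

definition P_inv :: "nat \<Rightarrow> 'a \<Rightarrow> 'a \<Rightarrow> 'a fps^2^2" where
  "P_inv k e ap = mat2 (fps_const ap * delta_inv ^ (k - 1)) (delta_inv ^ (k - 1))
     (- (fps_const e * q_ser p ^ (k - 1))) 0"

lemma matrix_inv_P_mat:
  assumes "e \<noteq> 0" shows "matrix_inv (P_mat p k e ap) = P_inv k e ap"
proof -
  define Q where "Q = fps_const e * q_ser p ^ (k - 1)"
  define R where "R = inverse Q"
  define D D' :: "'a fps" where "D = delta_ser p ^ (k - 1)" and "D' = delta_inv ^ (k - 1)"
  have Q0: "fps_nth Q 0 \<noteq> 0"
    using assms p_gt_1 by (simp add: Q_def fps_nth_power_0 q_ser_nth)
  then have RQ: "R * Q = 1" unfolding R_def by (rule inverse_mult_eq_1)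
  then have QR: "Q * R = 1" by (simp add: mult.commute)
  have div: "F / Q = F * R" for F unfolding R_def using Q0 by (rule fps_divide_unit)
  have d: "D * D' = 1" "D' * D = 1"
    using delta_ser_mult by (simp_all add: D_def D'_def mult.commute flip: power_mult_distrib)
  have P: "P_mat p k e ap = mat2 0 (- R) D (fps_const ap * R)"
    unfolding P_mat_def Q_def[symmetric] D_def[symmetric] div by simp
  have I: "P_inv k e ap = mat2 (fps_const ap * D') D' (- Q) 0"
    by (simp add: P_inv_def Q_def D'_def)
  show ?thesis
    unfolding P I
    by (rule matrix_inv_unique_right_left)
      (simp_all add: mat2_mult RQ QR d mult.assoc mult.left_commute[of _ "fps_const ap"] flip: mat2_1)
qed

lemma P_prod_Suc:
  assumes "e \<noteq> 0"
  shows "P_prod p k e ap (Suc n) $ 1 $ j = (frob p ^^ Suc n) (fps_const ap * delta_inv ^ (k - 1)) * P_prod p k e ap n $ 1 $ j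
      + (frob p ^^ Suc n) (delta_inv ^ (k - 1)) * P_prod p k e ap n $ 2 $ j"
    and "P_prod p k e ap (Suc n) $ 2 $ j = (frob p ^^ Suc n) (- (fps_const e * q_ser p ^ (k - 1))) * P_prod p k e ap n $ 1 $ j"
  by (simp_all add: matrix_inv_P_mat[OF assms] P_inv_def matrix_matrix_mult_def map_matrix_def sum_2 funpow_frob del: funpow.simps)

lemma int_fps_funpow_frob: "int_fps F \<Longrightarrow> int_fps ((frob p ^^ n) F)"
  unfolding funpow_frob using int_fps_omega by auto

lemma int_fps_P_prod:
  assumes e: "e \<noteq> 0" "nrm e \<le> 1" and ap: "nrm ap \<le> 1"
  shows "int_fps (P_prod p k e ap n $ i $ j)"
proof -
  have "int_fps (P_prod p k e ap n $ 1 $ j) \<and> int_fps (P_prod p k e ap n $ 2 $ j)"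
  proof (induction n)
    case 0
    then show ?case by (simp add: mat_def)
  next
    case (Suc n)
    then show ?case
      unfolding P_prod_Suc[OF e(1)]
      by (intro conjI int_fps_add int_fps_mult int_fps_funpow_frob int_fps_minus int_fps_power int_fps_const
          int_fps_q_ser int_fps_delta_inv e ap) auto
  qed
  then show ?thesis using exhaust_2[of i] by auto
qed

text \<open>\<open>P_prod\<close> acquires on the left the Frobenius twist of \<open>P_inv\<close>
  of order n + 1. Modulo \<omega> of that level this is its constant term, the matrix with rows (ap,
  1) and (- e p^(k - 1), 0), which is the inverse of \<open>A_mat\<close>.\<close>

lemma int_dvd_P_prod_Suc:
  assumes e: "e \<noteq> 0" "nrm e \<le> 1" and ap: "nrm ap \<le> 1"
  shows "int_dvd (omega_fps (Suc n)) (P_prod p k e ap (Suc n) $ 1 $ j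
      - fps_const ap * P_prod p k e ap n $ 1 $ j - P_prod p k e ap n $ 2 $ j)"
    and "int_dvd (omega_fps (Suc n)) (P_prod p k e ap (Suc n) $ 2 $ j
      - fps_const (- (e * of_nat p ^ (k - 1))) * P_prod p k e ap n $ 1 $ j)"
proof -
  let ?W = "omega_fps (Suc n) :: 'a fps" and ?P = "P_prod p k e ap n"
  let ?A = "fps_const ap * delta_inv ^ (k - 1)" and ?B = "delta_inv ^ (k - 1)"
    and ?C = "- (fps_const e * q_ser p ^ (k - 1))"
  have int: "int_fps ?A" "int_fps ?B" "int_fps ?C"
    by (intro int_fps_mult int_fps_minus int_fps_power int_fps_const int_fps_q_ser int_fps_delta_inv e ap)+
  have A0: "fps_nth ?A 0 = ap" "fps_nth ?B 0 = 1" "fps_nth ?C 0 = - (e * of_nat p ^ (k - 1))"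
    by (simp_all add: fps_nth_power_0 delta_inv_0 q_ser_nth)
  note dv = int[THEN int_dvd_funpow_frob_diff, of "Suc n", unfolded A0]
  have "P_prod p k e ap (Suc n) $ 1 $ j - fps_const ap * ?P $ 1 $ j - ?P $ 2 $ j
    = ?P $ 1 $ j * ((frob p ^^ Suc n) ?A - fps_const ap) + ?P $ 2 $ j * ((frob p ^^ Suc n) ?B - fps_const 1)"
    unfolding P_prod_Suc[OF e(1)] by (simp add: algebra_simps del: funpow.simps)
  then show "int_dvd ?W (P_prod p k e ap (Suc n) $ 1 $ j - fps_const ap * ?P $ 1 $ j - ?P $ 2 $ j)"
    using dv int_fps_P_prod[OF e ap] by (simp only:) (intro int_dvd_add int_dvd_mult)
  have "P_prod p k e ap (Suc n) $ 2 $ j - fps_const (- (e * of_nat p ^ (k - 1))) * ?P $ 1 $ j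
    = ?P $ 1 $ j * ((frob p ^^ Suc n) ?C - fps_const (- (e * of_nat p ^ (k - 1))))"
    unfolding P_prod_Suc[OF e(1)] by (simp add: algebra_simps del: funpow.simps)
  then show "int_dvd ?W (P_prod p k e ap (Suc n) $ 2 $ j - fps_const (- (e * of_nat p ^ (k - 1))) * ?P $ 1 $ j)"
    using dv int_fps_P_prod[OF e ap] by (simp only:) (intro int_dvd_mult)
qed

end

context padic_red
begin

lemma red_funpow_frob: "int_fps F \<Longrightarrow> red_fps ((frob p ^^ n) F) = red_fps F oo fps_X ^ (p ^ n)"
  unfolding funpow_frob by (simp add: red_fps_compose int_fps_omega red_fps_omega)

lemma subdegree_red_funpow_frob:
  assumes "int_fps F" "red_fps F \<noteq> 0"
  shows "red_fps ((frob p ^^ n) F) \<noteq> 0" "subdegree (red_fps ((frob p ^^ n) F)) = p ^ n * subdegree (red_fps F)"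
proof -
  have p0: "fps_nth (fps_X ^ (p ^ n) :: 'f fps) 0 = 0" using p_gt_1 by simp
  show "red_fps ((frob p ^^ n) F) \<noteq> 0" "subdegree (red_fps ((frob p ^^ n) F)) = p ^ n * subdegree (red_fps F)"
    using p0 p_gt_1 assms by (simp_all add: red_funpow_frob fps_compose_eq_0_iff)
qed

lemma red_q_ser: "red_fps (q_ser p) = fps_X ^ (p - 1)"
proof (rule fps_ext)
  fix j
  have eq: "Suc j = p \<longleftrightarrow> j = p - 1" using p_gt_1 by auto
  have "(of_nat (p choose Suc j) :: 'f) = (if j = p - 1 then 1 else 0)"
  proof (cases "Suc j < p")
    case True
    then have "p dvd (p choose Suc j)" using prime_p by (intro dvd_choose_prime) auto
    then show ?thesis using True by (auto simp: of_nat_eq_0_iff_char_dvd CHAR_residue simp del: binomial_Suc_Suc)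
  qed (use eq in \<open>auto simp: binomial_eq_0 not_less simp del: binomial_Suc_Suc\<close>)
  then show "fps_nth (red_fps (q_ser p)) j = fps_nth (fps_X ^ (p - 1)) j"
    by (simp add: q_ser_nth red_of_nat fps_X_power_nth del: binomial_Suc_Suc)
qed

text \<open>Two factors are taken at a time because a product of two antidiagonal matrices is
  diagonal, so that the first row is only multiplied by B. The order of B comes from q^(k - 1)
  alone, which reduces to X^((p - 1)(k - 1)) up to a unit and is twisted n + 1 times.\<close>

lemma red_P_prod_step:
  fixes e ap :: 'a and k n :: nat
  assumes e: "nrm e = 1" and ap: "nrm ap < 1"
  defines "B \<equiv> red_fps (- ((frob p ^^ Suc (Suc n)) (delta_inv ^ (k - 1)) * (frob p ^^ Suc n) (fps_const e * q_ser p ^ (k - 1))))"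
  shows "red_fps (P_prod p k e ap (Suc (Suc n)) $ 1 $ j) = B * red_fps (P_prod p k e ap n $ 1 $ j)"
    and "B \<noteq> 0" "subdegree B = p ^ Suc n * ((p - 1) * (k - 1))"
proof -
  have e': "e \<noteq> 0" "nrm e \<le> 1" and ap': "nrm ap \<le> 1" using e ap by auto
  let ?D = "(frob p ^^ Suc (Suc n)) (delta_inv ^ (k - 1))" and ?E = "(frob p ^^ Suc n) (fps_const e * q_ser p ^ (k - 1))"
  let ?A = "(frob p ^^ Suc (Suc n)) (fps_const ap * delta_inv ^ (k - 1))"
  have int: "int_fps (delta_inv ^ (k - 1))" "int_fps (fps_const e * q_ser p ^ (k - 1))"
      "int_fps (fps_const ap * delta_inv ^ (k - 1))"
    by (intro int_fps_mult int_fps_power int_fps_const int_fps_q_ser int_fps_delta_inv e' ap')+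
  note intf = int[THEN int_fps_funpow_frob]
  note intP = int_fps_P_prod[OF e' ap']
  have "red_fps (fps_const ap * delta_inv ^ (k - 1)) = 0"
    using ap ap' red_eq_0_iff[of ap]
    by (subst red_fps_mult) (auto simp: red_fps_const int_fps_const int_fps_delta_inv)
  then have A: "red_fps ?A = 0"
    by (simp only: red_funpow_frob[OF int(3)] fps_compose_0)
  have neg: "(frob p ^^ Suc n) (- (fps_const e * q_ser p ^ (k - 1))) = - ?E"
    unfolding funpow_frob by (rule fps_compose_uminus)
  have "P_prod p k e ap (Suc (Suc n)) $ 1 $ j = ?A * P_prod p k e ap (Suc n) $ 1 $ j + (- (?D * ?E)) * P_prod p k e ap n $ 1 $ j"
    unfolding P_prod_Suc(1)[OF e'(1), of k ap "Suc n"] P_prod_Suc(2)[OF e'(1), of k ap n] neg by (simp only: mult_minus_left mult_minus_right mult.assoc)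
  then show "red_fps (P_prod p k e ap (Suc (Suc n)) $ 1 $ j) = B * red_fps (P_prod p k e ap n $ 1 $ j)"
    using A intf intP unfolding B_def
    by (simp only: red_fps_add red_fps_mult int_fps_mult int_fps_minus mult_zero_left add_0_left)
  have one: "fps_nth (red_fps (delta_inv ^ (k - 1))) 0 = 1"
    by (simp add: fps_nth_power_0 delta_inv_0 red_1)
  then have d0: "red_fps (delta_inv ^ (k - 1)) \<noteq> 0" "subdegree (red_fps (delta_inv ^ (k - 1))) = 0"
    by (metis fps_zero_nth zero_neq_one, metis subdegree_eq_0 one zero_neq_one)
  have re: "red e \<noteq> 0" using red_eq_0_iff[of e] e by simp
  have "red_fps (fps_const e * q_ser p ^ (k - 1)) = fps_const (red e) * fps_X ^ ((p - 1) * (k - 1))"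
    using e' int_fps_q_ser
    by (simp add: red_fps_mult red_fps_power int_fps_const int_fps_power red_fps_const red_q_ser power_mult)
  then have q0: "red_fps (fps_const e * q_ser p ^ (k - 1)) \<noteq> 0"
      "subdegree (red_fps (fps_const e * q_ser p ^ (k - 1))) = (p - 1) * (k - 1)"
    using re by (simp_all add: subdegree_mult)
  have "int_fps (?D * ?E)" using intf by (intro int_fps_mult)
  then have "red_fps (0 - ?D * ?E) = 0 - red_fps (?D * ?E)"
    by (subst red_fps_diff) (simp_all only: int_fps_0 red_fps_0)
  then have B: "B = - (red_fps ?D * red_fps ?E)"
    unfolding B_def using intf by (simp only: diff_0 red_fps_mult)
  show "B \<noteq> 0" "subdegree B = p ^ Suc n * ((p - 1) * (k - 1))"
    unfolding B using subdegree_red_funpow_frob[OF int(1) d0(1), of "Suc (Suc n)"] subdegree_red_funpow_frob[OF int(2) q0(1), of "Suc n"]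
    by (simp_all only: subdegree_mult d0(2) q0(2) subdegree_uminus neg_equal_0_iff_equal mult_eq_0_iff simp_thms mult_0_right add_0_left)
qed

end

section \<open>The numbers q_n: recursion and size\<close>

lemma q_num_0: "q_num p 0 = 0" and q_num_1: "q_num p (Suc 0) = 0"
  by (simp_all add: q_num_def)

text \<open>Two more levels keep the signs of the old terms and add p^(n + 1) - p^n. Nonnegativity
  of the integer sum is proved along the way, because \<open>nat\<close> is additive only on
  nonnegative integers.\<close>

lemma q_num_Suc_Suc:
  assumes "p \<ge> 1" shows "q_num p (Suc (Suc n)) = q_num p n + p ^ n * (p - 1)"
proof -
  define S where "S m = (\<Sum>i\<in>{(if even m then 0 else 1)..<m}. (-1) ^ (m - 1 - i) * int p ^ i)" for m
  have rec: "S (Suc (Suc m)) = S m + int p ^ m * (int p - 1)" for m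
  proof -
    let ?a = "if even m then 0 else 1 :: nat"
    have a: "?a \<le> m" by (auto elim: oddE)
    have "S (Suc (Suc m)) = (\<Sum>i\<in>{?a..<m}. (-1) ^ (Suc m - i) * int p ^ i) - int p ^ m + int p ^ Suc m"
      using a by (simp add: S_def)
    also have "(\<Sum>i\<in>{?a..<m}. (-1) ^ (Suc m - i) * int p ^ i) = S m"
      unfolding S_def
    proof (intro sum.cong refl)
      fix i assume "i \<in> {?a..<m}"
      then have "Suc m - i = Suc (Suc (m - 1 - i))" by auto
      then show "(-1) ^ (Suc m - i) * int p ^ i = (-1) ^ (m - 1 - i) * int p ^ i" by simp
    qed
    finally show ?thesis by (simp add: algebra_simps)
  qed
  have pos: "S m \<ge> 0" for m
  proof (induction m rule: less_induct)
    case (less m)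
    show ?case
    proof (cases "m < 2")
      case True
      then have "m = 0 \<or> m = 1" by auto
      then show ?thesis by (auto simp: S_def)
    next
      case False
      then obtain m' where m: "m = Suc (Suc m')" by (metis add_2_eq_Suc le_Suc_ex not_less)
      then show ?thesis using less[of m'] assms by (simp add: rec)
    qed
  qed
  have "q_num p m = nat (S m)" for m by (simp add: q_num_def S_def)
  moreover have "int p ^ n * (int p - 1) = int (p ^ n * (p - 1))" using assms by (simp add: of_nat_diff)
  ultimately show ?thesis using rec[of n] pos[of n] by (simp only: nat_add_distrib of_nat_0_le_iff nat_int)
qed

text \<open>In fact (p + 1) q_n is p^n - 1 for even n and p^n - p for odd n, since (p + 1)(p - 1)
  p^m = p^(m + 2) - p^m.\<close>

lemma q_num_bound:
  assumes "p \<ge> 1" shows "(p + 1) * q_num p n \<le> p ^ n"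
proof (induction n rule: less_induct)
  case (less n)
  show ?case
  proof (cases "n < 2")
    case True
    then have "n = 0 \<or> n = 1" by auto
    then show ?thesis by (auto simp: q_num_0 q_num_1)
  next
    case False
    then obtain m where m: "n = Suc (Suc m)" by (metis add_2_eq_Suc le_Suc_ex not_less)
    obtain r where r: "p = Suc r" using assms by (cases p) auto
    have "(p + 1) * q_num p n = (p + 1) * q_num p m + (p + 1) * (p ^ m * (p - 1))"
      unfolding m q_num_Suc_Suc[OF assms] by (rule distrib_left)
    also have "\<dots> \<le> p ^ m + (p + 1) * (p ^ m * (p - 1))"
      using less[of m] m by simp
    also have "\<dots> = p ^ n" by (simp add: m r algebra_simps)
    finally show ?thesis .
  qed
qed

context padic_red
begin

text \<open>The orders satisfy the two-step recursion of p (k - 1) q_n, with n = 0 and n = 1 as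
  starting points; these differ in which entry survives, hence the parity. The extra factor p
  disappears on the way back through the Mellin transform.\<close>

lemma red_P_prod:
  fixes e ap :: 'a and k n :: nat
  assumes e: "nrm e = 1" and ap: "nrm ap < 1"
  defines "s \<equiv> (if odd n then 2 else 1 :: 2)" and "t \<equiv> (if odd n then 1 else 2 :: 2)"
  shows "red_fps (P_prod p k e ap n $ 1 $ t) = 0 \<and> red_fps (P_prod p k e ap n $ 1 $ s) \<noteq> 0
    \<and> subdegree (red_fps (P_prod p k e ap n $ 1 $ s)) = p * ((k - 1) * q_num p n)"
  unfolding s_def t_def
proof (induction n rule: less_induct)
  case (less n)
  have p1: "p \<ge> 1" using p_gt_1 by simp
  have e': "e \<noteq> 0" using e by auto
  consider "n = 0" | "n = 1" | m where "n = Suc (Suc m)"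
    by (metis One_nat_def not0_implies_Suc)
  then show ?case
  proof cases
    case 1
    then show ?thesis by (simp add: mat_def red_fps_0 red_fps_1 q_num_0)
  next
    case 2
    have int: "int_fps (fps_const ap * delta_inv ^ (k - 1))" "int_fps (delta_inv ^ (k - 1))"
      using ap by (intro int_fps_mult int_fps_power int_fps_const int_fps_delta_inv; simp)+
    have P: "P_prod p k e ap n $ 1 $ 1 = (frob p ^^ 1) (fps_const ap * delta_inv ^ (k - 1))"
      "P_prod p k e ap n $ 1 $ 2 = (frob p ^^ 1) (delta_inv ^ (k - 1))"
      using P_prod_Suc(1)[OF e', of k ap 0] 2 by (simp_all add: mat_def)
    have z: "red_fps (fps_const ap * delta_inv ^ (k - 1)) = 0"
      using ap red_eq_0_iff[of ap]
      by (subst red_fps_mult) (auto simp: red_fps_const int_fps_const int_fps_delta_inv)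
    have one: "fps_nth (red_fps (delta_inv ^ (k - 1))) 0 = 1"
      by (simp add: fps_nth_power_0 delta_inv_0 red_1)
    then have nz: "red_fps (delta_inv ^ (k - 1)) \<noteq> 0" "subdegree (red_fps (delta_inv ^ (k - 1))) = 0"
      by (metis fps_zero_nth zero_neq_one, metis subdegree_eq_0 one zero_neq_one)
    have "red_fps ((frob p ^^ 1) (fps_const ap * delta_inv ^ (k - 1))) = 0"
      by (simp only: red_funpow_frob[OF int(1)] z fps_compose_0)
    then show ?thesis
      using subdegree_red_funpow_frob[OF int(2) nz(1), of 1] nz(2) P 2 by (simp add: q_num_1)
  next
    case (3 m)
    note step = red_P_prod_step[OF e ap, where k = k and n = m]
    have "p * ((k - 1) * q_num p n) = p ^ Suc m * ((p - 1) * (k - 1)) + p * ((k - 1) * q_num p m)"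
      unfolding 3 q_num_Suc_Suc[OF p1] by (simp add: algebra_simps)
    moreover have "odd n \<longleftrightarrow> odd m" using 3 by simp
    ultimately show ?thesis
      using less[of m] step(2,3) unfolding 3 step(1)
      by (auto simp: subdegree_mult simp del: P_prod.simps funpow.simps power_Suc)
  qed
qed

end

section \<open>The logarithmic matrix and Iwasawa invariants\<close>

context padic_ext
begin

lemma fps_over_OK_pcompose:
  assumes "fps_over OK (fps_of_poly P)" "c \<in> OK" "d \<in> OK"
  shows "fps_over OK (fps_of_poly (pcompose P [:c, d:]))"
  unfolding fps_over_def fps_of_poly_nth
proof
  fix m
  show "coeff (pcompose P [:c, d:]) m \<in> OK"
    using assms subring_setD[OF subring_set_OK]
    by (intro coeff_pcompose_semiring_closed)
       (auto simp: fps_over_def coeff_pCons split: nat.splits)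
qed

lemma u_powi_OK: "u powi (- int j) \<in> OK"
proof -
  have "inverse (u ^ j) \<in> K"
    using K_subfield subring_set_prod[OF subring_set_K, of "{..<j}" "\<lambda>_. u"] u_K
    unfolding is_subfield_def by simp
  then show ?thesis
    by (simp add: int_ring_def power_int_minus nrm_inverse nrm_power nrm_u)
qed

text \<open>The factor with twist 0 is \<open>\<omega>\<^sub>n\<close> itself, so congruences modulo
  the whole product weaken to congruences modulo \<open>\<omega>\<^sub>n\<close>.\<close>

lemma omega_h_eq:
  assumes "k \<ge> 2"
  obtains W where "omega_h p u n (k - 1) = omega p n * W" "fps_over OK (fps_of_poly W)"
proof -
  define f where "f j = pcompose (omega p n) [:u powi (- int j) - 1, u powi (- int j):]" for j
  define W where "W = (\<Prod>j<k - 2. f (Suc j))"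
  have k: "k - 1 = Suc (k - 2)" using assms by simp
  have "omega_h p u n (k - 1) = f 0 * W"
    unfolding omega_h_def f_def[symmetric] W_def k by (rule prod.lessThan_Suc_shift)
  moreover have "f 0 = omega p n" by (simp add: f_def)
  moreover have "fps_over OK (fps_of_poly (f j))" for j
    unfolding f_def using u_powi_OK[of j] subring_setD[OF subring_set_OK]
    by (intro fps_over_OK_pcompose fps_over_OK_omega) auto
  then have "fps_over OK (fps_of_poly W)"
    unfolding W_def fps_of_poly_prod by (intro fps_over_prod subring_set_OK)
  ultimately show ?thesis using that by metis
qed

text \<open>R represents modulo \<open>\<omega>\<^sub>n\<close> an inverse transform of (1 + \<pi>)
  F. In this form the defining property of C is stable under integral linear combinations and under
  lowering n, which the degree bound for C is not designed for.\<close>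

definition mellin_lift :: "nat \<Rightarrow> 'a fps \<Rightarrow> 'a poly \<Rightarrow> bool" where
  "mellin_lift n F R \<longleftrightarrow> (\<exists>G H. fps_over OK G \<and> fps_over OK H \<and> mellin nrm u G = (1 + fps_X) * F \<and>
     fps_of_poly R = G + omega_fps n * H)"

lemma mellin_liftE:
  assumes "mellin_lift n F R"
  obtains G H where "fps_over OK G" "fps_over OK H" "mellin nrm u G = (1 + fps_X) * F"
    "fps_of_poly R = G + omega_fps n * H"
  using assms unfolding mellin_lift_def by blast

lemma mellin_liftI:
  assumes "fps_over OK G" "fps_over OK H" "mellin nrm u G = (1 + fps_X) * F"
    "fps_of_poly R = G + omega_fps n * H"
  shows "mellin_lift n F R"
  using assms unfolding mellin_lift_def by blast

lemma mellin_lift_diff: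
  assumes "mellin_lift n F R" "mellin_lift n F' R'"
  shows "mellin_lift n (F - F') (R - R')"
  using assms
proof (elim mellin_liftE)
  fix G H G' H'
  assume G: "fps_over OK G" "fps_over OK H" "fps_over OK G'" "fps_over OK H'"
    "mellin nrm u G = (1 + fps_X) * F" "mellin nrm u G' = (1 + fps_X) * F'"
    "fps_of_poly R = G + omega_fps n * H" "fps_of_poly R' = G' + omega_fps n * H'"
  show ?thesis
    by (rule mellin_liftI[of "G - G'" "H - H'"])
      (use G in \<open>auto simp: mellin_diff fps_of_poly_diff algebra_simps intro: fps_over_diff subring_set_OK\<close>)
qed

lemma mellin_lift_smult:
  assumes "mellin_lift n F R" "c \<in> OK"
  shows "mellin_lift n (fps_const c * F) (smult c R)"
  using assms(1)
proof (elim mellin_liftE)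
  fix G H
  assume G: "fps_over OK G" "fps_over OK H" "mellin nrm u G = (1 + fps_X) * F"
    "fps_of_poly R = G + omega_fps n * H"
  show ?thesis
  proof (rule mellin_liftI[of "fps_const c * G" "fps_const c * H"])
    show "mellin nrm u (fps_const c * G) = (1 + fps_X) * (fps_const c * F)"
      unfolding mellin_cmult[OF assms(2) G(1)] G(3) by (simp only: mult_ac)
  qed (use G assms(2) in \<open>auto simp: fps_of_poly_smult algebra_simps intro: fps_over_mult fps_over_const subring_set_OK\<close>)
qed

lemma mellin_lift_mult:
  assumes "fps_over OK G" "fps_over OK H" "mellin nrm u G = (1 + fps_X) * F"
    "fps_of_poly R = G + fps_of_poly (omega p n * W) * H" "fps_over OK (fps_of_poly W)"
  shows "mellin_lift n F R"
  by (rule mellin_liftI[OF assms(1) fps_over_mult[OF subring_set_OK assms(5,2)] assms(3)])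
    (simp add: assms(4) fps_of_poly_mult mult.assoc)

lemma mellin_lift_Suc: "mellin_lift (Suc n) F R \<Longrightarrow> mellin_lift n F R"
proof (elim mellin_liftE)
  let ?S = "\<Sum>i<p. ([:1, 1:] ^ (p ^ n)) ^ i :: 'a poly"
  have "fps_of_poly ?S \<in> {F. fps_over OK F}"
    unfolding fps_of_poly_sum fps_of_poly_power
    by (intro subring_set_sum[OF fps_over_subring[OF subring_set_OK]])
      (auto simp: fps_of_poly_pCons intro!: fps_over_power fps_over_add fps_over_1 fps_over_X subring_set_OK)
  then show "fps_over OK G \<Longrightarrow> fps_over OK H \<Longrightarrow> mellin nrm u G = (1 + fps_X) * F \<Longrightarrow>
      fps_of_poly R = G + omega_fps (Suc n) * H \<Longrightarrow> mellin_lift n F R" for G H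
    unfolding omega_Suc by (intro mellin_lift_mult) auto
qed

lemma C_mat_lift:
  assumes C: "is_C_mat p nrm u K k e ap n C" and k: "k \<ge> 2"
  shows "mellin_lift n (P_prod p k e ap n $ i $ j) (C $ i $ j)"
proof -
  obtain G H where GH: "fps_over OK G" "fps_over OK H"
    "mellin nrm u G = (1 + fps_X) * P_prod p k e ap n $ i $ j"
    "fps_of_poly (C $ i $ j) - G = fps_of_poly (omega_h p u n (k - 1)) * H"
    using C unfolding is_C_mat_def by blast
  obtain W where W: "omega_h p u n (k - 1) = omega p n * W" "fps_over OK (fps_of_poly W)"
    using omega_h_eq[OF k] by blast
  show ?thesis
    by (rule mellin_lift_mult[OF GH(1-3) _ W(2)]) (use GH(4) W(1) in \<open>simp add: diff_eq_eq add.commute\<close>)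
qed

text \<open>The transforms of G and of every integral multiple of \<open>\<omega>\<^sub>n\<close>
  lie in the ideal of the next level. Hence so does the transform of the remainder of R, and a
  remainder with this property is zero.\<close>

lemma omega_dvd:
  assumes "mellin_lift n F R" and dvd: "int_dvd (omega_fps (Suc n)) F"
  shows "omega p n dvd R"
proof -
  obtain G H where G: "fps_over OK G" and H: "fps_over OK H" and mG: "mellin nrm u G = (1 + fps_X) * F"
    and R: "fps_of_poly R = G + omega_fps n * H"
    using assms(1) by (elim mellin_liftE)
  let ?w = "omega p n :: 'a poly"
  define Q R' where "Q = R div ?w" and "R' = R mod ?w"
  have w0: "?w \<noteq> 0" using omega_distinguished(4)[of n] by auto
  have eq: "R = ?w * Q + R'" by (simp add: Q_def R'_def)
  have deg: "degree R' < p ^ n"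
    using degree_mod_less[OF w0, of R] omega_distinguished(2)[of n] p_gt_1 by (auto simp: R'_def)
  have oH: "fps_over OK (fps_of_poly ?w * H)"
    by (intro fps_over_mult subring_set_OK fps_over_OK_omega H)
  have oR: "fps_over OK (fps_of_poly R)"
    unfolding R by (intro fps_over_add subring_set_OK G oH)
  then have intR: "nrm (coeff R i) \<le> 1" for i
    by (auto simp: fps_over_def int_ring_def)
  \<comment> \<open>The division takes place over the field; integrality of Q follows from
    \<open>quotient_bound\<close>, as the remainder does not reach degree p^n.\<close>
  have intQ: "nrm (coeff Q i) \<le> 1" for i
  proof -
    have "nrm (fps_nth (fps_of_poly Q) i) \<le> 1"
    proof (rule quotient_bound[OF omega_distinguished(1) disc_convergent_poly])
      fix i assume "degree ?w \<le> i"
      then have "coeff R' i = 0" using deg omega_distinguished(2)[of n] by (intro coeff_eq_0) simp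
      then have "coeff (?w * Q) i = coeff R i" by (simp add: eq)
      then show "nrm (fps_nth (fps_of_poly ?w * fps_of_poly Q) i) \<le> 1"
        using intR[of i] by (simp flip: fps_of_poly_mult)
    qed simp
    then show ?thesis by simp
  qed
  have intR': "nrm (coeff R' i) \<le> 1" for i
  proof -
    have "int_fps (fps_of_poly R - fps_of_poly ?w * fps_of_poly Q)"
      by (intro int_fps_diff int_fps_mult int_fps_omega) (use intR intQ in \<open>auto simp: int_fps_def\<close>)
    moreover have "fps_of_poly R - fps_of_poly ?w * fps_of_poly Q = fps_of_poly R'"
      by (subst eq) (simp add: fps_of_poly_add fps_of_poly_mult)
    ultimately show ?thesis by (simp add: int_fps_def)
  qed
  have "mellin_poly R = mellin nrm u (fps_of_poly R)" by (simp add: mellin_of_poly)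
  moreover have "mellin nrm u G = mellin nrm u (fps_of_poly R) - mellin nrm u (fps_of_poly ?w * H)"
    using mellin_diff[OF oR oH] by (simp add: R)
  ultimately have "mellin_poly R = mellin nrm u G + mellin nrm u (fps_of_poly ?w * H)" by simp
  then have "int_dvd (omega_fps (Suc n)) (mellin_poly R)"
    using int_dvd_add[OF int_dvd_mult[OF dvd, of "1 + fps_X"] int_dvd_mellin_omega[OF H, of n, unfolded Suc_eq_plus1[symmetric]]]
      int_fps_add[OF int_fps_1 int_fps_X] by (simp add: mG)
  moreover have "mellin_poly R' = mellin_poly R - mellin_poly (?w * Q)"
    by (subst eq) (simp add: mellin_poly_add)
  ultimately have "int_dvd (omega_fps (n + 1)) (mellin_poly R')"
    using int_dvd_diff int_dvd_mellin_poly_omega[OF intQ, of n] by simp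
  then have "R' = 0" by (rule omega_dvd_if_mellin[OF intR' deg])
  then show ?thesis using eq by simp
qed

lemma omega_dvd_mono: "m \<le> n \<Longrightarrow> omega p m dvd (omega p n :: 'a poly)"
proof (induction rule: dec_induct)
  case (step n)
  have "omega p n dvd (omega p (Suc n) :: 'a poly)" unfolding omega_Suc by simp
  then show ?case using step dvd_trans by blast
qed simp

text \<open>In matrix form: the next C is congruent to the inverse of \<open>A_mat\<close> times C
  modulo \<open>\<omega>\<^sub>n\<close>. This is the congruence for \<open>P_prod\<close> one level
  higher, pulled back by \<open>omega_dvd\<close> after regarding the next C at level n.\<close>

lemma C_mat_rec:
  assumes C: "is_C_mat p nrm u K k e ap n C" "is_C_mat p nrm u K k e ap (Suc n) C'" and k: "k \<ge> 2"
    and e: "e \<in> K" "e \<noteq> 0" "nrm e \<le> 1" and ap: "ap \<in> K" "nrm ap \<le> 1"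
  shows "omega p n dvd C' $ 1 $ j - smult ap (C $ 1 $ j) - C $ 2 $ j"
    and "omega p n dvd C' $ 2 $ j - smult (- (e * of_nat p ^ (k - 1))) (C $ 1 $ j)"
proof -
  have apO: "ap \<in> OK" using ap by (simp add: int_ring_def)
  have "of_nat p ^ (k - 1) \<in> K"
    using subring_set_of_nat[OF subring_set_K, of "p ^ (k - 1)"] by simp
  then have fO: "- (e * of_nat p ^ (k - 1)) \<in> OK"
    using e subring_setD[OF subring_set_K] unfolding int_ring_def
    by (auto intro!: nrm_mult_le_1 nrm_power_le_1 nrm_of_nat_le_1)
  note lift = mellin_lift_Suc[OF C_mat_lift[OF C(2) k]] C_mat_lift[OF C(1) k]
  note dvd = int_dvd_P_prod_Suc[OF e(2,3) ap(2)]
  show "omega p n dvd C' $ 1 $ j - smult ap (C $ 1 $ j) - C $ 2 $ j"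
    by (rule omega_dvd[OF mellin_lift_diff[OF mellin_lift_diff[OF lift(1) mellin_lift_smult[OF lift(2) apO]] lift(2)] dvd(1)])
  show "omega p n dvd C' $ 2 $ j - smult (- (e * of_nat p ^ (k - 1))) (C $ 1 $ j)"
    by (rule omega_dvd[OF mellin_lift_diff[OF lift(1) mellin_lift_smult[OF lift(2) fO]] dvd(2)])
qed

text \<open>The constant coefficient of the first entry of \<open>P_prod\<close> for \<open>n = 1\<close> is \<open>ap\<close>.\<close>

lemma C_mat_imp_integral:
  assumes C: "is_C_mat p nrm u K k e ap 1 C" and k: "k \<ge> 2" and e: "e \<noteq> 0"
  shows "nrm ap \<le> 1"
proof -
  obtain G H where G: "fps_over OK G" "fps_over OK H" "mellin nrm u G = (1 + fps_X) * P_prod p k e ap 1 $ 1 $ 1"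
    by (rule mellin_liftE[OF C_mat_lift[OF C k]])
  have "P_prod p k e ap 1 $ 1 $ 1 = (frob p ^^ 1) (fps_const ap * delta_inv ^ (k - 1))"
    using P_prod_Suc(1)[OF e, of k ap 0 1] by (simp add: mat_def)
  then have "fps_nth (mellin nrm u G) 0 = ap"
    unfolding G(3) by (simp add: frob_def delta_inv_0 fps_nth_power_0)
  then show ?thesis using int_fps_mellin[OF G(1)] unfolding int_fps_def by metis
qed

end

section \<open>Limits on the open disc and the rows of the logarithmic matrix\<close>

context nonarch
begin

lemma disc_lim_add:
  assumes "disc_lim nrm S F" "disc_lim nrm T G"
  shows "disc_lim nrm (\<lambda>n. S n + T n) (F + G)"
  unfolding disc_lim_def
proof (intro ballI allI impI)
  fix r e :: real assume r: "r \<in> {0..<1}" and e: "e > 0"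
  obtain a where a: "\<And>n m. n \<ge> a \<Longrightarrow> nrm (fps_nth (S n) m - fps_nth F m) * r ^ m < e"
    using assms(1) r e unfolding disc_lim_def by meson
  obtain b where b: "\<And>n m. n \<ge> b \<Longrightarrow> nrm (fps_nth (T n) m - fps_nth G m) * r ^ m < e"
    using assms(2) r e unfolding disc_lim_def by meson
  have "nrm (fps_nth (S n + T n) m - fps_nth (F + G) m) * r ^ m < e" if n: "n \<ge> max a b" for n m
  proof -
    have eq: "fps_nth (S n + T n) m - fps_nth (F + G) m
      = (fps_nth (S n) m - fps_nth F m) + (fps_nth (T n) m - fps_nth G m)" by simp
    have "nrm (fps_nth (S n + T n) m - fps_nth (F + G) m) * r ^ m
      \<le> max (nrm (fps_nth (S n) m - fps_nth F m)) (nrm (fps_nth (T n) m - fps_nth G m)) * r ^ m"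
      unfolding eq using r by (intro mult_right_mono nrm_add_le_max) auto
    also have "\<dots> < e"
      using a[of n m] b[of n m] n by (cases "nrm (fps_nth (S n) m - fps_nth F m) \<le> nrm (fps_nth (T n) m - fps_nth G m)") auto
    finally show ?thesis .
  qed
  then show "\<exists>n0. \<forall>n\<ge>n0. \<forall>m. nrm (fps_nth (S n + T n) m - fps_nth (F + G) m) * r ^ m < e" by blast
qed

lemma disc_lim_cmult:
  assumes "disc_lim nrm S F"
  shows "disc_lim nrm (\<lambda>n. fps_const c * S n) (fps_const c * F)"
proof (cases "c = 0")
  case True
  then show ?thesis by (simp add: disc_lim_def)
next
  case False
  show ?thesis
    unfolding disc_lim_def
  proof (intro ballI allI impI)
    fix r e :: real assume r: "r \<in> {0..<1}" and e: "e > 0"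
    then have "e / nrm c > 0" using False by simp
    then obtain a where a: "\<And>n m. n \<ge> a \<Longrightarrow> nrm (fps_nth (S n) m - fps_nth F m) * r ^ m < e / nrm c"
      using assms r unfolding disc_lim_def by meson
    have "nrm (fps_nth (fps_const c * S n) m - fps_nth (fps_const c * F) m) * r ^ m < e" if "n \<ge> a" for n m
    proof -
      have "fps_nth (fps_const c * S n) m - fps_nth (fps_const c * F) m = c * (fps_nth (S n) m - fps_nth F m)"
        by (simp add: right_diff_distrib)
      then show ?thesis
        using a[OF that, of m] False by (simp add: nrm_mult pos_less_divide_eq mult_ac)
    qed
    then show "\<exists>n0. \<forall>n\<ge>n0. \<forall>m. nrm (fps_nth (fps_const c * S n) m - fps_nth (fps_const c * F) m) * r ^ m < e"
      by blast
  qed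
qed

lemma disc_lim_shift_diff:
  assumes "disc_lim nrm S F"
  shows "disc_lim nrm (\<lambda>m. S (n + m) - G) (F - G)"
  unfolding disc_lim_def
proof (intro ballI allI impI)
  fix r e :: real assume "r \<in> {0..<1}" "e > 0"
  then obtain a where a: "\<And>n m. n \<ge> a \<Longrightarrow> nrm (fps_nth (S n) m - fps_nth F m) * r ^ m < e"
    using assms unfolding disc_lim_def by meson
  show "\<exists>n0. \<forall>m\<ge>n0. \<forall>i. nrm (fps_nth (S (n + m) - G) i - fps_nth (F - G) i) * r ^ i < e"
    using a by (intro exI[of _ a]) simp
qed

lemma Tw_0: "Tw nrm u 0 F = F"
proof (rule fps_ext)
  fix i
  have "plim nrm (\<lambda>n. \<Sum>m<n. fps_nth F m * coeff ([:u ^ 0 - 1, u ^ 0:] ^ m) i) (fps_nth F i)"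
  proof (rule plim_eventually_const[of "Suc i"])
    fix n assume n: "n \<ge> Suc i"
    have "[:0, 1:] ^ m = (monom 1 m :: 'a poly)" for m by (simp add: monom_altdef)
    then have "(\<Sum>m<n. fps_nth F m * coeff ([:u ^ 0 - 1, u ^ 0:] ^ m) i) = (\<Sum>m<n. if m = i then fps_nth F m else 0)"
      by (intro sum.cong) auto
    then show "(\<Sum>m<n. fps_nth F m * coeff ([:u ^ 0 - 1, u ^ 0:] ^ m) i) = fps_nth F i"
      using n by simp
  qed
  then show "fps_nth (Tw nrm u 0 F) i = fps_nth F i"
    by (simp add: Tw_def psuminf_eqI)
qed

text \<open>\<open>(1, 1 / \<alpha>)\<close> and \<open>(1, 1 / \<beta>)\<close> are, up to a scalar, the rows of the inverse of \<open>Q_mat \<alpha> \<beta>\<close>.\<close>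

abbreviation left_row :: "'a fps^2^2 \<Rightarrow> 'a \<Rightarrow> 2 \<Rightarrow> 'a fps" where
  "left_row Y x j \<equiv> Y $ 1 $ j + fps_const (1 / x) * Y $ 2 $ j"

text \<open>\<open>A_mat\<close> has trace 1 / \<alpha> + 1 / \<beta> and determinant 1 / (\<alpha>
  \<beta>), so the eigenvalue of this row is 1 / \<alpha>.\<close>

lemma A_mat_funpow_row:
  fixes Y :: "'a fps^2^2"
  assumes ab: "e * of_nat p ^ (k - 1) = \<alpha> * \<beta>" "ap = \<alpha> + \<beta>" "\<alpha> \<noteq> 0" "\<beta> \<noteq> 0"
  shows "left_row (((**) (map_matrix fps_const (A_mat p k e ap)) ^^ m) Y) \<alpha> j
    = fps_const ((1 / \<alpha>) ^ m) * left_row Y \<alpha> j"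
proof (induction m)
  case (Suc m)
  let ?Z = "((**) (map_matrix fps_const (A_mat p k e ap)) ^^ m) Y"
  have A: "A_mat p k e ap = mat2 0 (- 1 / (\<alpha> * \<beta>)) 1 ((\<alpha> + \<beta>) / (\<alpha> * \<beta>))"
    by (simp only: A_mat_def ab)
  have "left_row (((**) (map_matrix fps_const (A_mat p k e ap)) ^^ Suc m) Y) \<alpha> j
    = fps_const (- 1 / (\<alpha> * \<beta>)) * ?Z $ 2 $ j
      + fps_const (1 / \<alpha>) * (?Z $ 1 $ j + fps_const ((\<alpha> + \<beta>) / (\<alpha> * \<beta>)) * ?Z $ 2 $ j)"
    by (simp add: A matrix_matrix_mult_def map_matrix_def sum_2)
  also have "\<dots> = fps_const (1 / \<alpha>) * ?Z $ 1 $ j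
      + fps_const (- 1 / (\<alpha> * \<beta>) + 1 / \<alpha> * ((\<alpha> + \<beta>) / (\<alpha> * \<beta>))) * ?Z $ 2 $ j"
    by (simp only: fps_const_add[symmetric] fps_const_mult[symmetric] distrib_left distrib_right mult.assoc add_ac)
  also have "- 1 / (\<alpha> * \<beta>) + 1 / \<alpha> * ((\<alpha> + \<beta>) / (\<alpha> * \<beta>)) = 1 / \<alpha> * (1 / \<alpha>)"
    using ab(3,4) by (simp add: field_simps)
  also have "fps_const (1 / \<alpha>) * ?Z $ 1 $ j + fps_const (1 / \<alpha> * (1 / \<alpha>)) * ?Z $ 2 $ j
      = fps_const (1 / \<alpha>) * (?Z $ 1 $ j + fps_const (1 / \<alpha>) * ?Z $ 2 $ j)"
    by (simp add: distrib_left mult.assoc flip: fps_const_mult)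
  also have "\<dots> = fps_const ((1 / \<alpha>) ^ Suc m) * left_row Y \<alpha> j"
    unfolding Suc by (simp add: mult.assoc flip: fps_const_mult)
  finally show ?case .
qed simp

text \<open>The inverse of \<open>Q_mat\<close> is 1 / (\<alpha> - \<beta>) times the matrix with
  rows (1, 1 / \<alpha>) and (1, 1 / \<beta>), so this scalar occurs on both sides and
  cancels.\<close>

lemma signed_pair_rows:
  assumes "is_signed_pair nrm K \<alpha> \<beta> M L\<alpha> L\<beta> Ls Lf" and ab: "\<alpha> \<noteq> 0" "\<beta> \<noteq> 0" "\<alpha> \<noteq> \<beta>"
  shows "L\<alpha> = left_row M \<alpha> 1 * Ls + left_row M \<alpha> 2 * Lf"
    and "L\<beta> = left_row M \<beta> 1 * Ls + left_row M \<beta> 2 * Lf"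
proof -
  define d where "d = 1 / (\<alpha> - \<beta>)"
  have d: "d \<noteq> 0" "d * (\<alpha> - \<beta>) = 1" using ab by (simp_all add: d_def)
  have inv: "\<alpha> * (1 / \<alpha>) = 1" "\<beta> * (1 / \<beta>) = 1" using ab by simp_all
  \<comment> \<open>The entries of the two matrix products, with variables i and j for the
    reciprocals, so that they become polynomial identities.\<close>
  have alg: "d * (x - y) = 1 \<Longrightarrow> x * d + - y * d = 1" "x * (d * i) + - y * (d * j) = 0"
    "- x * y * d + x * y * d = 0" "d * (x - y) = 1 \<Longrightarrow> - x * y * (d * i) + x * y * (d * j) = 1"
    "d * (x - y) = 1 \<Longrightarrow> d * x + d * i * (- x * y) = 1" "d * - y + d * i * (x * y) = 0"
    "d * x + d * j * (- x * y) = 0" "d * (x - y) = 1 \<Longrightarrow> d * - y + d * j * (x * y) = 1"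
    if "x * i = 1" "y * j = 1" for x y i j :: 'a
    using that by - (algebra, algebra, simp, algebra+)
  have "matrix_inv (Q_mat \<alpha> \<beta>) = mat2 d (d * (1 / \<alpha>)) d (d * (1 / \<beta>))"
    unfolding Q_mat_def
  proof (rule matrix_inv_unique_right_left)
    have "\<alpha> * d + - \<beta> * d = 1" "\<alpha> * (d * (1 / \<alpha>)) + - \<beta> * (d * (1 / \<beta>)) = 0"
      "- \<alpha> * \<beta> * d + \<alpha> * \<beta> * d = 0" "- \<alpha> * \<beta> * (d * (1 / \<alpha>)) + \<alpha> * \<beta> * (d * (1 / \<beta>)) = 1"
      using d(2) by (simp_all only: alg[OF inv])
    then show "mat2 \<alpha> (- \<beta>) (- \<alpha> * \<beta>) (\<alpha> * \<beta>) ** mat2 d (d * (1 / \<alpha>)) d (d * (1 / \<beta>)) = mat 1"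
      by (simp only: mat2_mult mat2_1)
    have "d * \<alpha> + d * (1 / \<alpha>) * (- \<alpha> * \<beta>) = 1" "d * - \<beta> + d * (1 / \<alpha>) * (\<alpha> * \<beta>) = 0"
      "d * \<alpha> + d * (1 / \<beta>) * (- \<alpha> * \<beta>) = 0" "d * - \<beta> + d * (1 / \<beta>) * (\<alpha> * \<beta>) = 1"
      using d(2) by (simp_all only: alg[OF inv])
    then show "mat2 d (d * (1 / \<alpha>)) d (d * (1 / \<beta>)) ** mat2 \<alpha> (- \<beta>) (- \<alpha> * \<beta>) (\<alpha> * \<beta>) = mat 1"
      by (simp only: mat2_mult mat2_1)
  qed
  moreover define da db where "da = d * (1 / \<alpha>)" and "db = d * (1 / \<beta>)"
  ultimately have eq: "fps_const d *s vector [L\<alpha>, L\<beta>] =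
      (map_matrix fps_const (mat2 d da d db) ** M) *v (vector [Ls, Lf] :: 'a fps^2)"
    using assms(1) by (simp add: is_signed_pair_def d_def)
  have const: "fps_const da = fps_const d * fps_const (1 / \<alpha>)" "fps_const db = fps_const d * fps_const (1 / \<beta>)"
    by (simp_all add: da_def db_def)
  have row: "L = (A + x * A') * Ls + (B + x * B') * Lf"
    if "fps_const d * L = (fps_const d * A + fps_const d * x * A') * Ls + (fps_const d * B + fps_const d * x * B') * Lf"
    for L x A A' B B'
  proof -
    have "fps_const d * L = fps_const d * ((A + x * A') * Ls + (B + x * B') * Lf)"
      unfolding that by (simp add: algebra_simps)
    then show ?thesis using d(1) by simp
  qed
  have "fps_const d * L\<alpha> = (fps_const d * M $ 1 $ 1 + fps_const da * M $ 2 $ 1) * Ls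
      + (fps_const d * M $ 1 $ 2 + fps_const da * M $ 2 $ 2) * Lf"
    using arg_cong[OF eq, of "\<lambda>v. v $ 1"]
    by (simp add: matrix_vector_mult_def matrix_matrix_mult_def map_matrix_def sum_2)
  then show "L\<alpha> = left_row M \<alpha> 1 * Ls + left_row M \<alpha> 2 * Lf"
    unfolding const by (rule row)
  have "fps_const d * L\<beta> = (fps_const d * M $ 1 $ 1 + fps_const db * M $ 2 $ 1) * Ls
      + (fps_const d * M $ 1 $ 2 + fps_const db * M $ 2 $ 2) * Lf"
    using arg_cong[OF eq, of "\<lambda>v. v $ 2"]
    by (simp add: matrix_vector_mult_def matrix_matrix_mult_def map_matrix_def sum_2)
  then show "L\<beta> = left_row M \<beta> 1 * Ls + left_row M \<beta> 2 * Lf"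
    unfolding const by (rule row)
qed

text \<open>The invariants in terms of norms: B is the Gauss norm, whose logarithm to base
  \<open>nrm \<pi>\<close> is \<mu>, and d is \<lambda>. Positivity of B excludes the zero
  sequence.\<close>

definition has_invariants :: "(nat \<Rightarrow> 'a) \<Rightarrow> real \<Rightarrow> nat \<Rightarrow> bool" where
  "has_invariants c B d \<longleftrightarrow> B > 0 \<and> (\<forall>i. nrm (c i) \<le> B) \<and> nrm (c d) = B \<and> (\<forall>i<d. nrm (c i) < B)"

lemma has_invariants_mu_lambda:
  assumes \<pi>: "is_uniformizer nrm K \<pi>" and c: "has_invariants c B d"
  shows "mu_inv nrm \<pi> c = ereal (log (nrm \<pi>) B)" "lambda_inv nrm \<pi> c = enat d"
proof -
  have pi: "0 < nrm \<pi>" "nrm \<pi> < 1" using \<pi> by (auto simp: is_uniformizer_def)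
  have B: "B > 0" using c by (simp add: has_invariants_def)
  have ln: "ln (nrm \<pi>) < 0" using pi by simp
  have le: "ereal (log (nrm \<pi>) B) \<le> ord_unif nrm \<pi> (c i)" for i
    using c ln B unfolding ord_unif_def log_def has_invariants_def
    by (auto intro!: divide_right_mono_neg)
  have less: "ereal (log (nrm \<pi>) B) < ord_unif nrm \<pi> (c i)" if "i < d" for i
    using c ln B that unfolding ord_unif_def log_def has_invariants_def
    by (auto intro!: divide_strict_right_mono_neg)
  have cd: "ord_unif nrm \<pi> (c d) = ereal (log (nrm \<pi>) B)"
    using c unfolding ord_unif_def has_invariants_def by auto
  show mu: "mu_inv nrm \<pi> c = ereal (log (nrm \<pi>) B)"
    unfolding mu_inv_def using le cd by (intro antisym INF_lower2[of d] INF_greatest) auto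
  have "(LEAST i. ord_unif nrm \<pi> (c i) = mu_inv nrm \<pi> c) = d"
    unfolding mu
  proof (rule Least_equality)
    show "d \<le> i" if "ord_unif nrm \<pi> (c i) = ereal (log (nrm \<pi>) B)" for i
      using less[of i] that by (cases "i < d") auto
  qed (rule cd)
  moreover have "c d \<noteq> 0" using c by (auto simp: has_invariants_def)
  ultimately show "lambda_inv nrm \<pi> c = enat d"
    by (auto simp: lambda_inv_def)
qed

text \<open>The supremum S of the norms is attained because the norm is discrete on K: otherwise two
  coefficients with distinct norms strictly between \<open>nrm \<pi> * S\<close> and S would have a
  ratio of norm strictly between \<open>nrm \<pi>\<close> and 1.\<close>

lemma has_invariants_exists:
  assumes \<pi>: "is_uniformizer nrm K \<pi>" and K: "is_subfield K" "\<And>i. c i \<in> K"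
    and bounded: "\<And>i. nrm (c i) \<le> B0" and ne: "c j \<noteq> 0"
  obtains B d where "has_invariants c B d"
proof -
  have pi: "0 < nrm \<pi>" "nrm \<pi> < 1" and gap: "\<And>x. x \<in> K \<Longrightarrow> nrm x < 1 \<Longrightarrow> nrm x \<le> nrm \<pi>"
    using \<pi> by (auto simp: is_uniformizer_def)
  define S where "S = (SUP i. nrm (c i))"
  have bdd: "bdd_above (range (\<lambda>i. nrm (c i)))" using bounded by (intro bdd_aboveI[of _ B0]) auto
  have le: "nrm (c i) \<le> S" for i unfolding S_def using bdd by (rule cSUP_upper[rotated]) simp
  have S: "S > 0" using le[of j] ne nrm_pos_iff[of "c j"] by linarith
  have "\<exists>i. nrm (c i) = S"
  proof (rule ccontr)
    assume "\<not> ?thesis"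
    then have strict: "nrm (c i) < S" for i using le[of i] by (simp add: less_le)
    have "nrm \<pi> * S < S" using S pi by simp
    then obtain i where i: "nrm \<pi> * S < nrm (c i)"
      unfolding S_def using less_cSUP_iff[OF _ bdd] by auto
    obtain l where l: "nrm (c i) < nrm (c l)"
      using strict[of i] less_cSUP_iff[OF _ bdd] unfolding S_def by auto
    have "c i * inverse (c l) \<in> K" using K unfolding is_subfield_def by blast
    moreover have cl: "nrm (c l) > 0" using l nrm_nonneg[of "c i"] by linarith
    then have "nrm (c i * inverse (c l)) < 1"
      using l by (simp add: nrm_divide field_simps)
    ultimately have "nrm (c i * inverse (c l)) \<le> nrm \<pi>" by (rule gap)
    then have "nrm (c i) \<le> nrm \<pi> * nrm (c l)"
      using cl by (simp add: nrm_divide field_simps)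
    also have "\<dots> \<le> nrm \<pi> * S" using le pi by (intro mult_left_mono) auto
    finally show False using i by simp
  qed
  then obtain i where i: "nrm (c i) = S" ..
  define d where "d = (LEAST i. nrm (c i) = S)"
  have "nrm (c d) = S" unfolding d_def using i by (rule LeastI)
  moreover have "nrm (c i) < S" if "i < d" for i
    using not_less_Least[of i "\<lambda>i. nrm (c i) = S"] that le[of i] by (auto simp: d_def)
  ultimately have "has_invariants c S d" using S le by (auto simp: has_invariants_def)
  then show ?thesis using that by blast
qed

text \<open>The Gauss norm is multiplicative and the first maximal indices add: in degree D + d the
  product of the two extremal coefficients is the only term of norm B, and in lower degrees there is
  none.\<close>

lemma has_invariants_mult:
  assumes G: "int_fps G" "\<And>i. i < D \<Longrightarrow> nrm (fps_nth G i) < 1" "nrm (fps_nth G D) = 1"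
    and F: "has_invariants (fps_nth F) B d"
  shows "has_invariants (fps_nth (G * F)) B (D + d)"
proof -
  have B: "B > 0" "\<And>i. nrm (fps_nth F i) \<le> B" "nrm (fps_nth F d) = B" "\<And>i. i < d \<Longrightarrow> nrm (fps_nth F i) < B"
    using F by (auto simp: has_invariants_def)
  have G1: "nrm (fps_nth G i) \<le> 1" for i using G(1) by (simp add: int_fps_def)
  have le: "nrm (fps_nth (G * F) n) \<le> B" for n
    using fps_mult_nth_bound[of G 1 F B] G1 B(2) by simp
  have small: "nrm (fps_nth G i * fps_nth F (n - i)) < B" if "i \<le> n" "n \<le> D + d" "\<not> (i = D \<and> n = D + d)" for i n
  proof (cases "i < D")
    case True
    have "nrm (fps_nth G i * fps_nth F (n - i)) \<le> nrm (fps_nth G i) * B"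
      unfolding nrm_mult using B by (intro mult_left_mono) auto
    also have "\<dots> < B" using G(2)[OF True] B(1) by simp
    finally show ?thesis .
  next
    case False
    then have "n - i < d" using that by auto
    from nrm_mult_less[OF B(4)[OF this] G1[of i]] show ?thesis by (simp add: mult.commute)
  qed
  have less: "nrm (fps_nth (G * F) n) < B" if "n < D + d" for n
    unfolding fps_mult_nth using that B(1) by (intro nrm_sum_less small) auto
  have "fps_nth (G * F) (D + d) = (\<Sum>i=0..D + d. fps_nth G i * fps_nth F (D + d - i))"
    by (rule fps_mult_nth)
  also have "\<dots> = fps_nth G D * fps_nth F d + (\<Sum>i\<in>{0..D + d} - {D}. fps_nth G i * fps_nth F (D + d - i))"
    by (subst sum.remove[of _ D]) auto
  finally have "fps_nth (G * F) (D + d) = \<dots>" .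
  moreover have "nrm (\<Sum>i\<in>{0..D + d} - {D}. fps_nth G i * fps_nth F (D + d - i)) < nrm (fps_nth G D * fps_nth F d)"
    unfolding nrm_mult G(3) B(3) mult_1 using B(1) by (intro nrm_sum_less small) auto
  ultimately have "nrm (fps_nth (G * F) (D + d)) = B"
    using nrm_add_eq by (simp add: nrm_mult G(3) B(3))
  then show ?thesis using B(1) le less by (auto simp: has_invariants_def)
qed

lemma has_invariants_add_small:
  assumes F: "has_invariants F B d" and G: "\<And>i. nrm (G i) < B"
  shows "has_invariants (\<lambda>i. F i + G i) B d"
proof -
  have F': "B > 0" "\<And>i. nrm (F i) \<le> B" "nrm (F d) = B" "\<And>i. i < d \<Longrightarrow> nrm (F i) < B"
    using F by (auto simp: has_invariants_def)
  then have "nrm (F d + G d) = B" using nrm_add_eq[of "G d" "F d"] G[of d] by simp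
  then show ?thesis
    using F' G less_imp_le[OF G] by (auto simp: has_invariants_def intro: nrm_add_le nrm_add_less)
qed

lemma fps_mult_nth_less:
  assumes "\<And>i. nrm (fps_nth G i) < 1" "\<And>i. nrm (fps_nth F i) \<le> B" "B > 0"
  shows "nrm (fps_nth (G * F) n) < B"
  unfolding fps_mult_nth
proof (rule nrm_sum_less[OF assms(3)])
  fix i
  have "nrm (fps_nth G i * fps_nth F (n - i)) \<le> nrm (fps_nth G i) * B"
    unfolding nrm_mult using assms by (intro mult_left_mono) auto
  also have "\<dots> < B" using assms(1)[of i] assms(3) by simp
  finally show "nrm (fps_nth G i * fps_nth F (n - i)) < B" .
qed

text \<open>From degree W on, W * H has to cancel F, which bounds H by B. Below degree W only
  non-leading coefficients of W occur in the product, so W * H is strictly smaller than B there and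
  cannot disturb an index d < degree W.\<close>

lemma has_invariants_remainder:
  assumes W: "distinguished W" and T: "degree T < degree W" "fps_of_poly T = F + fps_of_poly W * H"
    and H: "disc_convergent nrm H" and F: "has_invariants (fps_nth F) B d" "d < degree W"
  shows "has_invariants (coeff T) B d"
proof -
  have B: "B > 0" "\<And>i. nrm (fps_nth F i) \<le> B" using F(1) by (auto simp: has_invariants_def)
  have bH: "nrm (fps_nth H i) \<le> B" for i
  proof (rule quotient_bound[OF W H])
    fix i assume i: "degree W \<le> i"
    have "fps_nth F i + fps_nth (fps_of_poly W * H) i = coeff T i"
      using arg_cong[OF T(2), of "\<lambda>F. fps_nth F i"] by simp
    also have "coeff T i = 0" using T(1) i by (intro coeff_eq_0) auto
    finally have "fps_nth (fps_of_poly W * H) i = - fps_nth F i" by (simp add: eq_neg_iff_add_eq_0 add.commute)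
    then show "nrm (fps_nth (fps_of_poly W * H) i) \<le> B" using B(2) by simp
  qed (use B in auto)
  \<comment> \<open>Cut off at degree W, beyond which W * H may reach norm B; T itself is zero
    there.\<close>
  define G where "G i = (if i < degree W then fps_nth (fps_of_poly W * H) i else 0)" for i
  have G: "nrm (G i) < B" for i
  proof (cases "i < degree W")
    case True
    have "nrm (fps_nth (fps_of_poly W * H) i) < B"
      unfolding fps_mult_nth
    proof (rule nrm_sum_less[OF B(1)])
      fix l assume "l \<in> {0..i}"
      then have "nrm (coeff W l) < 1" using W True by (auto simp: distinguished_def)
      have "nrm (fps_nth (fps_of_poly W) l * fps_nth H (i - l)) \<le> nrm (coeff W l) * B"
        unfolding nrm_mult using bH by (simp add: mult_left_mono)
      also have "\<dots> < B" using \<open>nrm (coeff W l) < 1\<close> B(1) by simp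
      finally show "nrm (fps_nth (fps_of_poly W) l * fps_nth H (i - l)) < B" .
    qed
    then show ?thesis using True by (simp add: G_def)
  qed (use B in \<open>simp add: G_def\<close>)
  have inv: "has_invariants (\<lambda>i. fps_nth F i + G i) B d" by (rule has_invariants_add_small[OF F(1) G])
  have eq: "coeff T i = fps_nth F i + G i" if "i < degree W" for i
    using arg_cong[OF T(2), of "\<lambda>F. fps_nth F i"] that by (simp add: G_def)
  have zero: "coeff T i = 0" if "\<not> i < degree W" for i
    using T(1) that by (intro coeff_eq_0) auto
  have "nrm (coeff T i) \<le> B" for i
    using eq[of i] zero[of i] inv B(1) by (cases "i < degree W") (auto simp: has_invariants_def)
  moreover have "nrm (coeff T i) < B" if "i < d" for i
    using eq[of i] that F(2) inv by (auto simp: has_invariants_def)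
  ultimately show ?thesis
    using inv eq[OF F(2)] by (auto simp: has_invariants_def)
qed

end

section \<open>Mazur--Tate elements\<close>

lemma gr_poly_linear:
  "gr_poly p n (\<lambda>m. a * \<theta> m - b * \<eta> m) = smult a (gr_poly p n \<theta>) - smult b (gr_poly p n \<eta>)"
  for \<theta> \<eta> :: "nat \<Rightarrow> 'b::comm_ring_1"
proof -
  have "smult c (\<Sum>m\<in>A. P m) = (\<Sum>m\<in>A. smult c (P m))" for c :: 'b and A :: "nat set" and P
    by (induction A rule: infinite_finite_induct) (simp_all add: smult_add_right)
  then show ?thesis
    unfolding gr_poly_def by (simp add: smult_diff_left sum_subtractf)
qed

lemma degree_gr_poly:
  assumes "p > 0" shows "degree (gr_poly p n \<theta> :: 'b::idom poly) < p ^ n"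
proof -
  have "degree (gr_poly p n \<theta>) \<le> p ^ n - 1"
    unfolding gr_poly_def
  proof (rule degree_sum_le)
    fix m assume "m \<in> {..<p ^ n}"
    moreover have "degree (smult (\<theta> m) ([:1, 1:] ^ m)) \<le> m"
      by (rule order_trans[OF degree_smult_le]) (simp add: degree_power_eq)
    ultimately show "degree (smult (\<theta> m) ([:1, 1:] ^ m)) \<le> p ^ n - 1" by auto
  qed simp
  moreover have "p ^ n > 0" using assms by simp
  ultimately show ?thesis by linarith
qed

text \<open>Two powers of a agree modulo N, and the nonzero value can be cancelled. This serves to
  show that the nebentype at p has p-adic norm 1.\<close>

lemma dirichlet_char_root_of_unity:
  assumes \<epsilon>: "dirichlet_char N \<epsilon>" and N: "N > 0" and nz: "\<epsilon> (int a) \<noteq> 0"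
  obtains t where "t > 0" "\<epsilon> (int a) ^ t = 1"
proof -
  have mult: "\<epsilon> (m * n) = \<epsilon> m * \<epsilon> n" and per: "\<epsilon> (m + int N) = \<epsilon> m" for m n
    using \<epsilon> by (auto simp: dirichlet_char_def)
  have "\<epsilon> 1 \<noteq> 0" using \<epsilon> by (simp add: dirichlet_char_def)
  then have e1: "\<epsilon> 1 = 1" using mult[of 1 1] by simp
  have period: "\<epsilon> (m + int j * int N) = \<epsilon> m" for m j
  proof (induction j)
    case (Suc j)
    have "m + int (Suc j) * int N = (m + int j * int N) + int N" by (simp add: algebra_simps)
    then show ?case using per Suc by metis
  qed simp
  have "\<epsilon> (int x) = \<epsilon> (int (x mod N))" for x
    using period[of "int (x mod N)" "x div N"] by (simp flip: of_nat_mult of_nat_add)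
  moreover have powr: "\<epsilon> (int (a ^ n)) = \<epsilon> (int a) ^ n" for n
    by (induction n) (simp_all add: mult e1)
  ultimately have eq: "\<epsilon> (int a) ^ n = \<epsilon> (int (a ^ n mod N))" for n by metis
  have "finite (range (\<lambda>n. a ^ n mod N))"
    by (rule finite_subset[of _ "{..<N}"]) (simp_all add: N image_subset_iff)
  then have "\<not> inj (\<lambda>n. a ^ n mod N)" using finite_imageD by blast
  then obtain i' j' where "i' \<noteq> j'" "a ^ i' mod N = a ^ j' mod N"
    unfolding inj_def by blast
  moreover define i j where "i = min i' j'" and "j = max i' j'"
  ultimately have ij: "i < j" "a ^ i mod N = a ^ j mod N"
    by (auto simp: min_def max_def)
  then have "\<epsilon> (int a) ^ i = \<epsilon> (int a) ^ j" using eq by metis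
  also have "\<dots> = \<epsilon> (int a) ^ i * \<epsilon> (int a) ^ (j - i)" using ij(1) by (simp flip: power_add)
  finally have "\<epsilon> (int a) ^ (j - i) = 1" using nz by simp
  then show ?thesis using that[of "j - i"] ij(1) by simp
qed

text \<open>The embedding is multiplicative on algebraic numbers only, so all powers have to be
  algebraic.\<close>

lemma is_embedding_power:
  assumes "is_embedding \<iota>" "\<And>n. algebraic (z ^ n)" shows "\<iota> (z ^ n) = \<iota> z ^ n"
  using assms assms(2)[of 1] by (induction n) (auto simp: is_embedding_def)

lemma algebraic_root_of_unity:
  assumes "t > 0" "(z :: complex) ^ t = 1" shows "algebraic z"
proof (rule algebraicI)
  show "coeff (monom 1 t - 1 :: complex poly) i \<in> \<int>" for i
    by (cases i) (auto simp: one_pCons)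
  have "coeff (monom 1 t - 1 :: complex poly) t = 1" using assms(1) by simp
  then show "(monom 1 t - 1 :: complex poly) \<noteq> 0" by force
  show "poly (monom 1 t - 1) z = 0" using assms(2) by (simp add: poly_monom)
qed

section \<open>The congruence between Mazur--Tate elements and signed L-functions\<close>

locale log_matrix = padic_ext nrm p K u
  for nrm :: "'a::field_char_0 \<Rightarrow> real" and p K u +
  fixes k :: nat and e ap :: 'a and C :: "nat \<Rightarrow> 'a poly^2^2" and M :: "'a fps^2^2"
  assumes k: "k \<ge> 2" and e: "e \<in> K" "e \<noteq> 0" "nrm e \<le> 1" and ap: "ap \<in> K" "nrm ap \<le> 1"
    and C: "\<And>n. is_C_mat p nrm u K k e ap n (C n)" and M: "is_Mlog p nrm k e ap C M"
begin

text \<open>The exponent n + 2 collects n + 1 eigenvalues from the power of \<open>A_mat\<close> and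
  one factor that clears 1 / \<alpha> in the row. All approximations from level n on agree modulo
  \<open>\<omega>\<^sub>n\<close>, and this survives the limit by
  \<open>disc_lim_quotient\<close>.\<close>

lemma Mlog_row_cong:
  assumes ab: "e * of_nat p ^ (k - 1) = \<alpha> * \<beta>" "ap = \<alpha> + \<beta>" "\<alpha> \<noteq> 0" "\<beta> \<noteq> 0"
  obtains H where "disc_convergent nrm H"
    "fps_const (\<alpha> ^ (n + 2)) * (left_row M \<alpha> j)
      = fps_of_poly (smult \<alpha> (C n $ 1 $ j) + C n $ 2 $ j) + omega_fps n * H"
proof -
  define c where "c m = smult \<alpha> (C m $ 1 $ j) + C m $ 2 $ j" for m
  define S where "S m = smult (1 / \<alpha> ^ (m + 2)) (c m)" for m
  define L where "L = left_row M \<alpha> j"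
  have lim: "disc_lim nrm (\<lambda>m. fps_of_poly (S m)) L"
  proof -
    let ?X = "\<lambda>n. ((**) (map_matrix fps_const (A_mat p k e ap)) ^^ (n + 1)) (map_matrix fps_of_poly (C n))"
    have "disc_lim nrm (\<lambda>n. left_row (?X n) \<alpha> j) L"
      unfolding L_def using M unfolding is_Mlog_def by (intro disc_lim_add disc_lim_cmult) blast+
    moreover have "left_row (?X m) \<alpha> j = fps_of_poly (S m)" for m
    proof -
      have "left_row (?X m) \<alpha> j
        = fps_const ((1 / \<alpha>) ^ (m + 1)) * left_row (map_matrix fps_of_poly (C m)) \<alpha> j"
        by (rule A_mat_funpow_row[OF ab])
      also have "\<dots> = fps_of_poly (smult ((1 / \<alpha>) ^ (m + 1)) (C m $ 1 $ j + smult (1 / \<alpha>) (C m $ 2 $ j)))"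
        by (simp add: map_matrix_def fps_of_poly_add fps_of_poly_smult)
      also have "smult ((1 / \<alpha>) ^ (m + 1)) (C m $ 1 $ j + smult (1 / \<alpha>) (C m $ 2 $ j)) = S m"
        using ab(3) by (simp add: S_def c_def smult_add_right power_one_over field_simps)
      finally show ?thesis .
    qed
    ultimately show ?thesis by simp
  qed
  \<comment> \<open>The two recursions with weights \<alpha> and 1 combine to
    \<open>c (Suc m)\<close> congruent to \<alpha> times \<open>c m\<close>, because \<alpha> ap -
    \<alpha> \<beta> = \<alpha>^2.\<close>
  have step: "omega p m dvd S (Suc m) - S m" for m
  proof -
    have "c (Suc m) - smult \<alpha> (c m) = smult \<alpha> (C (Suc m) $ 1 $ j - smult ap (C m $ 1 $ j) - C m $ 2 $ j)
      + (C (Suc m) $ 2 $ j - smult (- (e * of_nat p ^ (k - 1))) (C m $ 1 $ j))"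
      by (simp only: c_def ab) (simp add: smult_add_right smult_diff_right smult_add_left algebra_simps)
    then have "omega p m dvd c (Suc m) - smult \<alpha> (c m)"
      using C_mat_rec[OF C[of m] C[of "Suc m"] k e ap, of j] by (simp only:) (intro dvd_add dvd_smult)
    then have "omega p m dvd smult (1 / \<alpha> ^ (Suc m + 2)) (c (Suc m) - smult \<alpha> (c m))"
      by (rule dvd_smult)
    also have "smult (1 / \<alpha> ^ (Suc m + 2)) (c (Suc m) - smult \<alpha> (c m)) = S (Suc m) - S m"
      using ab(3) by (simp add: S_def smult_diff_right)
    finally show ?thesis .
  qed
  have dvd: "omega p n dvd S (n + m) - S n" for m
  proof (induction m)
    case (Suc m)
    have "omega p n dvd S (Suc (n + m)) - S (n + m)"
      using step[of "n + m"] omega_dvd_mono[of n "n + m"] dvd_trans by simp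
    from dvd_add[OF this Suc] show ?case by simp
  qed simp
  then have "\<exists>q. \<forall>m. S (n + m) - S n = omega p n * q m"
    by (intro choice) (auto simp: dvd_def)
  then obtain q where q: "\<And>m. S (n + m) - S n = omega p n * q m" by blast
  obtain H where H: "disc_convergent nrm H" "L - fps_of_poly (S n) = omega_fps n * H"
  proof (rule disc_lim_quotient[of "omega p n"])
    show "disc_lim nrm (\<lambda>m. fps_of_poly (S (n + m)) - fps_of_poly (S n)) (L - fps_of_poly (S n))"
      by (rule disc_lim_shift_diff[OF lim])
    show "fps_of_poly (S (n + m)) - fps_of_poly (S n) = fps_of_poly (omega p n * q m)" for m
      by (simp add: q flip: fps_of_poly_diff)
  qed (use omega_distinguished that in auto)
  have "fps_const (\<alpha> ^ (n + 2)) * fps_of_poly (S n) = fps_of_poly (c n)"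
    using ab(3) by (simp add: S_def flip: fps_of_poly_smult)
  moreover have "fps_const (\<alpha> ^ (n + 2)) * L = fps_const (\<alpha> ^ (n + 2)) * fps_of_poly (S n)
      + omega_fps n * (fps_const (\<alpha> ^ (n + 2)) * H)"
    using H(2) by (simp only: diff_eq_eq) (simp add: algebra_simps)
  ultimately show ?thesis
    using that[OF disc_convergent_cmult[OF H(1), of "\<alpha> ^ (n + 2)"]] unfolding L_def c_def by simp
qed

text \<open>The same power \<alpha>^(n + 2) clears the denominators of \<open>Theta_stab\<close>;
  the term from level n - 1 then no longer depends on the root.\<close>

lemma Theta_root_cong:
  assumes ab: "e * of_nat p ^ (k - 1) = \<alpha> * \<beta>" "ap = \<alpha> + \<beta>" "\<alpha> \<noteq> 0" "\<beta> \<noteq> 0"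
    and L: "is_Lp p nrm u K' k e \<phi> \<alpha> 0 L"
      "L = left_row M \<alpha> 1 * Ls + left_row M \<alpha> 2 * Lf"
    and bounded: "\<And>i. nrm (fps_nth Ls i) \<le> B" "\<And>i. nrm (fps_nth Lf i) \<le> B" and n: "n \<ge> 1"
  obtains H where "disc_convergent nrm H"
    "fps_of_poly (smult \<alpha> (gr_poly p n (Theta p nrm u k \<phi> 0 n 0))
        - smult (e * of_nat p ^ (k - 2)) (gr_poly p n (nu_map p (n - 1) (Theta p nrm u k \<phi> 0 (n - 1) 0))))
      = fps_of_poly (smult \<alpha> (C n $ 1 $ 1) + C n $ 2 $ 1) * Ls + fps_of_poly (smult \<alpha> (C n $ 1 $ 2) + C n $ 2 $ 2) * Lf
        + omega_fps n * H"
proof -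
  let ?W = "omega_fps n :: 'a fps" and ?a = "fps_const (\<alpha> ^ (n + 2))"
  let ?T = "gr_poly p n (Theta p nrm u k \<phi> 0 n 0)"
  let ?N = "gr_poly p n (nu_map p (n - 1) (Theta p nrm u k \<phi> 0 (n - 1) 0))"
  let ?Q = "gr_poly p n (Theta_stab p nrm u k e \<phi> \<alpha> 0 n 0)"
  obtain H1 where H1: "disc_convergent nrm H1"
    "?a * (left_row M \<alpha> 1) = fps_of_poly (smult \<alpha> (C n $ 1 $ 1) + C n $ 2 $ 1) + ?W * H1"
    by (rule Mlog_row_cong[OF ab])
  obtain H2 where H2: "disc_convergent nrm H2"
    "?a * (left_row M \<alpha> 2) = fps_of_poly (smult \<alpha> (C n $ 1 $ 2) + C n $ 2 $ 2) + ?W * H2"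
    by (rule Mlog_row_cong[OF ab])
  obtain H3 where H3: "disc_convergent nrm H3" "L - fps_of_poly ?Q = ?W * H3"
    using L(1) n unfolding is_Lp_def disc_cong_def by (metis Tw_0 zero_le)
  have "Theta_stab p nrm u k e \<phi> \<alpha> 0 n 0 = (\<lambda>m. 1 / \<alpha> ^ (n + 1) * Theta p nrm u k \<phi> 0 n 0 m
      - e * of_nat p ^ (k - 2) / \<alpha> ^ (n + 2) * nu_map p (n - 1) (Theta p nrm u k \<phi> 0 (n - 1) 0) m)"
    by (auto simp: Theta_stab_def)
  then have Q: "?Q = smult (1 / \<alpha> ^ (n + 1)) ?T - smult (e * of_nat p ^ (k - 2) / \<alpha> ^ (n + 2)) ?N"
    by (simp only: gr_poly_linear)
  have "smult (\<alpha> ^ (n + 2)) ?Q = smult \<alpha> ?T - smult (e * of_nat p ^ (k - 2)) ?N"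
    unfolding Q using ab(3) by (simp add: smult_diff_right)
  then have "fps_of_poly (smult \<alpha> ?T - smult (e * of_nat p ^ (k - 2)) ?N) = ?a * fps_of_poly ?Q"
    by (metis fps_of_poly_smult)
  also have "\<dots> = ?a * L - ?W * (?a * H3)"
    using H3(2) by (simp add: algebra_simps)
  also have "?a * L = (?a * (left_row M \<alpha> 1)) * Ls + (?a * (left_row M \<alpha> 2)) * Lf"
    unfolding L(2) by (simp only: algebra_simps)
  also have "\<dots> - ?W * (?a * H3) = fps_of_poly (smult \<alpha> (C n $ 1 $ 1) + C n $ 2 $ 1) * Ls + fps_of_poly (smult \<alpha> (C n $ 1 $ 2) + C n $ 2 $ 2) * Lf
        + ?W * (H1 * Ls + H2 * Lf - ?a * H3)"
    unfolding H1(2) H2(2) by (simp only: algebra_simps)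
  finally show ?thesis
    by (rule that[rotated])
      (intro disc_convergent_diff disc_convergent_add disc_convergent_cmult
        disc_convergent_mult_bounded[OF H1(1) bounded(1)] disc_convergent_mult_bounded[OF H2(1) bounded(2)] H3(1))
qed

text \<open>The congruences for \<alpha> and \<beta> are affine in the root, apart from the error
  terms. Subtracting them removes the element of level n - 1 and the second row of C, and division
  by \<alpha> - \<beta> leaves the first row.\<close>

lemma Theta_cong:
  assumes ab: "e * of_nat p ^ (k - 1) = \<alpha> * \<beta>" "ap = \<alpha> + \<beta>" "\<alpha> \<noteq> 0" "\<beta> \<noteq> 0" "\<alpha> \<noteq> \<beta>"
    and L: "is_Lp p nrm u K' k e \<phi> \<alpha> 0 L\<alpha>" "is_Lp p nrm u K' k e \<phi> \<beta> 0 L\<beta>"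
    and signed: "is_signed_pair nrm K \<alpha> \<beta> M L\<alpha> L\<beta> Ls Lf" and n: "n \<ge> 1"
  obtains H where "disc_convergent nrm H"
    "fps_of_poly (gr_poly p n (Theta p nrm u k \<phi> 0 n 0))
      = fps_of_poly (C n $ 1 $ 1) * Ls + fps_of_poly (C n $ 1 $ 2) * Lf + omega_fps n * H"
proof -
  let ?W = "omega_fps n :: 'a fps"
  let ?T = "gr_poly p n (Theta p nrm u k \<phi> 0 n 0)"
  let ?N = "smult (e * of_nat p ^ (k - 2)) (gr_poly p n (nu_map p (n - 1) (Theta p nrm u k \<phi> 0 (n - 1) 0)))"
  obtain B where B: "\<And>i. nrm (fps_nth Ls i) \<le> B" "\<And>i. nrm (fps_nth Lf i) \<le> B"
    using signed unfolding is_signed_pair_def by blast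
  have ba: "e * of_nat p ^ (k - 1) = \<beta> * \<alpha>" "ap = \<beta> + \<alpha>" using ab(1,2) by (simp_all add: ac_simps)
  note rows = signed_pair_rows[OF signed ab(3-5)]
  obtain Ha where Ha: "disc_convergent nrm Ha" "fps_of_poly (smult \<alpha> ?T - ?N)
      = fps_of_poly (smult \<alpha> (C n $ 1 $ 1) + C n $ 2 $ 1) * Ls + fps_of_poly (smult \<alpha> (C n $ 1 $ 2) + C n $ 2 $ 2) * Lf + ?W * Ha"
    by (rule Theta_root_cong[OF ab(1-4) L(1) rows(1) B n])
  obtain Hb where Hb: "disc_convergent nrm Hb" "fps_of_poly (smult \<beta> ?T - ?N)
      = fps_of_poly (smult \<beta> (C n $ 1 $ 1) + C n $ 2 $ 1) * Ls + fps_of_poly (smult \<beta> (C n $ 1 $ 2) + C n $ 2 $ 2) * Lf + ?W * Hb"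
    by (rule Theta_root_cong[OF ba ab(4,3) L(2) rows(2) B n])
  define d where "d = 1 / (\<alpha> - \<beta>)"
  have d: "fps_const d * (fps_const \<alpha> - fps_const \<beta>) = 1"
    using ab(5) by (simp add: d_def)
  have "(fps_const \<alpha> - fps_const \<beta>) * fps_of_poly ?T = fps_of_poly (smult \<alpha> ?T - ?N) - fps_of_poly (smult \<beta> ?T - ?N)"
    by (simp only: fps_of_poly_diff fps_of_poly_smult algebra_simps)
  also have "\<dots> = (fps_const \<alpha> - fps_const \<beta>) * (fps_of_poly (C n $ 1 $ 1) * Ls + fps_of_poly (C n $ 1 $ 2) * Lf) + ?W * (Ha - Hb)"
    unfolding Ha(2) Hb(2) fps_of_poly_add fps_of_poly_smult by (simp only: algebra_simps)
  finally have eq: "(fps_const \<alpha> - fps_const \<beta>) * fps_of_poly ?T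
    = (fps_const \<alpha> - fps_const \<beta>) * (fps_of_poly (C n $ 1 $ 1) * Ls + fps_of_poly (C n $ 1 $ 2) * Lf) + ?W * (Ha - Hb)" .
  have "fps_of_poly ?T = fps_const d * ((fps_const \<alpha> - fps_const \<beta>) * fps_of_poly ?T)"
    by (simp only: mult.assoc[symmetric] d mult_1)
  also have "\<dots> = (fps_const d * (fps_const \<alpha> - fps_const \<beta>)) * (fps_of_poly (C n $ 1 $ 1) * Ls + fps_of_poly (C n $ 1 $ 2) * Lf)
      + ?W * (fps_const d * (Ha - Hb))"
    unfolding eq by (simp only: algebra_simps)
  also have "\<dots> = fps_of_poly (C n $ 1 $ 1) * Ls + fps_of_poly (C n $ 1 $ 2) * Lf + ?W * (fps_const d * (Ha - Hb))"
    by (simp only: d mult_1)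
  finally have "fps_of_poly ?T = fps_of_poly (C n $ 1 $ 1) * Ls + fps_of_poly (C n $ 1 $ 2) * Lf + ?W * (fps_const d * (Ha - Hb))" .
  then show ?thesis
    by (rule that[rotated]) (intro disc_convergent_cmult disc_convergent_diff Ha Hb)
qed

end

context padic_red
begin

text \<open>L1 is the series paired with the entry of nonzero reduction. The other product is
  smaller than B as soon as L2 is bounded by B, and this is where the equality of the
  \<mu>-invariants enters.\<close>

lemma C_mat_invariants:
  assumes C: "is_C_mat p nrm u K k e ap n C" and k: "k \<ge> 2" and e: "nrm e = 1" and ap: "nrm ap < 1"
    and L: "has_invariants (fps_nth L1) B d1" "\<And>i. nrm (fps_nth L2 i) \<le> B"
  defines "s \<equiv> (if odd n then 2 else 1 :: 2)" and "t \<equiv> (if odd n then 1 else 2 :: 2)"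
  obtains H F where "disc_convergent nrm H" "has_invariants (fps_nth F) B ((k - 1) * q_num p n + d1)"
    "fps_of_poly (C $ 1 $ s) * L1 + fps_of_poly (C $ 1 $ t) * L2 = F + omega_fps n * H"
proof -
  let ?W = "omega_fps n :: 'a fps"
  have e': "e \<noteq> 0" "nrm e \<le> 1" and ap': "nrm ap \<le> 1" using e ap by auto
  obtain G1 H1 where 1: "fps_over OK G1" "fps_over OK H1"
    "mellin nrm u G1 = (1 + fps_X) * P_prod p k e ap n $ 1 $ s" "fps_of_poly (C $ 1 $ s) = G1 + ?W * H1"
    by (rule mellin_liftE[OF C_mat_lift[OF C k]])
  obtain G2 H2 where 2: "fps_over OK G2" "fps_over OK H2"
    "mellin nrm u G2 = (1 + fps_X) * P_prod p k e ap n $ 1 $ t" "fps_of_poly (C $ 1 $ t) = G2 + ?W * H2"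
    by (rule mellin_liftE[OF C_mat_lift[OF C k]])
  note P = red_P_prod[OF e ap, where k = k and n = n, folded s_def t_def]
  note intP = int_fps_P_prod[OF e' ap', of k n]
  have G1: "red_fps G1 \<noteq> 0" "subdegree (red_fps G1) = (k - 1) * q_num p n"
  proof -
    show "red_fps G1 \<noteq> 0" using red_fps_via_mellin(1)[OF 1(1,3) intP] P by simp
    have "p * subdegree (red_fps G1) = p * ((k - 1) * q_num p n)"
      using red_fps_via_mellin(2)[OF 1(1,3) intP] P by metis
    then show "subdegree (red_fps G1) = (k - 1) * q_num p n" using p_gt_1 by simp
  qed
  have intG1: "int_fps G1" and intG2: "int_fps G2" using 1(1) 2(1) by (simp_all add: fps_over_OK_iff)
  have "red_fps G2 = 0" using red_fps_via_mellin(1)[OF 2(1,3) intP] P by simp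
  then have "red (fps_nth G2 i) = 0" for i by (metis red_fps_nth fps_zero_nth)
  then have G2: "nrm (fps_nth G2 i) < 1" for i
    using red_eq_0_iff[of "fps_nth G2 i"] intG2 by (simp add: int_fps_def)
  have inv1: "has_invariants (fps_nth (G1 * L1)) B ((k - 1) * q_num p n + d1)"
  proof (rule has_invariants_mult[OF intG1 _ _ L(1)])
    have int: "nrm (fps_nth G1 i) \<le> 1" for i using intG1 by (simp add: int_fps_def)
    show "nrm (fps_nth G1 i) < 1" if "i < (k - 1) * q_num p n" for i
      using nth_less_subdegree_zero[of i "red_fps G1"] that G1(2) red_eq_0_iff[OF int] by simp
    have "red (fps_nth G1 ((k - 1) * q_num p n)) \<noteq> 0"
      using nth_subdegree_nonzero[OF G1(1)] G1(2) by simp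
    then show "nrm (fps_nth G1 ((k - 1) * q_num p n)) = 1"
      using red_eq_0_iff[OF int, of "(k - 1) * q_num p n"] int[of "(k - 1) * q_num p n"] by linarith
  qed
  have B: "B > 0" "\<And>i. nrm (fps_nth L1 i) \<le> B" using L(1) by (auto simp: has_invariants_def)
  have "has_invariants (fps_nth (G1 * L1 + G2 * L2)) B ((k - 1) * q_num p n + d1)"
  proof -
    have "fps_nth (G1 * L1 + G2 * L2) = (\<lambda>i. fps_nth (G1 * L1) i + fps_nth (G2 * L2) i)"
      by (simp add: fun_eq_iff)
    moreover have "nrm (fps_nth (G2 * L2) i) < B" for i
      by (rule fps_mult_nth_less[OF G2 L(2) B(1)])
    ultimately show ?thesis using has_invariants_add_small[OF inv1] by simp
  qed
  moreover have "disc_convergent nrm (H1 * L1 + H2 * L2)"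
    using 1(2) 2(2) unfolding fps_over_OK_iff
    by (intro disc_convergent_add disc_convergent_mult_bounded[OF int_fps_disc_convergent B(2)]
        disc_convergent_mult_bounded[OF int_fps_disc_convergent L(2)]) blast+
  moreover have "fps_of_poly (C $ 1 $ s) * L1 + fps_of_poly (C $ 1 $ t) * L2
    = (G1 * L1 + G2 * L2) + ?W * (H1 * L1 + H2 * L2)"
    unfolding 1(4) 2(4) by (simp add: algebra_simps)
  ultimately show ?thesis using that by blast
qed

end

text \<open>By \<open>q_num_bound\<close> and k - 1 \<le> p - 1, the main term is at most p^n (p -
  1) / (p + 1). This leaves room 2 p^n / (p + 1) for the constant d.\<close>

lemma degree_bound_eventually:
  fixes p k d :: nat
  assumes p: "p \<ge> 2" and k: "k - 1 < p"
  shows "\<forall>\<^sub>F n in sequentially. (k - 1) * q_num p n + d < p ^ n"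
proof (rule eventually_sequentiallyI)
  fix n assume n: "n \<ge> (p + 1) * d"
  have "(p + 1) * ((k - 1) * q_num p n) = (k - 1) * ((p + 1) * q_num p n)" by (simp only: mult_ac)
  also have "\<dots> \<le> (p - 1) * p ^ n"
    using k q_num_bound[of p n] p by (intro mult_mono) auto
  finally have 1: "(p + 1) * ((k - 1) * q_num p n) \<le> (p - 1) * p ^ n" .
  have "n < 2 ^ n" by (rule less_exp)
  also have "2 ^ n \<le> p ^ n" using p by (intro power_mono) auto
  finally have "(p + 1) * d < 2 * p ^ n" using n by linarith
  then have "(p + 1) * ((k - 1) * q_num p n + d) < (p - 1) * p ^ n + 2 * p ^ n"
    using 1 by (simp add: distrib_left)
  also have "\<dots> = (p + 1) * p ^ n"
    using p by (simp flip: distrib_right)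
  finally show "(k - 1) * q_num p n + d < p ^ n" using mult_less_cancel1 by blast
qed

theorem theoremA:
  fixes p N k :: nat
    and nrm :: "'a::{alg_closed_field, field_char_0} \<Rightarrow> real"
    and \<iota> :: "complex \<Rightarrow> 'a"
    and K :: "'a set" and \<pi> u \<alpha> \<beta> :: 'a
    and \<epsilon> :: "int \<Rightarrow> complex" and f :: "complex \<Rightarrow> complex" and a :: "nat \<Rightarrow> complex"
    and red :: "'a \<Rightarrow> 'f::field"
    and \<rho> :: "(complex \<Rightarrow> complex) \<Rightarrow> 'a^2^2"
    and \<rho>bar :: "(complex \<Rightarrow> complex) \<Rightarrow> 'f^2^2"
    and \<phi> :: "int \<Rightarrow> 'a msym"
    and C :: "nat \<Rightarrow> 'a poly^2^2" and M :: "'a fps^2^2"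
    and L\<alpha> L\<beta> Lsharp Lflat :: "'a fps"
  assumes p: "odd p" "is_Qp_closure p nrm"
    and \<iota>: "is_embedding \<iota>"
    and k: "k \<ge> 2" and N: "\<not> p dvd N"
    and newform: "is_newform k N \<epsilon> f a"
    and K: "is_finite_ext nrm K" "\<forall>n. \<iota> (a n) \<in> K" "\<forall>m. \<iota> (\<epsilon> m) \<in> K"
    and \<pi>: "is_uniformizer nrm K \<pi>"
    and nonordinary: "\<iota> (a p) \<notin> int_units nrm K"
    and red: "is_residue_map nrm red"
    and \<rho>: "is_deligne_rep p nrm \<iota> K k N \<epsilon> a \<rho>"
    and \<rho>bar: "is_reduction nrm K red \<rho> \<rho>bar" "is_irreducible_rep \<rho>bar"
    and p_large: "p > k - 1"
    and \<phi>: "is_normalized_symbol nrm \<iota> K f (k - 2) 1 (\<phi> 1)"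
           "is_normalized_symbol nrm \<iota> K f (k - 2) (-1) (\<phi> (-1))"
    and u: "is_generator p nrm u"
    and roots: "[:- \<alpha>, 1:] * [:- \<beta>, 1:] =
                  [:\<iota> (\<epsilon> (int p)) * of_nat p ^ (k - 1), - \<iota> (a p), 1:]" "\<alpha> \<noteq> \<beta>"
    and L\<alpha>: "is_Lp p nrm u (adjoin K {\<alpha>, \<beta>}) k (\<iota> (\<epsilon> (int p))) \<phi> \<alpha> 0 L\<alpha>"
    and L\<beta>: "is_Lp p nrm u (adjoin K {\<alpha>, \<beta>}) k (\<iota> (\<epsilon> (int p))) \<phi> \<beta> 0 L\<beta>"
    and C: "\<forall>n. is_C_mat p nrm u K k (\<iota> (\<epsilon> (int p))) (\<iota> (a p)) n (C n)"
    and M: "is_Mlog p nrm k (\<iota> (\<epsilon> (int p))) (\<iota> (a p)) C M"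
    and signed: "is_signed_pair nrm K \<alpha> \<beta> M L\<alpha> L\<beta> Lsharp Lflat"
    and mu: "mu_inv nrm \<pi> (fps_nth Lsharp) = mu_inv nrm \<pi> (fps_nth Lflat)"
            "mu_inv nrm \<pi> (fps_nth Lflat) \<noteq> \<infinity>"
  shows "\<forall>\<^sub>F n in sequentially.
           let Q = coeff (gr_poly p n (Theta p nrm u k \<phi> 0 n 0));
               L = fps_nth (if odd n then Lflat else Lsharp)
           in mu_inv nrm \<pi> Q = mu_inv nrm \<pi> L \<and>
              lambda_inv nrm \<pi> Q = enat ((k - 1) * q_num p n) + lambda_inv nrm \<pi> L"
proof -
  have closure: "nonarch_abs nrm" "prime p" "nrm (of_nat p) = 1 / real p"
    "\<And>s :: nat \<Rightarrow> rat. pcauchy nrm (\<lambda>n. of_rat (s n)) \<Longrightarrow> \<exists>x. plim nrm (\<lambda>n. of_rat (s n)) x"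
    using p(2) unfolding is_Qp_closure_def by blast+
  interpret padic_red nrm p K u red
    by unfold_locales (fact closure(1-3) p(1) K(1) u red | erule closure(4))+
  define e where "e = \<iota> (\<epsilon> (int p))"
  define ap where "ap = \<iota> (a p)"
  have CC: "is_C_mat p nrm u K k e ap n (C n)" for n using C by (simp add: e_def ap_def)
  \<comment> \<open>The nebentype at p is a root of unity, so its image has norm 1.\<close>
  have "coprime (int p) (int N)" using N prime_p by (simp add: prime_imp_coprime)
  then have "dirichlet_char N \<epsilon>" "N > 0" "\<epsilon> (int p) \<noteq> 0"
    using newform N by (auto simp: is_newform_def dirichlet_char_def intro: Nat.gr0I)
  then obtain t where t: "t > 0" "\<epsilon> (int p) ^ t = 1"
    by (rule dirichlet_char_root_of_unity)
  have "(\<epsilon> (int p) ^ n) ^ t = 1" for n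
    using t(2) by (metis mult.commute power_mult power_one)
  then have "e ^ t = \<iota> (\<epsilon> (int p) ^ t)"
    unfolding e_def using is_embedding_power[OF \<iota>] algebraic_root_of_unity[OF t(1)] by metis
  then have et: "e ^ t = 1" using t(2) \<iota> by (simp add: is_embedding_def)
  then have "nrm e ^ t = 1" by (metis nrm_1 nrm_power)
  then have e1: "nrm e = 1"
    using t(1) power_eq_imp_eq_base[of "nrm e" t 1] by simp
  have e: "e \<in> K" "e \<noteq> 0" "nrm e \<le> 1" using K(3) e1 by (auto simp: e_def)
  have apK: "ap \<in> K" using K(2) by (simp add: ap_def)
  have ap_le: "nrm ap \<le> 1" by (rule C_mat_imp_integral[OF CC k e(2)])
  \<comment> \<open>\<open>nonordinary\<close> only says that ap is not a unit of the ring of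
    integers; together with integrality this gives norm below 1.\<close>
  have ap_less: "nrm ap < 1"
  proof (rule ccontr)
    assume "\<not> nrm ap < 1"
    then have "nrm ap = 1" using ap_le by simp
    moreover from this have "ap \<noteq> 0" by auto
    moreover have "inverse ap \<in> K" using apK K_subfield by (simp add: is_subfield_def)
    ultimately have "ap \<in> int_units nrm K"
      using apK by (simp add: int_units_def int_ring_def nrm_inverse)
    then show False using nonordinary by (simp add: ap_def)
  qed
  interpret LM: log_matrix nrm p K u k e ap C M
    by unfold_locales (fact k e apK ap_le CC M[folded e_def ap_def])+
  have ab: "e * of_nat p ^ (k - 1) = \<alpha> * \<beta>" "ap = \<alpha> + \<beta>"
    using roots(1) by (simp_all add: e_def ap_def algebra_simps)
  have "\<alpha> * \<beta> \<noteq> 0" unfolding ab(1)[symmetric] using e(2) p_gt_1 by simp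
  then have ab0: "\<alpha> \<noteq> 0" "\<beta> \<noteq> 0" by auto
  have overK: "fps_nth Lsharp i \<in> K" "fps_nth Lflat i \<in> K" for i
    using signed by (auto simp: is_signed_pair_def fps_over_def)
  obtain B0 where B0: "\<And>i. nrm (fps_nth Lsharp i) \<le> B0" "\<And>i. nrm (fps_nth Lflat i) \<le> B0"
    using signed unfolding is_signed_pair_def by blast
  have nonzero: "\<exists>i. c i \<noteq> 0" if "mu_inv nrm \<pi> c \<noteq> \<infinity>" for c
  proof (rule ccontr)
    assume "\<not> ?thesis"
    then have "mu_inv nrm \<pi> c = \<infinity>" by (simp add: mu_inv_def ord_unif_def)
    with that show False by simp
  qed
  obtain i where "fps_nth Lsharp i \<noteq> 0" using nonzero[of "fps_nth Lsharp"] mu by auto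
  then obtain Bs ds where s: "has_invariants (fps_nth Lsharp) Bs ds"
    by (rule has_invariants_exists[OF \<pi> K_subfield overK(1) B0(1)])
  obtain j where "fps_nth Lflat j \<noteq> 0" using nonzero[of "fps_nth Lflat"] mu by auto
  then obtain Bf df where f: "has_invariants (fps_nth Lflat) Bf df"
    by (rule has_invariants_exists[OF \<pi> K_subfield overK(2) B0(2)])
  note inv_s = has_invariants_mu_lambda[OF \<pi> s] and inv_f = has_invariants_mu_lambda[OF \<pi> f]
  \<comment> \<open>Equal \<mu>-invariants mean equal Gauss norms, so each series is bounded by the
    norm of the other.\<close>
  have "log (nrm \<pi>) Bs = log (nrm \<pi>) Bf" using mu(1) inv_s(1) inv_f(1) by simp
  moreover have "0 < nrm \<pi>" "nrm \<pi> < 1" using \<pi> by (auto simp: is_uniformizer_def)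
  moreover have "Bs > 0" "Bf > 0" using s f by (auto simp: has_invariants_def)
  ultimately have Beq: "Bs = Bf" by (simp add: log_def)
  have bounds: "nrm (fps_nth Lsharp i) \<le> Bf" "nrm (fps_nth Lflat i) \<le> Bs" for i
    using s f Beq by (auto simp: has_invariants_def)
  have "p \<ge> 2" using p_gt_1 by simp
  note ev = degree_bound_eventually[OF this p_large]
  show ?thesis
    using ev[of ds] ev[of df] eventually_ge_at_top[of 1]
  proof eventually_elim
    case (elim n)
    let ?T = "gr_poly p n (Theta p nrm u k \<phi> 0 n 0)"
    obtain H where H: "disc_convergent nrm H" "fps_of_poly ?T = fps_of_poly (C n $ 1 $ 1) * Lsharp
        + fps_of_poly (C n $ 1 $ 2) * Lflat + omega_fps n * H"
      by (rule LM.Theta_cong[OF ab ab0 roots(2) L\<alpha>[folded e_def] L\<beta>[folded e_def] signed elim(3)])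
    have deg: "degree ?T < degree (omega p n :: 'a poly)"
      using degree_gr_poly[of p n] p_gt_1 omega_distinguished(2)[of n] by simp
    \<comment> \<open>The error terms of the two congruences merge into one multiple of
      \<open>\<omega>\<^sub>n\<close>, so that \<open>has_invariants_remainder\<close> applies to
      the Mazur--Tate polynomial.\<close>
    have key: "has_invariants (coeff ?T) B (d + d')"
      if "disc_convergent nrm H'" "has_invariants (fps_nth F) B (d + d')" "d + d' < p ^ n"
        "fps_of_poly (C n $ 1 $ 1) * Lsharp + fps_of_poly (C n $ 1 $ 2) * Lflat = F + omega_fps n * H'"
      for H' F B d d'
    proof (rule has_invariants_remainder[OF omega_distinguished(1) deg _ disc_convergent_add[OF that(1) H(1)] that(2)])
      show "fps_of_poly ?T = F + omega_fps n * (H' + H)"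
        unfolding H(2) that(4) by (simp add: algebra_simps)
      show "d + d' < degree (omega p n :: 'a poly)" using that(3) omega_distinguished(2)[of n] by simp
    qed
    show ?case
    proof (cases "odd n")
      case True
      obtain H' F where HF: "disc_convergent nrm H'" "has_invariants (fps_nth F) Bf ((k - 1) * q_num p n + df)"
        "fps_of_poly (C n $ 1 $ (if odd n then 2 else 1)) * Lflat + fps_of_poly (C n $ 1 $ (if odd n then 1 else 2)) * Lsharp
          = F + omega_fps n * H'"
        by (rule C_mat_invariants[OF CC k e1 ap_less f bounds(1)])
      have "has_invariants (coeff ?T) Bf ((k - 1) * q_num p n + df)"
        using HF True elim(2) by (intro key[of H' F]) (simp_all add: add.commute)
      from has_invariants_mu_lambda[OF \<pi> this] show ?thesis
        using True inv_f by (simp add: Let_def)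
    next
      case False
      obtain H' F where HF: "disc_convergent nrm H'" "has_invariants (fps_nth F) Bs ((k - 1) * q_num p n + ds)"
        "fps_of_poly (C n $ 1 $ (if odd n then 2 else 1)) * Lsharp + fps_of_poly (C n $ 1 $ (if odd n then 1 else 2)) * Lflat
          = F + omega_fps n * H'"
        by (rule C_mat_invariants[OF CC k e1 ap_less s bounds(2)])
      have "has_invariants (coeff ?T) Bs ((k - 1) * q_num p n + ds)"
        using HF False elim(1) by (intro key[of H' F]) simp_all
      from has_invariants_mu_lambda[OF \<pi> this] show ?thesis
        using False inv_s by (simp add: Let_def)
    qed
  qed
qed

end
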